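(* The Horn Superposition Calculus (with the inference rules Parallel Superposition and Equality Resolution on Horn clauses) together with the lifted redundancy criterion $(\mathrm{Red}_I^{\mathcal G},\mathrm{Red}_C^{\mathcal G})$ is refutationally complete: for every set $N$ of Horn clauses that is saturated, i.e. every Parallel Superposition or Equality Resolution inference whose premises are in $N$ belongs to $\mathrm{Red}_I^{\mathcal G}(N)$, if ${\mathcal G}(N)$ is unsatisfiable (equivalently, $N$ is unsatisfiable in first-order logic with equality), then $\bot\in N$.
   Context: Fix a signature and a reduction ordering $\succ$ on terms that is total on ground terms. A clause is a finite multiset of equational literals $s\approx t$ or $s\not\approx t$ ($\approx$ symmetric), written as a disjunction; $\bot$ is the empty clause; a Horn clause has at most one positive literal. The literal ordering $\succ_L$ maps $s\approx t$ to the multiset $\{s,t\}$ and $s\not\approx t$ to $\{s,s,t,t\}$ and compares these by the multiset extension of $\succ$; the clause ordering $\succ_C$ is the multiset extension of $\succ_L$. A literal $L$ is maximal in $C\lor L$ if no literal of $C$ is larger than $L$, strictly maximal if no literal of $C$ is larger than or equal to $L$. Most general unifiers are idempotent. General inference rules. Parallel Superposition: from $D'\lor t\approx t'$ and $C[u,\dots,u]_{p_1,\dots,p_k}$ (renamed apart) derive $(D'\lor C[t',\dots,t']_{p_1,\dots,p_k})\sigma$, where $u$ is not a variable; $\sigma=\mathrm{mgu}(t\doteq u)$; $p_1,\dots,p_k$ are all occurrences of $u$ in $C$; if one of the occurrences of $u$ in $C$ is in a negative literal or below the top in a positive literal then $C\sigma\not\preceq_C(D'\lor t\approx t')\sigma$;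 $(t\approx t')\sigma$ is strictly maximal in $(D'\lor t\approx t')\sigma$; either one occurrence of $u$ is in a positive literal $L[u]=s[u]\approx s'$ with $L[u]\sigma$ strictly maximal in $C\sigma$, or one occurrence is in a negative literal $L[u]=s[u]\not\approx s'$ with $L[u]\sigma$ maximal in $C\sigma$; $t\sigma\not\preceq t'\sigma$; $s\sigma\not\preceq s'\sigma$. Equality Resolution: from $C'\lor s\not\approx s'$ derive $C'\sigma$, where $\sigma=\mathrm{mgu}(s\doteq s')$ and $(s\not\approx s')\sigma$ is maximal in $(C'\lor s\not\approx s')\sigma$. Ground closures. A ground closure $(C\cdot\theta)$ is a clause $C$ with a substitution $\theta$ such that $C\theta$ is ground; $(C_1\cdot\theta_1)$ and $(C_2\cdot\theta_2)$ are identified when $C_1,C_2$ are equal up to bijective variable renaming and $C_1\theta_1=C_2\theta_2$; $(\bot\cdot\theta)=\bot$. A ground rewrite system $R$ is contained in $\succ$ if $u\succ v$ for all $u\to v\in R$, left-reduced if no left-hand side $u$ of $u\to v\in R$ is reducible by $R\setminus\{u\to v\}$; $t{\downarrow}_R$ is the $R$-normal form; $R\models(C\cdot\theta)$ means $C\theta$ is true in the equational interpretation generated by $R$. Normalization closure ordering. For a clause $C$: $\mathrm{ss}^-(C)$ is the set of all subterms (at any position, including the top) of sides of negative literals of $C$; $\mathrm{ss}^+_{>\epsilon}(C)$ the set of subterms at non-top positions of sides of positive literals; $\mathrm{ts}^-(C)$ the set of sides of negative literals; $\mathrm{ts}^+(C)$ the set of sides of positive literals. $\mathrm{lss}(C)=\{(t,2)\mid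 t\in\mathrm{ss}^-(C)\}\cup\{(t,1)\mid t\in\mathrm{ss}^+_{>\epsilon}(C)\setminus\mathrm{ss}^-(C)\}\cup\{(t,0)\mid t\in\mathrm{ts}^+(C)\setminus(\mathrm{ss}^+_{>\epsilon}(C)\cup\mathrm{ss}^-(C))\}$, $\mathrm{lts}(C)=\{(t,2)\mid t\in\mathrm{ts}^-(C)\}\cup\{(t,0)\mid t\in\mathrm{ts}^+(C)\setminus\mathrm{ts}^-(C)\}$. For $R$ left-reduced, ground, contained in $\succ$, a ground term $t$ and $m\in\{0,1,2\}$: $\mathrm{rm}_R(t,m)=\emptyset$ if $t$ is $R$-irreducible; $=\{(u,m)\}\cup\mathrm{rm}_R(t',m)$ if $t\to_R t'$ with rule $u\to v$ at position $p$ with $p=\epsilon$ or $m>0$; $=\{(u,1)\}\cup\mathrm{rm}_R(t',m)$ if $t\to_Rt'$ with $u\to v$ at $p>\epsilon$ and $m=0$ (independent of the reduction chosen). $\mathrm{nm}_R(C\cdot\theta)=\bigcup_{(f(t_1,\dots,t_n),m)\in\mathrm{lss}(C)}\mathrm{rm}_R(f(t_1\theta{\downarrow}_R,\dots,t_n\theta{\downarrow}_R),m)\cup\bigcup_{(x,m)\in\mathrm{lss}(C),\,x\text{ variable}}\mathrm{rm}_R(x\theta,m)\cup\bigcup_{(t,m)\in\mathrm{lts}(C)}\{(t\theta{\downarrow}_R,m)\}$ (multiset unions). Fix a well-founded ordering $\succ_{Clo}$ on ground closures, total on closures with equal ground instance, such that $(C\cdot\theta_1)\succ_{Clo}(D\cdot\theta_2)$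 whenever $C\theta_1=D\theta_2$ and $D$ is an instance of $C$ but not vice versa. $\succ\!\!\succ_R$ is the lexicographic combination of (1) the multiset extension of the lexicographic combination of $\succ$ (on terms) and $>$ (on labels), applied to the $\mathrm{nm}_R$ multisets; (2) $\succ_C$ on the ground instances; (3) $\succ_{Clo}$. $\prec\!\!\prec_R$ is its converse. Ground closure inferences (premises renamed apart, sharing one $\theta$). Parallel Superposition I: from $(D'\lor t\approx t'\cdot\theta)$ and $(C[u,\dots,u]_{p_1,\dots,p_k}\cdot\theta)$ derive $((D'\lor C[t',\dots,t']_{p_1,\dots,p_k})\sigma\cdot\theta)$ where $u$ is not a variable, $t\theta=u\theta$, $\sigma=\mathrm{mgu}(t\doteq u)$, $p_1,\dots,p_k$ all occurrences of $u$ in $C$; if one occurrence of $u$ is in a negative literal or below the top in a positive literal then $(D'\lor t\approx t')\theta\prec_C C\theta$; one occurrence of $u$ is in a positive literal $s[u]\approx s'$ with $(s[u]\approx s')\theta$ strictly maximal in $C\theta$ or in a negative literal $s[u]\not\approx s'$ with $(s[u]\not\approx s')\theta$ maximal in $C\theta$; $s[u]\theta\succ s'\theta$; $(t\approx t')\theta$ strictly maximal in $(D'\lor t\approx t')\theta$; $t\theta\succ t'\theta$. Parallel Superposition II: from $(D'\lor t\approx t'\cdot\theta)$ and $(C\cdot\theta)$ derive $(D'\lor C\cdot\theta[x\mapsto u[t'\theta]])$ where $x$ is a variable of $C$ with $x\theta=u[t\theta]$ ($t\theta$ occurs in $x\theta$, replaced by $t'\theta$ at that position), with the same conditions as Parallel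 Superposition I with $x$ in place of $u$. Equality Resolution: from $(C'\lor s\not\approx s'\cdot\theta)$ derive $(C'\sigma\cdot\theta)$ where $s\theta=s'\theta$, $\sigma=\mathrm{mgu}(s\doteq s')$, $(s\not\approx s')\theta$ maximal in $(C'\lor s\not\approx s')\theta$. The second (resp. only) premise is the right (resp. only) premise. Redundancy for a set $N$ of ground closures: $(C\cdot\theta)\in\mathrm{Red}_C(N)$ iff for every left-reduced ground rewrite system $R$ contained in $\succ$, $R\models(C\cdot\theta)$ or some $(D\cdot\theta')\in N$ has $(D\cdot\theta')\prec\!\!\prec_R(C\cdot\theta)$ and $R\not\models(D\cdot\theta')$. A ground inference $\iota$ with right/only premise $(C\cdot\theta)$ is in $\mathrm{Red}_I(N)$ iff for every such $R$: (i) $R\models\mathrm{concl}(\iota)$, or (ii) some $(C'\cdot\theta')\in N$ has $(C'\cdot\theta')\prec\!\!\prec_R(C\cdot\theta)$ and $R\not\models(C'\cdot\theta')$, or (iii) $\iota$ is a Parallel Superposition inference with left premise $(D'\lor t\approx t'\cdot\theta)$, $t\theta\succ t'\theta$, and $(t\theta\to t'\theta)\notin R$, or (iv) $\iota$ is a Parallel Superposition inference whose left premise is not the $\succ\!\!\succ_R$-minimal premise. Grounding and lifting. The ground instances ${\mathcal G}(C)$ of a clause $C$ are all ground closures $(C\cdot\theta)$. A ground instance of a general inference $C_n\dots C_1/C_0$ is any ground closure inference $(C_n\cdot\theta)\dots(C_1\cdot\theta)/(C_0\cdot\theta)$; ${\mathcal G}(\iota)$ is the set of these; ${\mathcal G}(N)=\bigcup_{C\in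 N}{\mathcal G}(C)$. $\iota\in\mathrm{Red}_I^{\mathcal G}(N)$ iff ${\mathcal G}(\iota)\subseteq\mathrm{Red}_I({\mathcal G}(N))$; $C\in\mathrm{Red}_C^{\mathcal G}(N)$ iff ${\mathcal G}(C)\subseteq\mathrm{Red}_C({\mathcal G}(N))$.
   Formalization: The parenthetical "equivalently, N is unsatisfiable" is stated only for signatures with at least one constant; without ground terms it fails, e.g. N = {x ≉ x} is saturated and unsatisfiable while G(N) is empty. *)

theory Defs
  imports Main "HOL-Library.Multiset" "HOL-Library.Uprod" "HOL-Library.Infinite_Typeclass"
begin

section \<open>Terms, substitutions, clauses\<close>

datatype (syms_trm: 'f, vars_trm: 'v) trm = is_Var: Var 'v | Fun 'f "('f, 'v) trm list"

datatype ('f, 'v) ctxt = Hole | More 'f "('f, 'v) trm list" "('f, 'v) ctxt" "('f, 'v) trm list"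

fun plug :: "('f, 'v) ctxt \<Rightarrow> ('f, 'v) trm \<Rightarrow> ('f, 'v) trm" where
  "plug Hole t = t"
| "plug (More f ss c ts) t = Fun f (ss @ plug c t # ts)"

text \<open>A signature is a set of function symbols with their arities; all notions below are relative
  to the terms over it.\<close>

type_synonym 'f signature = "('f \<times> nat) set"

fun wf_trm :: "'f signature \<Rightarrow> ('f, 'v) trm \<Rightarrow> bool" where
  "wf_trm F (Var x) \<longleftrightarrow> True"
| "wf_trm F (Fun f ts) \<longleftrightarrow> (f, length ts) \<in> F \<and> (\<forall>t \<in> set ts. wf_trm F t)"

definition ground_trm :: "'f signature \<Rightarrow> ('f, 'v) trm \<Rightarrow> bool" where
  "ground_trm F t \<longleftrightarrow> wf_trm F t \<and> vars_trm t = {}"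

fun subterms :: "('f, 'v) trm \<Rightarrow> ('f, 'v) trm set" where
  "subterms (Var x) = {Var x}"
| "subterms (Fun f ts) = insert (Fun f ts) (\<Union>t \<in> set ts. subterms t)"

fun proper_subterms :: "('f, 'v) trm \<Rightarrow> ('f, 'v) trm set" where
  "proper_subterms (Var x) = {}"
| "proper_subterms (Fun f ts) = (\<Union>t \<in> set ts. subterms t)"

text \<open>Replacement of all occurrences of \<open>u\<close> by \<open>u'\<close>.\<close>

fun replace_trm :: "('f, 'v) trm \<Rightarrow> ('f, 'v) trm \<Rightarrow> ('f, 'v) trm \<Rightarrow> ('f, 'v) trm" where
  "replace_trm u u' (Var x) = (if Var x = u then u' else Var x)"
| "replace_trm u u' (Fun f ts) = (if Fun f ts = u then u' else Fun f (map (replace_trm u u') ts))"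

type_synonym ('f, 'v) subst = "'v \<Rightarrow> ('f, 'v) trm"

fun subst_trm :: "('f, 'v) trm \<Rightarrow> ('f, 'v) subst \<Rightarrow> ('f, 'v) trm" (infixl "\<cdot>" 67) where
  "Var x \<cdot> \<sigma> = \<sigma> x"
| "Fun f ts \<cdot> \<sigma> = Fun f (map (\<lambda>t. t \<cdot> \<sigma>) ts)"

text \<open>Most general unifiers are required to be idempotent.\<close>

definition is_mgu :: "('f, 'v) subst \<Rightarrow> ('f, 'v) trm \<Rightarrow> ('f, 'v) trm \<Rightarrow> bool" where
  "is_mgu \<sigma> s t \<longleftrightarrow> s \<cdot> \<sigma> = t \<cdot> \<sigma>
     \<and> (\<forall>\<tau>. s \<cdot> \<tau> = t \<cdot> \<tau> \<longrightarrow> (\<exists>\<delta>. \<forall>x. \<tau> x = \<sigma> x \<cdot> \<delta>))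
     \<and> (\<forall>x. \<sigma> x \<cdot> \<sigma> = \<sigma> x)"

text \<open>An equation is an unordered pair of terms.\<close>

datatype 't literal = is_Pos: Pos "'t uprod" | Neg "'t uprod"

type_synonym ('f, 'v) lit = "('f, 'v) trm literal"
type_synonym ('f, 'v) cls = "('f, 'v) trm literal multiset"

definition subst_lit :: "('f, 'v) lit \<Rightarrow> ('f, 'v) subst \<Rightarrow> ('f, 'v) lit" (infixl "\<cdot>l" 67) where
  "L \<cdot>l \<sigma> = map_literal (\<lambda>t. t \<cdot> \<sigma>) L"

definition subst_cls :: "('f, 'v) cls \<Rightarrow> ('f, 'v) subst \<Rightarrow> ('f, 'v) cls" (infixl "\<cdot>c" 67) where
  "C \<cdot>c \<sigma> = image_mset (\<lambda>L. L \<cdot>l \<sigma>) C"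

definition replace_cls :: "('f, 'v) trm \<Rightarrow> ('f, 'v) trm \<Rightarrow> ('f, 'v) cls \<Rightarrow> ('f, 'v) cls" where
  "replace_cls u u' C = image_mset (map_literal (replace_trm u u')) C"

definition trms_cls :: "('f, 'v) cls \<Rightarrow> ('f, 'v) trm set" where
  "trms_cls C = (\<Union>L \<in> set_mset C. set_literal L)"

definition vars_cls :: "('f, 'v) cls \<Rightarrow> 'v set" where
  "vars_cls C = (\<Union>t \<in> trms_cls C. vars_trm t)"

definition wf_cls :: "'f signature \<Rightarrow> ('f, 'v) cls \<Rightarrow> bool" where
  "wf_cls F C \<longleftrightarrow> (\<forall>t \<in> trms_cls C. wf_trm F t)"

definition ground_cls :: "'f signature \<Rightarrow> ('f, 'v) cls \<Rightarrow> bool" where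
  "ground_cls F C \<longleftrightarrow> (\<forall>t \<in> trms_cls C. ground_trm F t)"

definition horn :: "('f, 'v) cls \<Rightarrow> bool" where
  "horn C \<longleftrightarrow> size (filter_mset is_Pos C) \<le> 1"

definition variant :: "('f, 'v) cls \<Rightarrow> ('f, 'v) cls \<Rightarrow> bool" where
  "variant C D \<longleftrightarrow> (\<exists>\<pi>. bij \<pi> \<and> D = C \<cdot>c (\<lambda>x. Var (\<pi> x)))"

definition instance_of :: "('f, 'v) cls \<Rightarrow> ('f, 'v) cls \<Rightarrow> bool" where
  "instance_of D C \<longleftrightarrow> (\<exists>\<tau>. D = C \<cdot>c \<tau>)"

section \<open>Orderings\<close>

text \<open>Orderings are represented by their ``less than'' relation: \<open>lt s t\<close> stands for \<open>t \<succ> s\<close>.\<close>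

type_synonym 'a rel2 = "'a \<Rightarrow> 'a \<Rightarrow> bool"

definition reduction_ordering :: "'f signature \<Rightarrow> ('f, 'v) trm rel2 \<Rightarrow> bool" where
  "reduction_ordering F lt \<longleftrightarrow>
     (\<forall>s t. lt s t \<longrightarrow> wf_trm F s \<and> wf_trm F t)
     \<and> transp lt \<and> wfp lt
     \<and> (\<forall>s t \<sigma>. lt s t \<longrightarrow> (\<forall>x. wf_trm F (\<sigma> x)) \<longrightarrow> lt (s \<cdot> \<sigma>) (t \<cdot> \<sigma>))
     \<and> (\<forall>s t c. lt s t \<longrightarrow> wf_trm F (plug c t) \<longrightarrow> lt (plug c s) (plug c t))"

definition total_on_ground :: "'f signature \<Rightarrow> ('f, 'v) trm rel2 \<Rightarrow> bool" where
  "total_on_ground F lt \<longleftrightarrow> totalp_on {t. ground_trm F t} lt"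

lift_definition mset_uprod :: "'a uprod \<Rightarrow> 'a multiset" is "\<lambda>(a, b). {#a, b#}"
  by (auto simp: add_mset_commute)

fun mset_lit :: "('f, 'v) lit \<Rightarrow> ('f, 'v) trm multiset" where
  "mset_lit (Pos e) = mset_uprod e"
| "mset_lit (Neg e) = mset_uprod e + mset_uprod e"

definition lt_lit :: "('f, 'v) trm rel2 \<Rightarrow> ('f, 'v) lit rel2" where
  "lt_lit lt L K \<longleftrightarrow> multp lt (mset_lit L) (mset_lit K)"

definition lt_cls :: "('f, 'v) trm rel2 \<Rightarrow> ('f, 'v) cls rel2" where
  "lt_cls lt = multp (lt_lit lt)"

definition maximal_lit :: "('f, 'v) trm rel2 \<Rightarrow> ('f, 'v) lit \<Rightarrow> ('f, 'v) cls \<Rightarrow> bool" where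
  "maximal_lit lt L C \<longleftrightarrow> L \<in># C \<and> (\<forall>K \<in># C - {#L#}. \<not> lt_lit lt L K)"

definition strictly_maximal_lit :: "('f, 'v) trm rel2 \<Rightarrow> ('f, 'v) lit \<Rightarrow> ('f, 'v) cls \<Rightarrow> bool" where
  "strictly_maximal_lit lt L C \<longleftrightarrow>
     L \<in># C \<and> (\<forall>K \<in># C - {#L#}. \<not> (lt_lit lt L K \<or> L = K))"

section \<open>Sets of labelled subterms\<close>

definition ts_neg :: "('f, 'v) cls \<Rightarrow> ('f, 'v) trm set" where
  "ts_neg C = (\<Union>e \<in> {e. Neg e \<in># C}. set_uprod e)"

definition ts_pos :: "('f, 'v) cls \<Rightarrow> ('f, 'v) trm set" where
  "ts_pos C = (\<Union>e \<in> {e. Pos e \<in># C}. set_uprod e)"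

definition ss_neg :: "('f, 'v) cls \<Rightarrow> ('f, 'v) trm set" where
  "ss_neg C = (\<Union>t \<in> ts_neg C. subterms t)"

definition ss_pos_below :: "('f, 'v) cls \<Rightarrow> ('f, 'v) trm set" where
  "ss_pos_below C = (\<Union>t \<in> ts_pos C. proper_subterms t)"

definition lss :: "('f, 'v) cls \<Rightarrow> (('f, 'v) trm \<times> nat) set" where
  "lss C = {(t, 2) | t. t \<in> ss_neg C}
     \<union> {(t, 1) | t. t \<in> ss_pos_below C - ss_neg C}
     \<union> {(t, 0) | t. t \<in> ts_pos C - (ss_pos_below C \<union> ss_neg C)}"

definition lts :: "('f, 'v) cls \<Rightarrow> (('f, 'v) trm \<times> nat) set" where
  "lts C = {(t, 2) | t. t \<in> ts_neg C} \<union> {(t, 0) | t. t \<in> ts_pos C - ts_neg C}"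

section \<open>Ground rewrite systems\<close>

type_synonym ('f, 'v) trs = "(('f, 'v) trm \<times> ('f, 'v) trm) set"

inductive rstep :: "('f, 'v) trs \<Rightarrow> ('f, 'v) trm rel2" for R where
  "(u, v) \<in> R \<Longrightarrow> rstep R (plug c u) (plug c v)"

definition irreducible :: "('f, 'v) trs \<Rightarrow> ('f, 'v) trm \<Rightarrow> bool" where
  "irreducible R t \<longleftrightarrow> (\<nexists>t'. rstep R t t')"

definition normal_form :: "('f, 'v) trs \<Rightarrow> ('f, 'v) trm \<Rightarrow> ('f, 'v) trm" where
  "normal_form R t = (THE t'. (rstep R)\<^sup>*\<^sup>* t t' \<and> irreducible R t')"

text \<open>The rewrite systems that the redundancy notions range over: ground, contained in the ordering,
  and left-reduced (hence terminating and confluent).\<close>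

definition admissible :: "'f signature \<Rightarrow> ('f, 'v) trm rel2 \<Rightarrow> ('f, 'v) trs \<Rightarrow> bool" where
  "admissible F lt R \<longleftrightarrow>
     (\<forall>(u, v) \<in> R. ground_trm F u \<and> ground_trm F v \<and> lt v u \<and> irreducible (R - {(u, v)}) u)"

text \<open>Truth of a clause, where \<open>E\<close> is a symmetric relation interpreting equality.\<close>

fun true_lit :: "('f, 'v) trm rel2 \<Rightarrow> ('f, 'v) lit \<Rightarrow> bool" where
  "true_lit E (Pos e) \<longleftrightarrow> (\<exists>s t. e = Upair s t \<and> E s t)"
| "true_lit E (Neg e) \<longleftrightarrow> \<not> (\<exists>s t. e = Upair s t \<and> E s t)"

definition true_cls :: "('f, 'v) trm rel2 \<Rightarrow> ('f, 'v) cls \<Rightarrow> bool" where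
  "true_cls E C \<longleftrightarrow> (\<exists>L \<in># C. true_lit E L)"

section \<open>Ground closures and the normalization closure ordering\<close>

text \<open>Closures are represented by pairs. \<open>same_closure\<close> expresses when two pairs are identified.
  The tie-breaking ordering below is required to respect it; the other notions are invariant under
  renaming the clause and precomposing the substitution accordingly, so no quotient is formed.\<close>

type_synonym ('f, 'v) closure = "('f, 'v) cls \<times> ('f, 'v) subst"

fun inst :: "('f, 'v) closure \<Rightarrow> ('f, 'v) cls" where
  "inst (C, \<theta>) = C \<cdot>c \<theta>"

definition ground_closure :: "'f signature \<Rightarrow> ('f, 'v) closure \<Rightarrow> bool" where
  "ground_closure F c \<longleftrightarrow> ground_cls F (inst c)"

definition same_closure :: "('f, 'v) closure \<Rightarrow> ('f, 'v) closure \<Rightarrow> bool" where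
  "same_closure c d \<longleftrightarrow> variant (fst c) (fst d) \<and> inst c = inst d"

definition entails :: "('f, 'v) trs \<Rightarrow> ('f, 'v) closure \<Rightarrow> bool" where
  "entails R c \<longleftrightarrow> true_cls (equivclp (rstep R)) (inst c)"

text \<open>\<open>rm_rel R t m M\<close> holds if \<open>M\<close> is collected along some reduction of \<open>t\<close> to normal form. For
  admissible \<open>R\<close> and ground \<open>t\<close> there is exactly one such \<open>M\<close>.\<close>

inductive rm_rel :: "('f, 'v) trs \<Rightarrow> ('f, 'v) trm \<Rightarrow> nat \<Rightarrow> (('f, 'v) trm \<times> nat) multiset \<Rightarrow> bool"
  for R where
  irreducible: "irreducible R t \<Longrightarrow> rm_rel R t m {#}"
| same_label: "(u, v) \<in> R \<Longrightarrow> c = Hole \<or> m > 0 \<Longrightarrow> rm_rel R (plug c v) m M \<Longrightarrow>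
    rm_rel R (plug c u) m (add_mset (u, m) M)"
| below_top: "(u, v) \<in> R \<Longrightarrow> c \<noteq> Hole \<Longrightarrow> m = 0 \<Longrightarrow> rm_rel R (plug c v) m M \<Longrightarrow>
    rm_rel R (plug c u) m (add_mset (u, 1) M)"

definition rm :: "('f, 'v) trs \<Rightarrow> ('f, 'v) trm \<Rightarrow> nat \<Rightarrow> (('f, 'v) trm \<times> nat) multiset" where
  "rm R t m = (THE M. rm_rel R t m M)"

text \<open>The first two unions of the definition of \<open>nm\<close> are merged by a case distinction on the term.\<close>

fun nm :: "('f, 'v) trs \<Rightarrow> ('f, 'v) closure \<Rightarrow> (('f, 'v) trm \<times> nat) multiset" where
  "nm R (C, \<theta>) =
     (\<Sum>(t, m) \<in> lss C. case t of
        Fun f ts \<Rightarrow> rm R (Fun f (map (\<lambda>s. normal_form R (s \<cdot> \<theta>)) ts)) m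
      | Var x \<Rightarrow> rm R (\<theta> x) m)
     + (\<Sum>(t, m) \<in> lts C. {#(normal_form R (t \<cdot> \<theta>), m)#})"

fun lt_labelled :: "('f, 'v) trm rel2 \<Rightarrow> (('f, 'v) trm \<times> nat) rel2" where
  "lt_labelled lt (s, m) (t, n) \<longleftrightarrow> lt s t \<or> (s = t \<and> m < n)"

text \<open>The requirements on the ordering that breaks ties between closures with equal normalization
  multisets and equal ground instances.\<close>

definition tiebreak_ordering :: "'f signature \<Rightarrow> ('f, 'v) closure rel2 \<Rightarrow> bool" where
  "tiebreak_ordering F lt_clo \<longleftrightarrow>
     (\<forall>c d. lt_clo c d \<longrightarrow> ground_closure F c \<and> ground_closure F d)
     \<and> (\<forall>c c' d d'. same_closure c c' \<longrightarrow> same_closure d d' \<longrightarrow> lt_clo c d \<longrightarrow> lt_clo c' d')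
     \<and> transp lt_clo \<and> wfp lt_clo
     \<and> (\<forall>c d. ground_closure F c \<longrightarrow> ground_closure F d \<longrightarrow> inst c = inst d \<longrightarrow>
           lt_clo c d \<or> lt_clo d c \<or> same_closure c d)
     \<and> (\<forall>c d. ground_closure F c \<longrightarrow> ground_closure F d \<longrightarrow> inst c = inst d \<longrightarrow>
           instance_of (fst d) (fst c) \<longrightarrow> \<not> instance_of (fst c) (fst d) \<longrightarrow> lt_clo d c)"

definition lt_closure ::
  "('f, 'v) trm rel2 \<Rightarrow> ('f, 'v) closure rel2 \<Rightarrow> ('f, 'v) trs \<Rightarrow> ('f, 'v) closure rel2" where
  "lt_closure lt lt_clo R c d \<longleftrightarrow>
     multp (lt_labelled lt) (nm R c) (nm R d)
     \<or> nm R c = nm R d \<and> (lt_cls lt (inst c) (inst d)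
         \<or> inst c = inst d \<and> lt_clo c d)"

section \<open>Inferences\<close>

text \<open>Inferences on clauses and on ground closures. A parallel superposition inference records its
  left premise, the equation \<open>t \<approx> t'\<close> of the left premise in the orientation used, its right
  premise and its conclusion.\<close>

datatype ('t, 'c) inference =
  ParSup (left_prem: 'c) 't 't (main_prem: 'c) (concl: 'c)
| EqRes (main_prem: 'c) (concl: 'c)

fun prems :: "('t, 'c) inference \<Rightarrow> 'c set" where
  "prems (ParSup D t t' C E) = {D, C}"
| "prems (EqRes C E) = {C}"

subsection \<open>General inferences\<close>

definition overlap ::
  "('f, 'v) trm rel2 \<Rightarrow> ('f, 'v) trm \<Rightarrow> ('f, 'v) cls \<Rightarrow> ('f, 'v) subst \<Rightarrow> bool" where
  "overlap lt u C \<sigma> \<longleftrightarrow> (\<exists>s s'. u \<in> subterms s \<and> \<not> lt\<^sup>=\<^sup>= (s \<cdot> \<sigma>) (s' \<cdot> \<sigma>)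
     \<and> (Pos (Upair s s') \<in># C \<and> strictly_maximal_lit lt (Pos (Upair s s') \<cdot>l \<sigma>) (C \<cdot>c \<sigma>)
        \<or> Neg (Upair s s') \<in># C \<and> maximal_lit lt (Neg (Upair s s') \<cdot>l \<sigma>) (C \<cdot>c \<sigma>)))"

inductive_set inferences ::
  "('f, 'v) trm rel2 \<Rightarrow> (('f, 'v) trm, ('f, 'v) cls) inference set" for lt where
  par_sup: "ParSup D t t' C ((D' + replace_cls u t' C) \<cdot>c \<sigma>) \<in> inferences lt"
  if "D = add_mset (Pos (Upair t t')) D'"
    and "vars_cls D \<inter> vars_cls C = {}"
    and "\<not> is_Var u"
    and "is_mgu \<sigma> t u"
    and "u \<in> ss_neg C \<union> ss_pos_below C \<Longrightarrow> \<not> (lt_cls lt)\<^sup>=\<^sup>= (C \<cdot>c \<sigma>) (D \<cdot>c \<sigma>)"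
    and "strictly_maximal_lit lt (Pos (Upair t t') \<cdot>l \<sigma>) (D \<cdot>c \<sigma>)"
    and "overlap lt u C \<sigma>"
    and "\<not> lt\<^sup>=\<^sup>= (t \<cdot> \<sigma>) (t' \<cdot> \<sigma>)"
| eq_res: "EqRes C (C' \<cdot>c \<sigma>) \<in> inferences lt"
  if "C = add_mset (Neg (Upair s s')) C'"
    and "is_mgu \<sigma> s s'"
    and "maximal_lit lt (Neg (Upair s s') \<cdot>l \<sigma>) (C \<cdot>c \<sigma>)"

text \<open>Premises may be renamed, so that they can be made variable-disjoint.\<close>

definition inferences_from ::
  "('f, 'v) trm rel2 \<Rightarrow> ('f, 'v) cls set \<Rightarrow> (('f, 'v) trm, ('f, 'v) cls) inference set" where
  "inferences_from lt N = {\<iota> \<in> inferences lt. \<forall>C \<in> prems \<iota>. \<exists>D \<in> N. variant D C}"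

subsection \<open>Ground closure inferences\<close>

definition ground_overlap ::
  "('f, 'v) trm rel2 \<Rightarrow> ('f, 'v) trm \<Rightarrow> ('f, 'v) cls \<Rightarrow> ('f, 'v) subst \<Rightarrow> bool" where
  "ground_overlap lt u C \<theta> \<longleftrightarrow> (\<exists>s s'. u \<in> subterms s \<and> lt (s' \<cdot> \<theta>) (s \<cdot> \<theta>)
     \<and> (Pos (Upair s s') \<in># C \<and> strictly_maximal_lit lt (Pos (Upair s s') \<cdot>l \<theta>) (C \<cdot>c \<theta>)
        \<or> Neg (Upair s s') \<in># C \<and> maximal_lit lt (Neg (Upair s s') \<cdot>l \<theta>) (C \<cdot>c \<theta>)))"

inductive_set ground_inferences ::
  "'f signature \<Rightarrow> ('f, 'v) trm rel2 \<Rightarrow> (('f, 'v) trm, ('f, 'v) closure) inference set"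
  for F lt where
  par_sup_I:
  "ParSup (D, \<theta>) t t' (C, \<theta>) ((D' + replace_cls u t' C) \<cdot>c \<sigma>, \<theta>) \<in> ground_inferences F lt"
  if "ground_closure F (D, \<theta>)"
    and "ground_closure F (C, \<theta>)"
    and "D = add_mset (Pos (Upair t t')) D'"
    and "vars_cls D \<inter> vars_cls C = {}"
    and "\<not> is_Var u"
    and "t \<cdot> \<theta> = u \<cdot> \<theta>"
    and "is_mgu \<sigma> t u"
    and "u \<in> ss_neg C \<union> ss_pos_below C \<Longrightarrow> lt_cls lt (D \<cdot>c \<theta>) (C \<cdot>c \<theta>)"
    and "ground_overlap lt u C \<theta>"
    and "strictly_maximal_lit lt (Pos (Upair t t') \<cdot>l \<theta>) (D \<cdot>c \<theta>)"
    and "lt (t' \<cdot> \<theta>) (t \<cdot> \<theta>)"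
| par_sup_II:
  "ParSup (D, \<theta>) t t' (C, \<theta>) (D' + C, \<theta>(x := plug c (t' \<cdot> \<theta>))) \<in> ground_inferences F lt"
  if "ground_closure F (D, \<theta>)"
    and "ground_closure F (C, \<theta>)"
    and "D = add_mset (Pos (Upair t t')) D'"
    and "vars_cls D \<inter> vars_cls C = {}"
    and "x \<in> vars_cls C"
    and "\<theta> x = plug c (t \<cdot> \<theta>)"
    and "Var x \<in> ss_neg C \<union> ss_pos_below C \<Longrightarrow> lt_cls lt (D \<cdot>c \<theta>) (C \<cdot>c \<theta>)"
    and "ground_overlap lt (Var x) C \<theta>"
    and "strictly_maximal_lit lt (Pos (Upair t t') \<cdot>l \<theta>) (D \<cdot>c \<theta>)"
    and "lt (t' \<cdot> \<theta>) (t \<cdot> \<theta>)"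
| eq_res: "EqRes (C, \<theta>) (C' \<cdot>c \<sigma>, \<theta>) \<in> ground_inferences F lt"
  if "ground_closure F (C, \<theta>)"
    and "C = add_mset (Neg (Upair s s')) C'"
    and "s \<cdot> \<theta> = s' \<cdot> \<theta>"
    and "is_mgu \<sigma> s s'"
    and "maximal_lit lt (Neg (Upair s s') \<cdot>l \<theta>) (C \<cdot>c \<theta>)"

section \<open>Redundancy\<close>

definition Red_C ::
  "'f signature \<Rightarrow> ('f, 'v) trm rel2 \<Rightarrow> ('f, 'v) closure rel2 \<Rightarrow>
   ('f, 'v) closure set \<Rightarrow> ('f, 'v) closure set" where
  "Red_C F lt lt_clo N = {c. ground_closure F c \<and> (\<forall>R. admissible F lt R \<longrightarrow>
     entails R c \<or> (\<exists>d \<in> N. lt_closure lt lt_clo R d c \<and> \<not> entails R d))}"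

text \<open>The last disjunct states that the left premise is not minimal among the premises.\<close>

definition Red_I ::
  "'f signature \<Rightarrow> ('f, 'v) trm rel2 \<Rightarrow> ('f, 'v) closure rel2 \<Rightarrow>
   ('f, 'v) closure set \<Rightarrow> (('f, 'v) trm, ('f, 'v) closure) inference set" where
  "Red_I F lt lt_clo N = {\<iota> \<in> ground_inferences F lt. \<forall>R. admissible F lt R \<longrightarrow>
     entails R (concl \<iota>)
     \<or> (\<exists>c \<in> N. lt_closure lt lt_clo R c (main_prem \<iota>) \<and> \<not> entails R c)
     \<or> (\<exists>D \<theta> t t' c e. \<iota> = ParSup (D, \<theta>) t t' c e
           \<and> lt (t' \<cdot> \<theta>) (t \<cdot> \<theta>) \<and> (t \<cdot> \<theta>, t' \<cdot> \<theta>) \<notin> R)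
     \<or> (\<exists>d t t' c e. \<iota> = ParSup d t t' c e \<and> lt_closure lt lt_clo R c d)}"

definition ground_closures ::
  "'f signature \<Rightarrow> ('f, 'v) cls set \<Rightarrow> ('f, 'v) closure set" where
  "ground_closures F N = {(C, \<theta>) | C \<theta>. C \<in> N \<and> ground_closure F (C, \<theta>)}"

definition ground_instances ::
  "'f signature \<Rightarrow> ('f, 'v) trm rel2 \<Rightarrow> (('f, 'v) trm, ('f, 'v) cls) inference \<Rightarrow>
   (('f, 'v) trm, ('f, 'v) closure) inference set" where
  "ground_instances F lt \<iota> =
     {map_inference id (\<lambda>C. (C, \<theta>)) \<iota> | \<theta>. True} \<inter> ground_inferences F lt"

definition lifted_Red_C ::
  "'f signature \<Rightarrow> ('f, 'v) trm rel2 \<Rightarrow> ('f, 'v) closure rel2 \<Rightarrow>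
   ('f, 'v) cls set \<Rightarrow> ('f, 'v) cls set" where
  "lifted_Red_C F lt lt_clo N =
     {C. ground_closures F {C} \<subseteq> Red_C F lt lt_clo (ground_closures F N)}"

definition lifted_Red_I ::
  "'f signature \<Rightarrow> ('f, 'v) trm rel2 \<Rightarrow> ('f, 'v) closure rel2 \<Rightarrow>
   ('f, 'v) cls set \<Rightarrow> (('f, 'v) trm, ('f, 'v) cls) inference set" where
  "lifted_Red_I F lt lt_clo N =
     {\<iota>. ground_instances F lt \<iota> \<subseteq> Red_I F lt lt_clo (ground_closures F N)}"

definition saturated ::
  "'f signature \<Rightarrow> ('f, 'v) trm rel2 \<Rightarrow> ('f, 'v) closure rel2 \<Rightarrow> ('f, 'v) cls set \<Rightarrow> bool" where
  "saturated F lt lt_clo N \<longleftrightarrow> inferences_from lt N \<subseteq> lifted_Red_I F lt lt_clo N"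

section \<open>Satisfiability in first-order logic with equality\<close>

definition is_algebra :: "'f signature \<Rightarrow> 'a set \<Rightarrow> ('f \<Rightarrow> 'a list \<Rightarrow> 'a) \<Rightarrow> bool" where
  "is_algebra F U I \<longleftrightarrow> U \<noteq> {}
     \<and> (\<forall>(f, n) \<in> F. \<forall>as. length as = n \<longrightarrow> set as \<subseteq> U \<longrightarrow> I f as \<in> U)"

fun eval :: "('f \<Rightarrow> 'a list \<Rightarrow> 'a) \<Rightarrow> ('v \<Rightarrow> 'a) \<Rightarrow> ('f, 'v) trm \<Rightarrow> 'a" where
  "eval I \<beta> (Var x) = \<beta> x"
| "eval I \<beta> (Fun f ts) = I f (map (eval I \<beta>) ts)"

definition model ::
  "'f signature \<Rightarrow> 'a set \<Rightarrow> ('f \<Rightarrow> 'a list \<Rightarrow> 'a) \<Rightarrow> ('f, 'v) cls set \<Rightarrow> bool" where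
  "model F U I M \<longleftrightarrow> is_algebra F U I
     \<and> (\<forall>C \<in> M. \<forall>\<beta>. range \<beta> \<subseteq> U \<longrightarrow> true_cls (\<lambda>s t. eval I \<beta> s = eval I \<beta> t) C)"

text \<open>HOL cannot quantify over the type of the universe, so universes are taken to be sets of terms.
  This does not affect satisfiability: a satisfiable clause set has a model generated by a single
  element (take a subalgebra), and the elements of such a model can be represented by terms.\<close>

definition unsatisfiable :: "'f signature \<Rightarrow> ('f, 'v) cls set \<Rightarrow> bool" where
  "unsatisfiable F M \<longleftrightarrow>
     (\<nexists>(U :: ('f, 'v) trm set) I. model F U I M)"

end

theory Submission
  imports Defs "HOL-Library.Confluence"
begin

text \<open>Let \<open>N\<close> be saturated without \<open>\<bottom>\<close>. A ground rewrite system \<open>RN\<close> is built by recursion on ground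
  terms: an \<open>s\<close> that is irreducible by the rules with smaller left-hand sides receives a rule if some
  ground closure of \<open>N\<close> has a strictly maximal equation with larger side \<open>s\<close> and otherwise only
  false literals; the rule is taken from a minimal such closure. The closure ordering itself depends
  on the rewrite system, but the rules whose left-hand side is at least \<open>s\<close> change the normalization
  multisets of all these candidates by the same amount, so that minimality with respect to the rules
  below \<open>s\<close> is minimality with respect to \<open>RN\<close>.

  Suppose that \<open>C \<cdot> \<theta>\<close> is the smallest ground closure of \<open>N\<close> that is false in \<open>RN\<close>. Normalizing \<open>\<theta>\<close>
  makes the closure smaller without changing its truth value, so \<open>\<theta>\<close> is irreducible and Parallel
  Superposition II is never needed. The maximal literal of \<open>C \<cdot> \<theta>\<close> then admits an Equality Resolution
  or a Parallel Superposition inference from a rule-producing closure; otherwise \<open>C \<cdot> \<theta>\<close> itself would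
  be a candidate for a rule. The producing closure is not larger than \<open>C \<cdot> \<theta>\<close>: the redex of its maximal
  equation carries the smallest label, and if it carries the same label in \<open>C \<cdot> \<theta>\<close>, then \<open>C \<cdot> \<theta>\<close> was a
  candidate for the same rule. The conclusion is false in \<open>RN\<close>, so none of the four cases of
  redundancy applies.\<close>

section \<open>Terms and substitutions\<close>

lemma subst_trm_cong: "(\<And>x. x \<in> vars_trm t \<Longrightarrow> \<sigma> x = \<tau> x) \<Longrightarrow> t \<cdot> \<sigma> = t \<cdot> \<tau>"
  by (induction t) auto

lemma subst_trm_comp: "t \<cdot> \<sigma> \<cdot> \<tau> = t \<cdot> (\<lambda>x. \<sigma> x \<cdot> \<tau>)"
  by (induction t) auto

lemma subst_trm_Var [simp]: "t \<cdot> Var = t"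
  by (induction t) (auto intro: map_idI)

lemma vars_subst_trm: "vars_trm (t \<cdot> \<sigma>) = (\<Union>x \<in> vars_trm t. vars_trm (\<sigma> x))"
  by (induction t) auto

lemma wf_subst_trm: "wf_trm F t \<Longrightarrow> (\<And>x. x \<in> vars_trm t \<Longrightarrow> wf_trm F (\<sigma> x)) \<Longrightarrow> wf_trm F (t \<cdot> \<sigma>)"
  by (induction t) auto

lemma wf_subst_trmD: "wf_trm F (t \<cdot> \<sigma>) \<Longrightarrow> x \<in> vars_trm t \<Longrightarrow> wf_trm F (\<sigma> x)"
  by (induction t) auto

lemma subst_lit_comp: "L \<cdot>l \<sigma> \<cdot>l \<tau> = L \<cdot>l (\<lambda>x. \<sigma> x \<cdot> \<tau>)"
  by (simp add: subst_lit_def literal.map_comp comp_def subst_trm_comp)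

lemma subst_cls_comp: "C \<cdot>c \<sigma> \<cdot>c \<tau> = C \<cdot>c (\<lambda>x. \<sigma> x \<cdot> \<tau>)"
  by (simp add: subst_cls_def image_mset.compositionality comp_def subst_lit_comp)

lemma subst_lit_cong:
  "(\<And>t x. t \<in> set_literal L \<Longrightarrow> x \<in> vars_trm t \<Longrightarrow> \<sigma> x = \<tau> x) \<Longrightarrow> L \<cdot>l \<sigma> = L \<cdot>l \<tau>"
  unfolding subst_lit_def by (intro literal.map_cong subst_trm_cong refl) auto

lemma vars_clsI: "L \<in># C \<Longrightarrow> t \<in> set_literal L \<Longrightarrow> x \<in> vars_trm t \<Longrightarrow> x \<in> vars_cls C"
  by (auto simp: vars_cls_def trms_cls_def)

lemma subst_cls_cong: "(\<And>x. x \<in> vars_cls C \<Longrightarrow> \<sigma> x = \<tau> x) \<Longrightarrow> C \<cdot>c \<sigma> = C \<cdot>c \<tau>"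
  unfolding subst_cls_def by (intro image_mset_cong subst_lit_cong) (auto intro: vars_clsI)

lemma subst_cls_add [simp]: "(C + D) \<cdot>c \<sigma> = C \<cdot>c \<sigma> + D \<cdot>c \<sigma>"
  by (simp add: subst_cls_def)

lemma subst_cls_add_mset [simp]: "add_mset L C \<cdot>c \<sigma> = add_mset (L \<cdot>l \<sigma>) (C \<cdot>c \<sigma>)"
  by (simp add: subst_cls_def)

lemma subst_lit_simps [simp]:
  "Pos (Upair s t) \<cdot>l \<sigma> = Pos (Upair (s \<cdot> \<sigma>) (t \<cdot> \<sigma>))"
  "Neg (Upair s t) \<cdot>l \<sigma> = Neg (Upair (s \<cdot> \<sigma>) (t \<cdot> \<sigma>))"
  by (simp_all add: subst_lit_def)

lemma subst_lit_Var [simp]: "L \<cdot>l Var = L"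
  by (simp add: subst_lit_def literal.map_ident)

lemma subst_cls_Var [simp]: "C \<cdot>c Var = C"
  by (simp add: subst_cls_def)

lemma trms_subst_cls: "trms_cls (C \<cdot>c \<sigma>) = (\<lambda>t. t \<cdot> \<sigma>) ` trms_cls C"
  by (auto simp: trms_cls_def subst_cls_def subst_lit_def literal.set_map)

lemma vars_subst_cls: "vars_cls (C \<cdot>c \<sigma>) = (\<Union>x \<in> vars_cls C. vars_trm (\<sigma> x))"
  by (auto simp: vars_cls_def trms_subst_cls vars_subst_trm)

lemma finite_vars_cls [simp]: "finite (vars_cls C)"
  by (auto simp: vars_cls_def trms_cls_def)

lemma literal_cases:
  obtains (Pos) s t where "L = Pos (Upair s t)" | (Neg) s t where "L = Neg (Upair s t)"
  by (metis literal.exhaust uprod_exhaust)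

section \<open>Unification\<close>

text \<open>The occurs check: no substitution can equate a variable with a term that properly
  contains it.\<close>

lemma size_vars_trm: "x \<in> vars_trm t \<Longrightarrow> t \<noteq> Var x \<Longrightarrow> size (\<tau> x) < size (t \<cdot> \<tau>)"
proof (induction t)
  case (Fun f ts)
  then obtain t where t: "t \<in> set ts" "x \<in> vars_trm t" by auto
  have "size (\<tau> x) \<le> size (t \<cdot> \<tau>)"
    using Fun.IH[OF t] by (cases "t = Var x") auto
  also have "\<dots> \<le> size_list size (map (\<lambda>t. t \<cdot> \<tau>) ts)"
    using t(1) by (intro size_list_estimation'[of "t \<cdot> \<tau>"]) auto
  finally show ?case by simp
qed simp

definition vars_eqs :: "(('f, 'v) trm \<times> ('f, 'v) trm) list \<Rightarrow> 'v set" where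
  "vars_eqs E = (\<Union>(s, t) \<in> set E. vars_trm s \<union> vars_trm t)"

definition unifies :: "('f, 'v) subst \<Rightarrow> (('f, 'v) trm \<times> ('f, 'v) trm) list \<Rightarrow> bool" where
  "unifies \<tau> E \<longleftrightarrow> (\<forall>(s, t) \<in> set E. s \<cdot> \<tau> = t \<cdot> \<tau>)"

text \<open>The successor charges for the equation itself, so deleting an equation between identical
  variables already counts as progress.\<close>

definition size_eqs :: "(('f, 'v) trm \<times> ('f, 'v) trm) list \<Rightarrow> nat" where
  "size_eqs E = (\<Sum>(s, t) \<leftarrow> E. Suc (size s + size t))"

lemma finite_vars_eqs: "finite (vars_eqs E)"
  by (auto simp: vars_eqs_def)

lemma size_eqs_zip:
  "size_eqs (zip ss ts) \<le> size_list size ss + size_list size ts"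
proof (induction ss arbitrary: ts)
  case (Cons s ss)
  show ?case
  proof (cases ts)
    case Cons': (Cons t ts')
    then show ?thesis using Cons.IH[of ts'] by (simp add: size_eqs_def)
  qed (simp add: size_eqs_def)
qed (simp add: size_eqs_def)

lemma vars_eqs_zip:
  "vars_eqs (zip ss ts) \<subseteq> (\<Union>s \<in> set ss. vars_trm s) \<union> (\<Union>t \<in> set ts. vars_trm t)"
  by (auto simp: vars_eqs_def dest: set_zip_leftD set_zip_rightD)

lemma unifies_zip:
  "length ss = length ts \<Longrightarrow>
    unifies \<tau> (zip ss ts) \<longleftrightarrow> map (\<lambda>s. s \<cdot> \<tau>) ss = map (\<lambda>t. t \<cdot> \<tau>) ts"
  by (induction ss ts rule: list_induct2) (auto simp: unifies_def)

text \<open>Requiring that every unifier absorbs \<open>\<sigma>\<close> from the left makes \<open>\<sigma>\<close> most general and, since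
  \<open>\<sigma>\<close> is itself a unifier, idempotent.\<close>

lemma solved_form_elim:
  assumes x: "x \<notin> vars_trm t"
    and \<sigma>: "unifies \<sigma> (map (\<lambda>(l, r). (l \<cdot> Var(x := t), r \<cdot> Var(x := t))) E)"
    and absorb: "\<And>\<tau>. unifies \<tau> (map (\<lambda>(l, r). (l \<cdot> Var(x := t), r \<cdot> Var(x := t))) E) \<Longrightarrow>
      \<forall>y. \<sigma> y \<cdot> \<tau> = \<tau> y"
  defines "\<rho> \<equiv> \<sigma>(x := t \<cdot> \<sigma>)"
  shows "unifies \<rho> ((Var x, t) # E)"
    and "unifies \<tau> ((Var x, t) # E) \<Longrightarrow> \<forall>y. \<rho> y \<cdot> \<tau> = \<tau> y"
proof -
  have sub: "l \<cdot> Var(x := t) \<cdot> \<upsilon> = l \<cdot> \<upsilon>(x := t \<cdot> \<upsilon>)" for l and \<upsilon> :: "('b, 'a) subst"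
    unfolding subst_trm_comp by (rule subst_trm_cong) auto
  have "t \<cdot> \<rho> = t \<cdot> \<sigma>"
    unfolding \<rho>_def using x by (intro subst_trm_cong) auto
  then show "unifies \<rho> ((Var x, t) # E)"
    using \<sigma> by (auto simp: unifies_def sub \<rho>_def)
  assume \<tau>: "unifies \<tau> ((Var x, t) # E)"
  then have *: "\<tau>(x := t \<cdot> \<tau>) = \<tau>" by (auto simp: unifies_def)
  have "unifies \<tau> (map (\<lambda>(l, r). (l \<cdot> Var(x := t), r \<cdot> Var(x := t))) E)"
    using \<tau> by (auto simp: unifies_def sub *)
  then have abs: "\<sigma> y \<cdot> \<tau> = \<tau> y" for y using absorb by blast
  have "t \<cdot> \<sigma> \<cdot> \<tau> = \<tau> x"
    using \<tau> by (simp add: unifies_def subst_trm_comp abs)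
  then show "\<forall>y. \<rho> y \<cdot> \<tau> = \<tau> y" by (auto simp: \<rho>_def abs)
qed

text \<open>Induction on the number of variables, then the size: eliminating a variable lowers the
  first component; deleting or decomposing an equation adds no variables and lowers the second. The
  given unifier rules out clashes and occurs-check failures.\<close>

lemma unification:
  assumes "unifies \<tau> E"
  shows "\<exists>\<sigma>. unifies \<sigma> E \<and> (\<forall>\<tau>. unifies \<tau> E \<longrightarrow> (\<forall>y. \<sigma> y \<cdot> \<tau> = \<tau> y))"
  using assms
proof (induction E rule: wf_induct_rule[OF wf_measures[of "[\<lambda>E. card (vars_eqs E), size_eqs]"]])
  case (1 E)
  note IH = 1(1) and uni = 1(2)
  have elim: ?case if "E = e # E'" "e = (Var x, t) \<or> e = (t, Var x)" "t \<noteq> Var x" for e E' x t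
  proof -
    have xt: "\<tau> x = t \<cdot> \<tau>" using uni that by (auto simp: unifies_def)
    then have x: "x \<notin> vars_trm t"
      using size_vars_trm[of x t \<tau>] that(3) by auto
    let ?E = "map (\<lambda>(l, r). (l \<cdot> Var(x := t), r \<cdot> Var(x := t))) E'"
    have "vars_eqs ?E \<subseteq> vars_eqs E - {x}"
      using x that(1,2) by (fastforce simp: vars_eqs_def vars_subst_trm split: if_splits)
    moreover have "x \<in> vars_eqs E" using that(1,2) by (auto simp: vars_eqs_def)
    ultimately have "card (vars_eqs ?E) < card (vars_eqs E)"
      by (intro psubset_card_mono finite_vars_eqs) auto
    then have less: "(?E, E) \<in> measures [\<lambda>E. card (vars_eqs E), size_eqs]" by simp
    \<comment> \<open>Since \<open>\<tau>\<close> already sends \<open>x\<close> to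
      \<open>t \<cdot> \<tau>\<close>, eliminating \<open>x\<close> does not change instances under
      \<open>\<tau>\<close>.\<close>
    have "\<tau>(x := t \<cdot> \<tau>) = \<tau>" using xt by auto
    then have "l \<cdot> Var(x := t) \<cdot> \<tau> = l \<cdot> \<tau>" for l
      unfolding subst_trm_comp by (intro subst_trm_cong) (use xt in auto)
    then have "unifies \<tau> ?E" using uni that(1) by (auto simp: unifies_def)
    from IH[OF less this] obtain \<sigma> where \<sigma>: "unifies \<sigma> ?E"
      "\<And>\<tau>. unifies \<tau> ?E \<Longrightarrow> \<forall>y. \<sigma> y \<cdot> \<tau> = \<tau> y" by blast
    have "unifies \<upsilon> E \<longleftrightarrow> unifies \<upsilon> ((Var x, t) # E')" for \<upsilon>
      using that(1,2) by (auto simp: unifies_def)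
    then show ?thesis using solved_form_elim[OF x \<sigma>] by blast
  qed
  show ?case
  proof (cases E)
    case Nil
    then show ?thesis by (intro exI[of _ Var]) (auto simp: unifies_def)
  next
    case (Cons e E')
    obtain s t where e: "e = (s, t)" by force
    have smaller: ?thesis if "vars_eqs E'' \<subseteq> vars_eqs E" "size_eqs E'' < size_eqs E"
      "\<And>\<upsilon>. unifies \<upsilon> E \<longleftrightarrow> unifies \<upsilon> E''" for E''
    proof -
      have "card (vars_eqs E'') \<le> card (vars_eqs E)"
        using that(1) by (intro card_mono finite_vars_eqs)
      then have "(E'', E) \<in> measures [\<lambda>E. card (vars_eqs E), size_eqs]"
        using that(2) by auto
      from IH[OF this] uni show ?thesis unfolding that(3) .
    qed
    show ?thesis
    proof (cases s; cases t)
      fix x y assume "s = Var x" "t = Var y"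
      show ?thesis
      proof (cases "x = y")
        case True
        then show ?thesis using Cons e \<open>s = _\<close> \<open>t = _\<close>
          by (intro smaller[of E']) (auto simp: vars_eqs_def size_eqs_def unifies_def)
      next
        case False
        then show ?thesis using elim[OF Cons, of x t] e \<open>s = _\<close> \<open>t = _\<close> by auto
      qed
    next
      fix x f ts assume "s = Var x" "t = Fun f ts"
      then show ?thesis using elim[OF Cons, of x t] e by auto
    next
      fix x f ts assume "s = Fun f ts" "t = Var x"
      then show ?thesis using elim[OF Cons, of x s] e by auto
    next
      fix f ss g ts assume st: "s = Fun f ss" "t = Fun g ts"
      have "map (\<lambda>s. s \<cdot> \<tau>) ss = map (\<lambda>t. t \<cdot> \<tau>) ts" and fg: "f = g"
        using uni Cons e st by (auto simp: unifies_def)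
      then have len: "length ss = length ts" by (metis length_map)
      show ?thesis
      proof (rule smaller[of "zip ss ts @ E'"])
        show "vars_eqs (zip ss ts @ E') \<subseteq> vars_eqs E"
          using vars_eqs_zip[of ss ts] Cons e st by (auto simp: vars_eqs_def)
        show "size_eqs (zip ss ts @ E') < size_eqs E"
          using size_eqs_zip[of ss ts] Cons e st by (auto simp: size_eqs_def)
        show "unifies \<upsilon> E \<longleftrightarrow> unifies \<upsilon> (zip ss ts @ E')" for \<upsilon>
          using unifies_zip[OF len, of \<upsilon>] Cons e st fg by (auto simp: unifies_def)
      qed
    qed
  qed
qed

lemma is_mgu_exists:
  assumes "s \<cdot> \<tau> = t \<cdot> \<tau>"
  obtains \<sigma> where "is_mgu \<sigma> s t"
proof -
  have "unifies \<tau> [(s, t)]" using assms by (simp add: unifies_def)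
  from unification[OF this] obtain \<sigma> where \<sigma>: "s \<cdot> \<sigma> = t \<cdot> \<sigma>"
    "\<And>\<tau>. s \<cdot> \<tau> = t \<cdot> \<tau> \<Longrightarrow> \<forall>y. \<sigma> y \<cdot> \<tau> = \<tau> y"
    by (auto simp: unifies_def)
  then have "is_mgu \<sigma> s t"
    unfolding is_mgu_def by (metis)
  then show thesis by (rule that)
qed

text \<open>Factor \<open>\<tau>\<close> through \<open>\<sigma>\<close>; by idempotence of
  \<open>\<sigma>\<close>, \<open>\<tau>\<close> can serve as its own factor. This identifies the
  ground instance of \<open>C \<cdot>c \<sigma>\<close> with that of \<open>C\<close> in the
  inferences below.\<close>

lemma is_mgu_absorb:
  assumes "is_mgu \<sigma> s t" and "s \<cdot> \<tau> = t \<cdot> \<tau>"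
  shows "(\<lambda>x. \<sigma> x \<cdot> \<tau>) = \<tau>"
proof
  fix x
  obtain \<delta> where \<delta>: "\<And>x. \<tau> x = \<sigma> x \<cdot> \<delta>"
    using assms unfolding is_mgu_def by metis
  have "\<sigma> x \<cdot> \<tau> = \<sigma> x \<cdot> \<sigma> \<cdot> \<delta>"
    unfolding subst_trm_comp \<delta> by simp
  also have "\<dots> = \<tau> x"
    using assms(1) \<delta> by (simp add: is_mgu_def)
  finally show "\<sigma> x \<cdot> \<tau> = \<tau> x" .
qed

section \<open>Renaming apart\<close>

text \<open>\<open>variant\<close> demands a bijection of all variables, so \<open>A\<close> is
  swapped with a set of fresh variables of the same cardinality; the swap is its own
  inverse.\<close>

lemma finite_renaming_apart:
  fixes A B :: "'v :: infinite set"
  assumes "finite A" "finite B"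
  obtains \<pi> :: "'v \<Rightarrow> 'v" where "bij \<pi>" "\<pi> ` A \<inter> B = {}"
proof -
  have "infinite (UNIV - (A \<union> B))"
    using assms by (intro Diff_infinite_finite infinite_UNIV) auto
  then obtain A' where A': "A' \<subseteq> UNIV - (A \<union> B)" "finite A'" "card A' = card A"
    using infinite_arbitrarily_large by metis
  then obtain h where h: "bij_betw h A A'"
    using assms(1) finite_same_card_bij by metis
  let ?k = "the_inv_into A h"
  define \<pi> where "\<pi> x = (if x \<in> A then h x else if x \<in> A' then ?k x else x)" for x
  have hA: "h x \<in> A'" "?k (h x) = x" if "x \<in> A" for x
    using h that by (auto simp: bij_betw_def the_inv_into_f_f)
  have kA: "?k x \<in> A" "h (?k x) = x" if "x \<in> A'" for x
    using h that by (auto simp: bij_betw_def intro: the_inv_into_into f_the_inv_into_f)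
  have "A \<inter> A' = {}" using A'(1) by auto
  then have "\<pi> (\<pi> x) = x" for x
    using hA[of x] kA[of x] by (cases "x \<in> A"; cases "x \<in> A'") (auto simp: \<pi>_def)
  then have "bij \<pi>" by (rule involuntory_imp_bij)
  moreover have "\<pi> ` A \<inter> B = {}" using hA A'(1) by (auto simp: \<pi>_def)
  ultimately show thesis by (rule that)
qed

lemma variant_refl: "variant C C"
  unfolding variant_def by (intro exI[of _ id]) auto

section \<open>Rewriting with left-reduced ground systems\<close>

lemma subterms_refl [simp]: "t \<in> subterms t"
  by (cases t) auto

lemma subterms_conv_proper: "subterms t = insert t (proper_subterms t)"
  by (cases t) auto

lemma proper_subterms_plug: "c \<noteq> Hole \<Longrightarrow> u \<in> proper_subterms (plug c u)"
proof (induction c)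
  case (More f ss c ts)
  then show ?case by (cases "c = Hole") (auto simp: subterms_conv_proper)
qed simp

lemma subterms_plugE:
  assumes "u \<in> subterms t"
  obtains c where "t = plug c u"
proof -
  have "\<exists>c. t = plug c u" using assms
  proof (induction t)
    case (Fun f ts)
    show ?case
    proof (cases "u = Fun f ts")
      case True
      then show ?thesis by (intro exI[of _ Hole]) simp
    next
      case False
      with Fun.prems obtain t where t: "t \<in> set ts" "u \<in> subterms t" by auto
      with Fun.IH obtain c where c: "t = plug c u" by blast
      from t(1) obtain ss ss' where "ts = ss @ t # ss'" by (meson split_list)
      with c show ?thesis by (intro exI[of _ "More f ss c ss'"]) simp
    qed
  qed (auto intro: exI[of _ Hole])
  then show thesis using that by blast
qed

lemma proper_subterms_plugE:
  assumes "u \<in> proper_subterms t"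
  obtains c where "t = plug c u" "c \<noteq> Hole"
proof (cases t)
  case (Fun f ts)
  with assms obtain t' where t': "t' \<in> set ts" "u \<in> subterms t'" by auto
  obtain c where c: "t' = plug c u" using subterms_plugE[OF t'(2)] .
  from t'(1) obtain ss ss' where "ts = ss @ t' # ss'" by (meson split_list)
  with c Fun show thesis by (intro that[of "More f ss c ss'"]) simp_all
qed (use assms in simp)

lemma vars_subterms: "u \<in> subterms t \<Longrightarrow> vars_trm u \<subseteq> vars_trm t"
  by (induction t) auto

lemma subterms_subst: "u \<in> subterms t \<Longrightarrow> u \<cdot> \<sigma> \<in> subterms (t \<cdot> \<sigma>)"
  by (induction t) auto

lemma proper_subterms_subst: "u \<in> proper_subterms t \<Longrightarrow> u \<cdot> \<sigma> \<in> proper_subterms (t \<cdot> \<sigma>)"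
  by (cases t) (auto intro: subterms_subst)

lemma Var_subterms_iff: "Var x \<in> subterms t \<longleftrightarrow> x \<in> vars_trm t"
  by (induction t) auto

lemma finite_subterms [simp]: "finite (subterms t)"
  by (induction t) auto

lemma finite_proper_subterms [simp]: "finite (proper_subterms t)"
  by (cases t) auto

lemma ground_plugD: "ground_trm F (plug c t) \<Longrightarrow> ground_trm F t"
  by (induction c) (auto simp: ground_trm_def)

lemma ground_plug: "ground_trm F (plug c t) \<Longrightarrow> ground_trm F u \<Longrightarrow> ground_trm F (plug c u)"
  by (induction c) (auto simp: ground_trm_def)

lemma ground_Fun: "ground_trm F (Fun f ts) \<longleftrightarrow> (f, length ts) \<in> F \<and> (\<forall>t \<in> set ts. ground_trm F t)"
  by (auto simp: ground_trm_def)

text \<open>A redex that the substitution does not introduce sits at a non-variable position of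
  \<open>t\<close>. With an irreducible substitution every redex is therefore within reach of
  Parallel Superposition I.\<close>

lemma subst_subterm_redex:
  assumes "l \<in> subterms (t \<cdot> \<theta>)" and "\<And>x. x \<in> vars_trm t \<Longrightarrow> l \<notin> subterms (\<theta> x)"
  obtains u where "u \<in> subterms t" "\<not> is_Var u" "u \<cdot> \<theta> = l"
proof -
  have "\<exists>u \<in> subterms t. \<not> is_Var u \<and> u \<cdot> \<theta> = l" using assms
  proof (induction t)
    case (Fun f ts)
    show ?case
    proof (cases "l = Fun f ts \<cdot> \<theta>")
      case True
      then show ?thesis by (intro bexI[of _ "Fun f ts"]) auto
    next
      case False
      then obtain t where "t \<in> set ts" "l \<in> subterms (t \<cdot> \<theta>)"
        using Fun.prems(1) by auto
      with Fun.IH[of t] Fun.prems(2) show ?thesis by fastforce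
    qed
  qed auto
  then show thesis using that by blast
qed

text \<open>Two occurrences in one term are nested, equal or parallel. In the parallel case
  \<open>d\<close> and \<open>d'\<close> are the contexts of one redex after the other has been
  contracted, and both results have a common reduct. That they differ from \<open>Hole\<close> is
  recorded because labels depend on it.\<close>

lemma plug_eq_cases:
  assumes "plug c u = plug c' u'"
  shows "u' \<in> proper_subterms u \<or> u \<in> proper_subterms u' \<or> c = c' \<and> u = u'
    \<or> c \<noteq> Hole \<and> c' \<noteq> Hole \<and> (\<forall>v v'. \<exists>d d'. d \<noteq> Hole \<and> d' \<noteq> Hole
        \<and> plug c v = plug d u' \<and> plug c' v' = plug d' u \<and> plug d v' = plug d' v)"
  using assms
proof (induction c arbitrary: c')
  case Hole
  then show ?case by (cases "c' = Hole") (auto intro: proper_subterms_plug)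
next
  case (More f ss c ts)
  show ?case
  proof (cases c')
    case Hole
    then have u': "u' = plug (More f ss c ts) u" using More.prems by simp
    have "u \<in> proper_subterms u'" unfolding u' by (rule proper_subterms_plug) simp
    then show ?thesis by blast
  next
    case c': (More f' ss' d ts')
    have f: "f' = f" and eq: "ss @ plug c u # ts = ss' @ plug d u' # ts'"
      using More.prems c' by simp_all
    consider "length ss = length ss'" | "length ss < length ss'" | "length ss' < length ss"
      by linarith
    then show ?thesis
    proof cases
      case 1
      then have *: "ss = ss'" "ts = ts'" "plug c u = plug d u'" using eq by simp_all
      have "\<exists>e e'. e \<noteq> Hole \<and> e' \<noteq> Hole \<and> plug (More f ss c ts) v = plug e u'
          \<and> plug (More f ss d ts) v' = plug e' u \<and> plug e v' = plug e' v"
        if "\<exists>e e'. e \<noteq> Hole \<and> e' \<noteq> Hole \<and> plug c v = plug e u'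
          \<and> plug d v' = plug e' u \<and> plug e v' = plug e' v" for v v'
      proof -
        from that obtain e e' where "plug c v = plug e u'" "plug d v' = plug e' u"
          "plug e v' = plug e' v" by blast
        then show ?thesis
          by (intro exI[of _ "More f ss e ts"] exI[of _ "More f ss e' ts"]) simp
      qed
      then have "(\<forall>v v'. \<exists>e e'. e \<noteq> Hole \<and> e' \<noteq> Hole \<and> plug c v = plug e u'
          \<and> plug d v' = plug e' u \<and> plug e v' = plug e' v) \<Longrightarrow>
        (\<forall>v v'. \<exists>e e'. e \<noteq> Hole \<and> e' \<noteq> Hole \<and> plug (More f ss c ts) v = plug e u'
          \<and> plug (More f ss d ts) v' = plug e' u \<and> plug e v' = plug e' v)" by blast
      then show ?thesis using More.IH[OF *(3)]
        unfolding c' f *(1,2)[symmetric] by (elim disjE conjE) simp_all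
    next
      \<comment> \<open>The first hole lies in an argument to the left of the second; each new
        context has the other argument already replaced.\<close>
      case 2
      then obtain xs where xs: "ss' = ss @ plug c u # xs" "ts = xs @ plug d u' # ts'"
        using eq by (auto simp: append_eq_append_conv2 append_eq_Cons_conv Cons_eq_append_conv)
      have "\<exists>e e'. e \<noteq> Hole \<and> e' \<noteq> Hole \<and> plug (More f ss c ts) v = plug e u'
          \<and> plug c' v' = plug e' u \<and> plug e v' = plug e' v" for v v'
        by (intro exI[of _ "More f (ss @ plug c v # xs) d ts'"]
            exI[of _ "More f ss c (xs @ plug d v' # ts')"]) (simp add: c' f xs)
      then show ?thesis by (simp add: c')
    next
      case 3
      then obtain xs where xs: "ss = ss' @ plug d u' # xs" "ts' = xs @ plug c u # ts"
        using eq by (auto simp: append_eq_append_conv2 append_eq_Cons_conv Cons_eq_append_conv)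
      have "\<exists>e e'. e \<noteq> Hole \<and> e' \<noteq> Hole \<and> plug (More f ss c ts) v = plug e u'
          \<and> plug c' v' = plug e' u \<and> plug e v' = plug e' v" for v v'
        by (intro exI[of _ "More f ss' d (xs @ plug c v # ts)"]
            exI[of _ "More f (ss' @ plug d v' # xs) c ts"]) (simp add: c' f xs)
      then show ?thesis by (simp add: c')
    qed
  qed
qed

section \<open>Rewrite steps in arguments and instances, and irreducibility\<close>

lemma rstep_arg: "rstep R s t \<Longrightarrow> rstep R (Fun f (xs @ s # ys)) (Fun f (xs @ t # ys))"
proof (induction rule: rstep.induct)
  case (1 u v c)
  then show ?case using rstep.intros[of u v R "More f xs c ys"] by simp
qed

lemma rsteps_arg: "(rstep R)\<^sup>*\<^sup>* s t \<Longrightarrow> (rstep R)\<^sup>*\<^sup>* (Fun f (xs @ s # ys)) (Fun f (xs @ t # ys))"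
  by (induction rule: rtranclp_induct) (auto intro: rtranclp.rtrancl_into_rtrancl rstep_arg)

lemma rsteps_args_aux:
  "list_all2 (rstep R)\<^sup>*\<^sup>* ss ts \<Longrightarrow> (rstep R)\<^sup>*\<^sup>* (Fun f (xs @ ss)) (Fun f (xs @ ts))"
proof (induction arbitrary: xs rule: list_all2_induct)
  case (Cons s ss t ts)
  show ?case
    using rsteps_arg[OF Cons.hyps(1), of f xs ss] Cons.IH[of "xs @ [t]"] by simp
qed simp

lemma rsteps_args:
  "(\<And>t. t \<in> set ts \<Longrightarrow> (rstep R)\<^sup>*\<^sup>* (g t) (h t)) \<Longrightarrow> (rstep R)\<^sup>*\<^sup>* (Fun f (map g ts)) (Fun f (map h ts))"
  using rsteps_args_aux[of R "map g ts" "map h ts" f "[]"]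
  by (simp add: list_all2_conv_all_nth)

lemma rsteps_subst:
  "(\<And>x. x \<in> vars_trm t \<Longrightarrow> (rstep R)\<^sup>*\<^sup>* (\<theta> x) (\<theta>' x)) \<Longrightarrow> (rstep R)\<^sup>*\<^sup>* (t \<cdot> \<theta>) (t \<cdot> \<theta>')"
proof (induction t)
  case (Fun f ts)
  show ?case
    unfolding subst_trm.simps by (rule rsteps_args) (use Fun in auto)
qed simp

lemma rsteps_replace:
  assumes "(u \<cdot> \<theta>, u' \<cdot> \<theta>) \<in> R"
  shows "(rstep R)\<^sup>*\<^sup>* (t \<cdot> \<theta>) (replace_trm u u' t \<cdot> \<theta>)"
proof -
  have top: "(rstep R)\<^sup>*\<^sup>* (u \<cdot> \<theta>) (u' \<cdot> \<theta>)"
    using rstep.intros[OF assms, of Hole] by auto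
  show ?thesis
  proof (induction t)
    case (Fun f ts)
    have "(rstep R)\<^sup>*\<^sup>* (Fun f (map (\<lambda>t. t \<cdot> \<theta>) ts)) (Fun f (map (\<lambda>t. replace_trm u u' t \<cdot> \<theta>) ts))"
      by (rule rsteps_args) (use Fun in auto)
    then show ?case using top by (auto simp: comp_def)
  qed (use top in auto)
qed

lemma rstep_mono: "rstep R s t \<Longrightarrow> R \<subseteq> R' \<Longrightarrow> rstep R' s t"
  by (auto elim!: rstep.cases intro: rstep.intros)

lemma irreducible_mono: "irreducible R' t \<Longrightarrow> R \<subseteq> R' \<Longrightarrow> irreducible R t"
  by (auto simp: irreducible_def dest: rstep_mono)

lemma irreducible_iff: "irreducible R t \<longleftrightarrow> (\<forall>(u, v) \<in> R. u \<notin> subterms t)"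
proof
  assume *: "\<forall>(u, v) \<in> R. u \<notin> subterms t"
  show "irreducible R t"
    unfolding irreducible_def
  proof
    assume "\<exists>t'. rstep R t t'"
    then obtain u v c where "(u, v) \<in> R" "t = plug c u" by (auto elim: rstep.cases)
    moreover have "u \<in> subterms (plug c u)"
      by (cases "c = Hole") (auto simp: subterms_conv_proper proper_subterms_plug)
    ultimately show False using * by auto
  qed
next
  assume irr: "irreducible R t"
  show "\<forall>(u, v) \<in> R. u \<notin> subterms t"
  proof clarify
    fix u v assume uv: "(u, v) \<in> R" and "u \<in> subterms t"
    then obtain c where "t = plug c u" by (auto elim: subterms_plugE)
    then show False using irr rstep.intros[OF uv, of c] unfolding irreducible_def by blast
  qed
qed

lemma subterms_trans: "u \<in> subterms t \<Longrightarrow> t \<in> subterms s \<Longrightarrow> u \<in> subterms s"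
  by (induction s) auto

lemma proper_subterms_trans: "u \<in> subterms t \<Longrightarrow> t \<in> proper_subterms s \<Longrightarrow> u \<in> proper_subterms s"
  by (cases s) (auto intro: subterms_trans)

lemma irreducible_subterm: "irreducible R t \<Longrightarrow> u \<in> subterms t \<Longrightarrow> irreducible R u"
  by (auto simp: irreducible_iff dest: subterms_trans)

text \<open>One formula for both collecting rules of \<open>rm_rel\<close>: at the top the label
  stays; below the top \<open>0\<close> rises to \<open>1\<close>, while \<open>1\<close> and
  \<open>2\<close> stay.\<close>

definition redex_label :: "('f, 'v) ctxt \<Rightarrow> nat \<Rightarrow> nat" where
  "redex_label c m = (if c = Hole then m else max m 1)"

lemma rm_rel_step:
  assumes "(u, v) \<in> R" and "rm_rel R (plug c v) m M"
  shows "rm_rel R (plug c u) m (add_mset (u, redex_label c m) M)"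
proof (cases "c = Hole \<or> m > 0")
  case True
  then have "redex_label c m = m" by (auto simp: redex_label_def)
  then show ?thesis using rm_rel.same_label[OF assms(1) True assms(2)] by simp
next
  case False
  then show ?thesis using rm_rel.below_top[of u v R c m M] assms by (simp add: redex_label_def)
qed

lemma rm_rel_cases:
  assumes "rm_rel R t m M"
  obtains "irreducible R t" "M = {#}"
  | u v c M' where "(u, v) \<in> R" "t = plug c u" "rm_rel R (plug c v) m M'"
      "M = add_mset (u, redex_label c m) M'"
  using assms
proof cases
  case irreducible
  then show thesis by (intro that(1))
next
  case (same_label u v c M')
  then show thesis by (intro that(2)[of u v c M']) (auto simp: redex_label_def)
next
  case (below_top u v c M')
  then show thesis by (intro that(2)[of u v c M']) (auto simp: redex_label_def)
qed

lemma admissible_subset: "admissible F lt R \<Longrightarrow> R0 \<subseteq> R \<Longrightarrow> admissible F lt R0"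
  unfolding admissible_def using irreducible_mono[OF _ Diff_mono[OF _ order_refl]] by blast

section \<open>Ground terms under a total reduction ordering\<close>

locale ground_total_ordering =
  fixes F :: "'f signature" and lt :: "('f, 'v) trm rel2"
  assumes red: "reduction_ordering F lt" and tot: "total_on_ground F lt"
begin

lemma transp_lt: "transp lt" and wfp_lt: "wfp lt"
  using red by (simp_all add: reduction_ordering_def)

lemma irreflp_lt: "irreflp lt"
  using wfp_lt by (rule wfp_imp_irreflp)

lemma lt_trans: "lt s t \<Longrightarrow> lt t u \<Longrightarrow> lt s u"
  using transp_lt by (rule transpD)

lemma lt_irrefl [simp]: "\<not> lt s s"
  using irreflp_lt by (simp add: irreflpD)

lemma lt_asym: "lt s t \<Longrightarrow> \<not> lt t s"
  using lt_trans lt_irrefl by blast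

lemma lt_subst: "lt s t \<Longrightarrow> (\<And>x. wf_trm F (\<sigma> x)) \<Longrightarrow> lt (s \<cdot> \<sigma>) (t \<cdot> \<sigma>)"
  using red by (auto simp: reduction_ordering_def)

lemma lt_plug: "lt s t \<Longrightarrow> wf_trm F (plug c t) \<Longrightarrow> lt (plug c s) (plug c t)"
  using red by (auto simp: reduction_ordering_def)

lemma lt_total: "ground_trm F s \<Longrightarrow> ground_trm F t \<Longrightarrow> s \<noteq> t \<Longrightarrow> lt s t \<or> lt t s"
  using tot by (auto simp: total_on_ground_def totalp_on_def)

text \<open>Sizes exclude equality, so by totality the only alternative is that
  \<open>plug c t\<close> is smaller than \<open>t\<close>; iterating \<open>c\<close> would then
  give an infinite descending chain.\<close>

lemma lt_subterm:
  assumes "ground_trm F (plug c t)" and "c \<noteq> Hole"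
  shows "lt t (plug c t)"
proof (rule ccontr)
  assume nlt: "\<not> lt t (plug c t)"
  have "t \<noteq> plug c t"
  proof
    assume "t = plug c t"
    have "size t < size (plug c t)" using assms(2)
    proof (induction c)
      case (More f ss c ts)
      have "size t \<le> size (plug c t)" using More.IH by (cases "c = Hole") auto
      then show ?case by simp
    qed simp
    with \<open>t = plug c t\<close> show False by simp
  qed
  then have lt: "lt (plug c t) t"
    using nlt lt_total assms(1) ground_plugD by blast
  define s where "s n = (plug c ^^ n) t" for n
  have "lt (s (Suc n)) (s n) \<and> ground_trm F (s (Suc n))" for n
  proof (induction n)
    case 0
    then show ?case using lt assms(1) by (simp add: s_def)
  next
    case (Suc n)
    have s: "s (Suc (Suc n)) = plug c (s (Suc n))" "s (Suc n) = plug c (s n)"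
      by (simp_all add: s_def)
    have gr: "ground_trm F (s (Suc n))" using Suc by simp
    then have "lt (plug c (s (Suc n))) (plug c (s n))"
      using Suc s by (intro lt_plug) (auto simp: ground_trm_def)
    moreover have "ground_trm F (plug c (s (Suc n)))"
      using ground_plug[of F c t "s (Suc n)"] assms(1) gr by blast
    ultimately show ?case using s by simp
  qed
  then show False using wfp_lt unfolding wfp_def wf_iff_no_infinite_down_chain by blast
qed

lemma lt_proper_subterm: "ground_trm F t \<Longrightarrow> u \<in> proper_subterms t \<Longrightarrow> lt u t"
  by (auto elim!: proper_subterms_plugE intro: lt_subterm)

lemma le_subterm: "ground_trm F t \<Longrightarrow> u \<in> subterms t \<Longrightarrow> lt\<^sup>=\<^sup>= u t"
  by (auto simp: subterms_conv_proper lt_proper_subterm)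

lemma ground_subterm: "ground_trm F t \<Longrightarrow> u \<in> subterms t \<Longrightarrow> ground_trm F u"
  by (auto elim!: subterms_plugE dest: ground_plugD)

lemma le_lt_trans: "lt\<^sup>=\<^sup>= s t \<Longrightarrow> lt t u \<Longrightarrow> lt s u"
  by (auto intro: lt_trans)

lemma lt_le_trans: "lt s t \<Longrightarrow> lt\<^sup>=\<^sup>= t u \<Longrightarrow> lt s u"
  by (auto intro: lt_trans)

end

section \<open>Confluence, normal forms and collected redexes of admissible systems\<close>

locale admissible_trs = ground_total_ordering F lt
  for F :: "'f signature" and lt :: "('f, 'v) trm rel2" +
  fixes R :: "('f, 'v) trs"
  assumes adm: "admissible F lt R"
begin

lemma rule: "(u, v) \<in> R \<Longrightarrow> ground_trm F u \<and> ground_trm F v \<and> lt v u"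
  using adm by (auto simp: admissible_def)

lemma rule_irred: "(u, v) \<in> R \<Longrightarrow> irreducible (R - {(u, v)}) u"
  using adm by (auto simp: admissible_def)

lemma rule_unique: "(u, v) \<in> R \<Longrightarrow> (u, v') \<in> R \<Longrightarrow> v = v'"
  using rule_irred[of u v] unfolding irreducible_iff
  by (metis (mono_tags, lifting) Diff_iff Pair_inject case_prodD singletonD subterms_refl)

text \<open>The inner left-hand side is smaller than \<open>u\<close>, hence belongs to a different
  rule, which would reduce \<open>u\<close>.\<close>

lemma rule_no_overlap:
  assumes uv: "(u, v) \<in> R" and uv': "(u', v') \<in> R"
  shows "u' \<notin> proper_subterms u"
proof
  assume *: "u' \<in> proper_subterms u"
  then have "lt u' u" using rule[OF uv] lt_proper_subterm by blast
  then have "(u', v') \<in> R - {(u, v)}" using uv' by auto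
  then show False using rule_irred[OF uv] * by (auto simp: irreducible_iff subterms_conv_proper)
qed

lemma rule_subterm_irreducible:
  "(u, v) \<in> R \<Longrightarrow> p \<in> proper_subterms u \<Longrightarrow> irreducible R p"
  using rule_no_overlap proper_subterms_trans unfolding irreducible_iff by blast

text \<open>Nested redexes are impossible, so of the cases of \<open>plug_eq_cases\<close> only
  equal and parallel positions remain.\<close>

lemma rstep_cases_two:
  assumes uv: "(u, v) \<in> R" and uv': "(u', v') \<in> R" and eq: "plug c u = plug c' u'"
  obtains "c = c'" "u = u'" "v = v'"
  | d d' where "c \<noteq> Hole" "c' \<noteq> Hole" "d \<noteq> Hole" "d' \<noteq> Hole"
      "plug c v = plug d u'" "plug c' v' = plug d' u" "plug d v' = plug d' v"
proof -
  have "u' \<notin> proper_subterms u" "u \<notin> proper_subterms u'"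
    using rule_no_overlap uv uv' by auto
  with plug_eq_cases[OF eq] consider "c = c' \<and> u = u'"
    | "c \<noteq> Hole \<and> c' \<noteq> Hole \<and> (\<forall>v v'. \<exists>d d'. d \<noteq> Hole \<and> d' \<noteq> Hole
        \<and> plug c v = plug d u' \<and> plug c' v' = plug d' u \<and> plug d v' = plug d' v)" by blast
  then show thesis
  proof cases
    case 1
    then show thesis using that(1) rule_unique uv uv' by blast
  next
    case 2
    then show thesis using that(2) by metis
  qed
qed

text \<open>There are no critical pairs: distinct steps from one term are parallel and are joined by
  one further step each.\<close>

lemma confluent: "confluentp (rstep R)"
proof (rule strong_confluentp_imp_confluentp, rule strong_confluentpI)
  fix t a b assume "rstep R t a" "rstep R t b"
  then obtain c u v c' u' v' where uv: "(u, v) \<in> R" "(u', v') \<in> R"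
    and t: "t = plug c u" "plug c u = plug c' u'" and ab: "a = plug c v" "b = plug c' v'"
    by (elim rstep.cases) metis
  from uv t(2) show "\<exists>z. (rstep R)\<^sup>*\<^sup>* a z \<and> (rstep R)\<^sup>=\<^sup>= b z"
  proof (cases rule: rstep_cases_two)
    case 1
    then show ?thesis using ab by auto
  next
    case (2 d d')
    have "rstep R a (plug d v')" "rstep R b (plug d v')"
      using rstep.intros[OF uv(2), of d] rstep.intros[OF uv(1), of d'] 2 ab by simp_all
    then show ?thesis by auto
  qed
qed

lemma rstep_ground: "rstep R s t \<Longrightarrow> ground_trm F s \<Longrightarrow> ground_trm F t \<and> lt t s"
proof (induction rule: rstep.induct)
  case (1 u v c)
  then show ?case
    using rule[OF 1(1)] ground_plug[of F c u v] lt_plug[of v u c] by (auto simp: ground_trm_def)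
qed

lemma rsteps_ground: "(rstep R)\<^sup>*\<^sup>* s t \<Longrightarrow> ground_trm F s \<Longrightarrow> ground_trm F t \<and> lt\<^sup>=\<^sup>= t s"
  by (induction rule: rtranclp_induct) (auto dest: rstep_ground intro: lt_trans)

lemma normal_form_exists: "ground_trm F t \<Longrightarrow> \<exists>n. (rstep R)\<^sup>*\<^sup>* t n \<and> irreducible R n"
proof (induction t rule: wfp_induct_rule[OF wfp_lt])
  case (1 t)
  show ?case
  proof (cases "irreducible R t")
    case False
    then obtain t' where t': "rstep R t t'" by (auto simp: irreducible_def)
    then show ?thesis using 1 rstep_ground
      by (meson converse_rtranclp_into_rtranclp)
  qed auto
qed

lemma irreducible_rsteps: "(rstep R)\<^sup>*\<^sup>* t n \<Longrightarrow> irreducible R t \<Longrightarrow> n = t"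
  by (auto simp: irreducible_def elim: converse_rtranclpE)

lemma normal_form_eqI:
  assumes "(rstep R)\<^sup>*\<^sup>* t n" "irreducible R n"
  shows "normal_form R t = n"
  unfolding normal_form_def
proof (rule the_equality)
  fix n' assume "(rstep R)\<^sup>*\<^sup>* t n' \<and> irreducible R n'"
  then show "n' = n"
    using confluentpD[OF confluent] assms irreducible_rsteps by metis
qed (use assms in simp)

lemma normal_form: "ground_trm F t \<Longrightarrow>
    (rstep R)\<^sup>*\<^sup>* t (normal_form R t) \<and> irreducible R (normal_form R t)"
  using normal_form_exists normal_form_eqI by metis

lemma normal_form_ground: "ground_trm F t \<Longrightarrow>
    ground_trm F (normal_form R t) \<and> lt\<^sup>=\<^sup>= (normal_form R t) t"
  using normal_form rsteps_ground by blast

lemma normal_form_irreducible: "irreducible R t \<Longrightarrow> normal_form R t = t"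
  by (rule normal_form_eqI) auto

lemma normal_form_rsteps: "ground_trm F s \<Longrightarrow> (rstep R)\<^sup>*\<^sup>* s t \<Longrightarrow> normal_form R s = normal_form R t"
  by (rule normal_form_eqI) (use normal_form[of t] rsteps_ground[of s t] in auto)

lemma normal_form_subst:
  assumes "ground_trm F (t \<cdot> \<theta>)"
  shows "normal_form R (t \<cdot> (\<lambda>x. normal_form R (\<theta> x))) = normal_form R (t \<cdot> \<theta>)"
proof -
  have "ground_trm F (\<theta> x)" if "x \<in> vars_trm t" for x
    using ground_subterm[OF assms] subterms_subst[of "Var x" t \<theta>] that
    by (auto simp: Var_subterms_iff)
  then have "(rstep R)\<^sup>*\<^sup>* (t \<cdot> \<theta>) (t \<cdot> (\<lambda>x. normal_form R (\<theta> x)))"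
    by (intro rsteps_subst) (simp add: normal_form)
  then show ?thesis using assms by (metis normal_form_rsteps)
qed

lemma equivclp_join: "equivclp (rstep R) s t \<longleftrightarrow> (\<exists>z. (rstep R)\<^sup>*\<^sup>* s z \<and> (rstep R)\<^sup>*\<^sup>* t z)"
  using semiconfluentp_equivclp[OF confluentp_imp_semiconfluentp[OF confluent]]
  by (auto simp: rtranclp_conversep)

lemma equivclp_normal_form:
  assumes "ground_trm F s" "ground_trm F t"
  shows "equivclp (rstep R) s t \<longleftrightarrow> normal_form R s = normal_form R t"
  using assms normal_form normal_form_rsteps unfolding equivclp_join by metis

lemma rm_rel_exists: "ground_trm F t \<Longrightarrow> \<exists>M. rm_rel R t m M"
proof (induction t rule: wfp_induct_rule[OF wfp_lt])
  case (1 t)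
  show ?case
  proof (cases "irreducible R t")
    case False
    then obtain u v c where *: "(u, v) \<in> R" "t = plug c u"
      by (auto simp: irreducible_def elim: rstep.cases)
    then show ?thesis
      using 1 rstep_ground[OF rstep.intros[OF *(1), of c]] rm_rel_step[OF *(1)] by metis
  qed (auto intro: rm_rel.irreducible)
qed

lemma rm_rel_irreducible: "rm_rel R t m M \<Longrightarrow> irreducible R t \<Longrightarrow> M = {#}"
  by (erule rm_rel_cases) (auto simp: irreducible_def dest: rstep.intros)

text \<open>Induction along rewriting. Two different first steps are parallel and below the top, so
  performing both in either order collects the same two labelled redexes, followed by the multiset
  \<open>K\<close> of the common reduct.\<close>

lemma rm_rel_unique:
  "ground_trm F t \<Longrightarrow> rm_rel R t m M \<Longrightarrow> rm_rel R t m N \<Longrightarrow> M = N"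
proof (induction t arbitrary: M N rule: wfp_induct_rule[OF wfp_lt])
  case (1 t)
  show ?case
  proof (cases "irreducible R t")
    case True
    then show ?thesis using 1(3,4) rm_rel_irreducible by metis
  next
    case False
    from 1(3) False obtain u v c M' where M: "(u, v) \<in> R" "t = plug c u"
      "rm_rel R (plug c v) m M'" "M = add_mset (u, redex_label c m) M'"
      by (auto elim: rm_rel_cases)
    from 1(4) False obtain u' v' c' N' where N: "(u', v') \<in> R" "t = plug c' u'"
      "rm_rel R (plug c' v') m N'" "N = add_mset (u', redex_label c' m) N'"
      by (auto elim: rm_rel_cases)
    have g: "ground_trm F (plug c v)" "lt (plug c v) t"
      "ground_trm F (plug c' v')" "lt (plug c' v') t"
      using rstep_ground rstep.intros[OF M(1), of c] rstep.intros[OF N(1), of c'] M(2) N(2) 1(2)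
      by auto
    have "plug c u = plug c' u'" using M(2) N(2) by simp
    with M(1) N(1) show ?thesis
    proof (cases rule: rstep_cases_two)
      case 1
      then show ?thesis using "1.IH"[OF g(2,1) M(3)] N M by auto
    next
      case (2 d d')
      have "ground_trm F (plug d v')"
        using rstep_ground[OF rstep.intros[OF N(1), of d]] 2 g(1) by simp
      then obtain K where K: "rm_rel R (plug d v') m K" using rm_rel_exists by blast
      have "rm_rel R (plug c v) m (add_mset (u', redex_label d m) K)"
        using rm_rel_step[OF N(1) K] 2 by simp
      then have M': "M' = add_mset (u', redex_label d m) K"
        using "1.IH"[OF g(2,1) M(3)] by blast
      have "rm_rel R (plug c' v') m (add_mset (u, redex_label d' m) K)"
        using rm_rel_step[OF M(1), of d'] K 2 by simp
      then have N': "N' = add_mset (u, redex_label d' m) K"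
        using "1.IH"[OF g(4,3) N(3)] by blast
      show ?thesis using M(4) N(4) M' N' 2 by (simp add: redex_label_def)
    qed
  qed
qed

lemma rm_eqI: "ground_trm F t \<Longrightarrow> rm_rel R t m M \<Longrightarrow> rm R t m = M"
  unfolding rm_def by (rule the_equality) (auto dest: rm_rel_unique)

lemma rm_rel_rm: "ground_trm F t \<Longrightarrow> rm_rel R t m (rm R t m)"
  using rm_rel_exists rm_eqI by metis

lemma rm_irreducible: "irreducible R t \<Longrightarrow> rm R t m = {#}"
  unfolding rm_def by (rule the_equality) (auto intro: rm_rel.irreducible dest: rm_rel_irreducible)

lemma rm_reducible:
  assumes "ground_trm F t" "\<not> irreducible R t"
  shows "rm R t m \<noteq> {#}"
  using rm_rel_rm[OF assms(1), of m] assms(2) by (auto elim: rm_rel_cases)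

lemma rm_rule: "(u, v) \<in> R \<Longrightarrow> (u, m) \<in># rm R u m"
proof -
  assume uv: "(u, v) \<in> R"
  then have "rm_rel R u m (add_mset (u, m) (rm R v m))"
    using rm_rel_step[OF uv, of Hole m "rm R v m"] rm_rel_rm[of v m] rule[OF uv]
    by (simp add: redex_label_def)
  then show ?thesis using rm_eqI rule[OF uv] by (metis union_single_eq_member)
qed

text \<open>Terms shrink along the reduction, and a redex is a subterm of the term in which it is
  contracted. Only a first step at the root has the redex \<open>t\<close> itself, and that step
  keeps the label \<open>m\<close>.\<close>

lemma rm_rel_bound:
  "rm_rel R t m M \<Longrightarrow> ground_trm F t \<Longrightarrow> (w, k) \<in># M \<Longrightarrow> lt w t \<or> w = t \<and> k = m"
proof (induction t arbitrary: M rule: wfp_induct_rule[OF wfp_lt])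
  case (1 t)
  from 1(2) show ?case
  proof (cases rule: rm_rel_cases)
    case (2 u v c M')
    have step: "ground_trm F (plug c v)" "lt (plug c v) t"
      using rstep_ground[OF rstep.intros[OF 2(1), of c]] 2(2) 1(3) by auto
    show ?thesis
    proof (cases "(w, k) \<in># M'")
      case True
      then show ?thesis using 1(1)[OF step(2) 2(3) step(1)] step(2) lt_trans by blast
    next
      case False
      then have "w = u" "k = redex_label c m" using 2(4) 1(4) by auto
      then show ?thesis using lt_subterm 1(3) 2(2) by (auto simp: redex_label_def)
    qed
  qed (use 1(4) in simp)
qed

lemma rm_bound: "ground_trm F t \<Longrightarrow> (w, k) \<in># rm R t m \<Longrightarrow> lt w t \<or> w = t \<and> k = m"
  using rm_rel_bound rm_rel_rm by blast

end

section \<open>Rewriting below a bound\<close>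

text \<open>The part of a rewrite system that is already fixed when the rule for \<open>s\<close> is
  decided.\<close>

definition below :: "('f, 'v) trm rel2 \<Rightarrow> ('f, 'v) trm \<Rightarrow> ('f, 'v) trs \<Rightarrow> ('f, 'v) trs" where
  "below lt s R = {(u, v) \<in> R. lt u s}"

context admissible_trs
begin

lemma below_subset: "below lt s R \<subseteq> R"
  by (auto simp: below_def)

lemma admissible_below: "admissible F lt (below lt s R)"
  using adm below_subset by (rule admissible_subset)

interpretation below: admissible_trs F lt "below lt s R" for s
  using admissible_below by unfold_locales

text \<open>A redex in \<open>t\<close> is at most \<open>t\<close>, so the rule applied has its
  left-hand side below \<open>s\<close>.\<close>

lemma rstep_below:
  assumes "ground_trm F t" "lt t s"
  shows "rstep (below lt s R) t t' \<longleftrightarrow> rstep R t t'"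
proof
  assume "rstep R t t'"
  then show "rstep (below lt s R) t t'" using assms
  proof (induction rule: rstep.induct)
    case (1 u v c)
    have "lt\<^sup>=\<^sup>= u (plug c u)" using 1(2) lt_subterm by (cases "c = Hole") auto
    then have "lt u s" using 1(3) le_lt_trans by blast
    then show ?case using 1(1) by (intro rstep.intros) (simp add: below_def)
  qed
qed (rule rstep_mono[OF _ below_subset])

lemma irreducible_below:
  "ground_trm F t \<Longrightarrow> lt t s \<Longrightarrow> irreducible (below lt s R) t \<longleftrightarrow> irreducible R t"
  by (simp add: irreducible_def rstep_below)

lemma rsteps_below: "(rstep (below lt s R))\<^sup>*\<^sup>* t t' \<Longrightarrow> (rstep R)\<^sup>*\<^sup>* t t'"
  by (rule rtranclp_mono[THEN predicate2D]) (auto intro: rstep_mono[OF _ below_subset])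

lemma normal_form_below:
  assumes "ground_trm F t" "lt t s"
  shows "normal_form (below lt s R) t = normal_form R t"
proof -
  have "lt (normal_form (below lt s R) t) s"
    using below.normal_form_ground assms le_lt_trans by blast
  then show ?thesis
    using assms below.normal_form below.normal_form_ground irreducible_below rsteps_below
    by (metis normal_form_eqI)
qed

text \<open>The reduction stays below \<open>s\<close> and can be replayed in \<open>R\<close>;
  uniqueness then turns this into the equation \<open>rm_below\<close>.\<close>

lemma rm_rel_below:
  "rm_rel (below lt s R) t m M \<Longrightarrow> ground_trm F t \<Longrightarrow> lt t s \<Longrightarrow> rm_rel R t m M"
proof (induction t arbitrary: M rule: wfp_induct_rule[OF wfp_lt])
  case (1 t)
  from 1(2) show ?case
  proof (cases rule: rm_rel_cases)
    case 1
    then show ?thesis using irreducible_below "1.prems" by (auto intro: rm_rel.irreducible)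
  next
    case (2 u v c M')
    have "ground_trm F (plug c v)" "lt (plug c v) t"
      using below.rstep_ground[OF rstep.intros[OF 2(1), of c]] 2(2) "1.prems" by auto
    then have "rm_rel R (plug c v) m M'" using "1.IH" 2(3) "1.prems"(3) lt_trans by blast
    then show ?thesis unfolding 2(2,4)
      using 2(1) by (intro rm_rel_step) (auto simp: below_def)
  qed
qed

lemma rm_below: "ground_trm F t \<Longrightarrow> lt t s \<Longrightarrow> rm (below lt s R) t m = rm R t m"
  using rm_rel_below below.rm_rel_rm rm_eqI by metis

lemma equivclp_below:
  "ground_trm F t \<Longrightarrow> ground_trm F t' \<Longrightarrow> lt t s \<Longrightarrow> lt t' s \<Longrightarrow>
    equivclp (rstep (below lt s R)) t t' \<longleftrightarrow> equivclp (rstep R) t t'"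
  by (simp add: equivclp_normal_form below.equivclp_normal_form normal_form_below)

end

section \<open>Normalization multisets\<close>

lemma multp_dominated: "j \<in># J \<Longrightarrow> (\<And>k. k \<in># K \<Longrightarrow> r k j) \<Longrightarrow> multp r K J"
  using one_step_implies_multp[of J K r "{#}"] by fastforce

lemma mset_uprod_Upair [simp]: "mset_uprod (Upair a b) = {#a, b#}"
  by transfer simp

lemma Neg_subst_iff:
  "Neg e \<in># C \<cdot>c \<sigma> \<longleftrightarrow> (\<exists>e'. Neg e' \<in># C \<and> e = map_uprod (\<lambda>t. t \<cdot> \<sigma>) e')"
proof -
  have "Neg e = L \<cdot>l \<sigma> \<longleftrightarrow> (\<exists>e'. L = Neg e' \<and> e = map_uprod (\<lambda>t. t \<cdot> \<sigma>) e')" for L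
    by (cases L) (auto simp: subst_lit_def)
  then show ?thesis unfolding subst_cls_def by (simp add: image_iff) blast
qed

lemma ts_neg_subst: "ts_neg (C \<cdot>c \<sigma>) = (\<lambda>t. t \<cdot> \<sigma>) ` ts_neg C"
  unfolding ts_neg_def Neg_subst_iff by (fastforce simp: uprod.set_map)

lemma Pos_subst_iff:
  "Pos e \<in># C \<cdot>c \<sigma> \<longleftrightarrow> (\<exists>e'. Pos e' \<in># C \<and> e = map_uprod (\<lambda>t. t \<cdot> \<sigma>) e')"
proof -
  have "Pos e = L \<cdot>l \<sigma> \<longleftrightarrow> (\<exists>e'. L = Pos e' \<and> e = map_uprod (\<lambda>t. t \<cdot> \<sigma>) e')" for L
    by (cases L) (auto simp: subst_lit_def)
  then show ?thesis unfolding subst_cls_def by (simp add: image_iff) blast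
qed

lemma ts_pos_subst: "ts_pos (C \<cdot>c \<sigma>) = (\<lambda>t. t \<cdot> \<sigma>) ` ts_pos C"
  unfolding ts_pos_def Pos_subst_iff by (fastforce simp: uprod.set_map)

lemma subst_cls_memberI: "L \<in># C \<Longrightarrow> L \<cdot>l \<sigma> \<in># C \<cdot>c \<sigma>"
  by (simp add: subst_cls_def)

lemma ts_negE:
  assumes "t \<in> ts_neg C"
  obtains t' where "Neg (Upair t t') \<in># C"
proof -
  from assms obtain e where e: "Neg e \<in># C" "t \<in> set_uprod e" by (auto simp: ts_neg_def)
  then show thesis using that by (cases e) (auto, metis Upair_inject)
qed

lemma ts_posE:
  assumes "t \<in> ts_pos C"
  obtains t' where "Pos (Upair t t') \<in># C"
proof -
  from assms obtain e where e: "Pos e \<in># C" "t \<in> set_uprod e" by (auto simp: ts_pos_def)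
  then show thesis using that by (cases e) (auto, metis Upair_inject)
qed

lemma ts_subset_trms: "ts_neg C \<union> ts_pos C = trms_cls C"
proof
  show "ts_neg C \<union> ts_pos C \<subseteq> trms_cls C" by (force simp: ts_neg_def ts_pos_def trms_cls_def)
  show "trms_cls C \<subseteq> ts_neg C \<union> ts_pos C"
  proof
    fix t assume "t \<in> trms_cls C"
    then obtain L where "L \<in># C" "t \<in> set_literal L" by (auto simp: trms_cls_def)
    then show "t \<in> ts_neg C \<union> ts_pos C" by (cases L) (auto simp: ts_neg_def ts_pos_def)
  qed
qed

lemma finite_trms_cls: "finite (trms_cls C)"
  by (auto simp: trms_cls_def)

lemma finite_ts [simp]: "finite (ts_neg C)" "finite (ts_pos C)"
  using finite_trms_cls[of C] unfolding ts_subset_trms[symmetric] by auto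

lemma ss_neg_conv: "u \<in> ss_neg C \<longleftrightarrow> (\<exists>t \<in> ts_neg C. u \<in> subterms t)"
  by (simp add: ss_neg_def)

lemma ss_pos_below_conv: "u \<in> ss_pos_below C \<longleftrightarrow> (\<exists>t \<in> ts_pos C. u \<in> proper_subterms t)"
  by (simp add: ss_pos_below_def)

lemma finite_lss [simp]: "finite (lss C)"
proof -
  have "lss C \<subseteq> (ss_neg C \<union> ss_pos_below C \<union> ts_pos C) \<times> {0, 1, 2}"
    by (auto simp: lss_def)
  then show ?thesis
    by (rule finite_subset) (auto simp: ss_neg_def ss_pos_below_def)
qed

lemma finite_lts [simp]: "finite (lts C)"
proof -
  have "lts C \<subseteq> (ts_neg C \<union> ts_pos C) \<times> {0, 2}"
    by (auto simp: lts_def)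
  then show ?thesis by (rule finite_subset) auto
qed

lemma lss_subterm:
  assumes "(t, m) \<in> lss C"
  obtains t' where "t' \<in> trms_cls C" "t \<in> subterms t'"
proof -
  from assms have "t \<in> ss_neg C \<or> t \<in> ss_pos_below C \<or> t \<in> ts_pos C"
    by (auto simp: lss_def)
  then have "\<exists>t' \<in> ts_neg C \<union> ts_pos C. t \<in> subterms t'"
    unfolding ss_neg_def ss_pos_below_def subterms_conv_proper by blast
  then show thesis unfolding ts_subset_trms using that by blast
qed

lemma lts_trms: "(t, m) \<in> lts C \<Longrightarrow> t \<in> trms_cls C"
  unfolding lts_def ts_subset_trms[symmetric] by auto

lemma trms_cls_lss:
  assumes "t' \<in> trms_cls C" "t \<in> subterms t'"
  shows "\<exists>m. (t, m) \<in> lss C"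
proof -
  have "t \<in> ss_neg C \<or> t \<in> ss_pos_below C \<or> t \<in> ts_pos C"
    using assms unfolding ts_subset_trms[symmetric] ss_neg_def ss_pos_below_def
      subterms_conv_proper by blast
  then show ?thesis by (auto simp: lss_def)
qed

lemma vars_lss: "(t, m) \<in> lss C \<Longrightarrow> x \<in> vars_trm t \<Longrightarrow> x \<in> vars_cls C"
  unfolding vars_cls_def using vars_subterms lss_subterm by (metis UN_I subsetD)

lemma vars_lts: "(t, m) \<in> lts C \<Longrightarrow> x \<in> vars_trm t \<Longrightarrow> x \<in> vars_cls C"
  unfolding vars_cls_def using lts_trms by blast

text \<open>The term whose normalization contributes the redexes for \<open>t\<close>.\<close>

fun nm_arg :: "('f, 'v) trs \<Rightarrow> ('f, 'v) subst \<Rightarrow> ('f, 'v) trm \<Rightarrow> ('f, 'v) trm" where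
  "nm_arg R \<theta> (Var x) = \<theta> x"
| "nm_arg R \<theta> (Fun f ts) = Fun f (map (\<lambda>s. normal_form R (s \<cdot> \<theta>)) ts)"

lemma nm_conv:
  "nm R (C, \<theta>) = (\<Sum>p \<in> lss C. rm R (nm_arg R \<theta> (fst p)) (snd p))
    + (\<Sum>p \<in> lts C. {#(normal_form R (fst p \<cdot> \<theta>), snd p)#})"
proof -
  have "(\<lambda>(t, m). case t of
        Fun f ts \<Rightarrow> rm R (Fun f (map (\<lambda>s. normal_form R (s \<cdot> \<theta>)) ts)) m
      | Var x \<Rightarrow> rm R (\<theta> x) m) = (\<lambda>p. rm R (nm_arg R \<theta> (fst p)) (snd p))"
    by (auto simp: fun_eq_iff split: trm.splits)
  then show ?thesis by (simp add: case_prod_beta')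
qed

declare nm.simps [simp del]

lemma nm_arg_cong: "(\<And>x. x \<in> vars_trm t \<Longrightarrow> \<theta> x = \<theta>' x) \<Longrightarrow> nm_arg R \<theta> t = nm_arg R \<theta>' t"
proof (cases t)
  case (Fun f ts)
  assume *: "\<And>x. x \<in> vars_trm t \<Longrightarrow> \<theta> x = \<theta>' x"
  have "s \<cdot> \<theta> = s \<cdot> \<theta>'" if "s \<in> set ts" for s
    using that * Fun by (intro subst_trm_cong) auto
  then show ?thesis using Fun by simp
qed simp

lemma nm_cong:
  assumes "\<And>x. x \<in> vars_cls C \<Longrightarrow> \<theta> x = \<theta>' x"
  shows "nm R (C, \<theta>) = nm R (C, \<theta>')"
proof -
  have "nm_arg R \<theta> (fst p) = nm_arg R \<theta>' (fst p)" if "p \<in> lss C" for p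
    using that assms by (cases p) (auto intro!: nm_arg_cong dest: vars_lss)
  moreover have "fst p \<cdot> \<theta> = fst p \<cdot> \<theta>'" if "p \<in> lts C" for p
    using that assms by (cases p) (auto intro!: subst_trm_cong dest: vars_lts)
  ultimately show ?thesis by (simp add: nm_conv)
qed

lemma subterms_renaming:
  "subterms (t \<cdot> (\<lambda>x. Var (\<pi> x))) = (\<lambda>t. t \<cdot> (\<lambda>x. Var (\<pi> x))) ` subterms t"
  by (induction t) auto

lemma proper_subterms_renaming:
  "proper_subterms (t \<cdot> (\<lambda>x. Var (\<pi> x))) = (\<lambda>t. t \<cdot> (\<lambda>x. Var (\<pi> x))) ` proper_subterms t"
  by (cases t) (auto simp: subterms_renaming)

lemma inj_renaming:
  assumes "bij \<pi>"
  shows "inj (\<lambda>t. t \<cdot> (\<lambda>x. Var (\<pi> x)))"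
proof (rule inj_on_inverseI)
  show "t \<cdot> (\<lambda>x. Var (\<pi> x)) \<cdot> (\<lambda>x. Var (inv \<pi> x)) = t" for t :: "('b, 'a) trm"
    using assms by (simp add: subst_trm_comp bij_is_inj)
qed

text \<open>A bijective renaming is injective on terms, so it reindexes the sets of labelled terms
  without merging summands.\<close>

lemma nm_renaming:
  assumes "bij \<pi>"
  shows "nm R (C \<cdot>c (\<lambda>x. Var (\<pi> x)), \<theta>) = nm R (C, \<lambda>x. \<theta> (\<pi> x))"
proof -
  let ?\<rho> = "\<lambda>x. Var (\<pi> x)"
  define g where "g = (\<lambda>t :: ('b, 'a) trm. t \<cdot> ?\<rho>)"
  have inj: "inj g" unfolding g_def using assms by (rule inj_renaming)
  have ts: "ts_neg (C \<cdot>c ?\<rho>) = g ` ts_neg C" "ts_pos (C \<cdot>c ?\<rho>) = g ` ts_pos C"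
    by (simp_all add: ts_neg_subst ts_pos_subst g_def)
  have ss: "ss_neg (C \<cdot>c ?\<rho>) = g ` ss_neg C" "ss_pos_below (C \<cdot>c ?\<rho>) = g ` ss_pos_below C"
    unfolding ss_neg_def ss_pos_below_def ts
    by (simp_all add: g_def subterms_renaming proper_subterms_renaming image_UN)
  have labelled: "{(t, k) |t. t \<in> g ` A} = map_prod g id ` {(t, k) |t. t \<in> A}" for A and k :: nat
    by force
  have lss: "lss (C \<cdot>c ?\<rho>) = map_prod g id ` lss C"
    unfolding lss_def ts ss image_Un[symmetric] image_set_diff[OF inj, symmetric] labelled ..
  have lts: "lts (C \<cdot>c ?\<rho>) = map_prod g id ` lts C"
    unfolding lts_def ts image_Un[symmetric] image_set_diff[OF inj, symmetric] labelled ..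
  have inj': "inj_on (map_prod g id) A" for A :: "(('b, 'a) trm \<times> nat) set"
    using inj prod.inj_map[of g id] by (auto intro: inj_on_subset)
  have "nm_arg R \<theta> (g t) = nm_arg R (\<lambda>x. \<theta> (\<pi> x)) t" for t
    by (cases t) (auto simp: g_def subst_trm_comp)
  moreover have "g t \<cdot> \<theta> = t \<cdot> (\<lambda>x. \<theta> (\<pi> x))" for t
    by (simp add: g_def subst_trm_comp)
  ultimately show ?thesis
    unfolding nm_conv lss lts by (simp add: sum.reindex[OF inj'])
qed

lemma same_closure_cong:
  "(\<And>x. x \<in> vars_cls C \<Longrightarrow> \<theta> x = \<theta>' x) \<Longrightarrow> same_closure (C, \<theta>) (C, \<theta>')"
  by (auto simp: same_closure_def variant_refl intro: subst_cls_cong)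

lemma same_closure_renaming:
  "bij \<pi> \<Longrightarrow> same_closure (C \<cdot>c (\<lambda>x. Var (\<pi> x)), \<theta>) (C, \<lambda>x. \<theta> (\<pi> x))"
proof -
  assume \<pi>: "bij \<pi>"
  have "C = C \<cdot>c (\<lambda>x. Var (\<pi> x)) \<cdot>c (\<lambda>x. Var (inv \<pi> x))"
    using \<pi> by (simp add: subst_cls_comp bij_is_inj)
  then show ?thesis
    unfolding same_closure_def variant_def using bij_imp_bij_inv[OF \<pi>]
    by (auto simp: subst_cls_comp)
qed

text \<open>Closures are pairs rather than classes, so invariance under identification is passed on
  from the tie-breaker. It is applied after changing a substitution off the clause variables and
  after renaming premises apart.\<close>

lemma lt_closure_cong:
  assumes "tiebreak_ordering F lt_clo"
    and "same_closure c c'" "nm R c = nm R c'" "same_closure d d'" "nm R d = nm R d'"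
    and "lt_closure lt lt_clo R c d"
  shows "lt_closure lt lt_clo R c' d'"
  using assms unfolding lt_closure_def same_closure_def tiebreak_ordering_def by metis

section \<open>Well-foundedness of the orderings, and closures with a strictly maximal
  equation\<close>

context ground_total_ordering
begin

lemma transp_lt_lit: "transp (lt_lit lt)"
  unfolding lt_lit_def using transp_multp[OF transp_lt] by (auto intro!: transpI dest: transpD)

lemma wfp_lt_lit: "wfp (lt_lit lt)"
proof (rule wfp_if_convertible_to_wfp)
  show "wfp (multp lt)" by (rule wfp_multp[OF wfp_lt])
qed (simp add: lt_lit_def)

lemma wfp_lt_cls: "wfp (lt_cls lt)"
  unfolding lt_cls_def by (rule wfp_multp[OF wfp_lt_lit])

lemma transp_lt_labelled: "transp (lt_labelled lt)"
proof (rule transpI)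
  fix x y z assume "lt_labelled lt x y" "lt_labelled lt y z"
  then show "lt_labelled lt x z"
    by (cases x; cases y; cases z) (auto intro: lt_trans)
qed

lemma wfp_lt_labelled: "wfp (lt_labelled lt)"
proof -
  have "wf ({(x, y). lt x y} <*lex*> less_than)"
    using wfp_lt by (auto simp: wfp_def)
  then have "wf {(x, y). lt_labelled lt x y}"
    by (rule wf_subset) auto
  then show ?thesis by (simp add: wfp_def)
qed

lemma wfp_lt_closure:
  assumes "tiebreak_ordering F lt_clo"
  shows "wfp (lt_closure lt lt_clo R)"
proof -
  let ?r = "{(x, y). multp (lt_labelled lt) x y} <*lex*> {(x, y). lt_cls lt x y}
    <*lex*> {(x, y). lt_clo x y}"
  have "wf ?r"
    using wfp_multp[OF wfp_lt_labelled] wfp_lt_cls assms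
    unfolding tiebreak_ordering_def wfp_def by (intro wf_lex_prod) auto
  then have "wf (inv_image ?r (\<lambda>c. (nm R c, inst c, c)))"
    by (rule wf_inv_image)
  then have "wf {(c, d). lt_closure lt lt_clo R c d}"
    by (rule wf_subset) (auto simp: lt_closure_def)
  then show ?thesis by (simp add: wfp_def)
qed

lemma ground_lss: "ground_cls F (C \<cdot>c \<theta>) \<Longrightarrow> (t, m) \<in> lss C \<Longrightarrow> ground_trm F (t \<cdot> \<theta>)"
  unfolding ground_cls_def trms_subst_cls
  by (blast elim: lss_subterm intro: ground_subterm subterms_subst)

lemma ground_lts: "ground_cls F (C \<cdot>c \<theta>) \<Longrightarrow> (t, m) \<in> lts C \<Longrightarrow> ground_trm F (t \<cdot> \<theta>)"
  unfolding ground_cls_def trms_subst_cls by (blast dest: lts_trms)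

lemma ground_vars_cls: "ground_cls F (C \<cdot>c \<theta>) \<Longrightarrow> x \<in> vars_cls C \<Longrightarrow> ground_trm F (\<theta> x)"
proof -
  assume g: "ground_cls F (C \<cdot>c \<theta>)" and "x \<in> vars_cls C"
  then obtain t where "t \<in> trms_cls C" "Var x \<in> subterms t"
    by (auto simp: vars_cls_def Var_subterms_iff)
  with g show ?thesis
    using trms_cls_lss[of t C "Var x"] ground_lss[of C \<theta> "Var x"] by auto
qed

lemma ground_lit:
  assumes "ground_cls F (C \<cdot>c \<theta>)" and "Pos (Upair s t) \<in># C \<or> Neg (Upair s t) \<in># C"
  shows "ground_trm F (s \<cdot> \<theta>)" "ground_trm F (t \<cdot> \<theta>)"
proof -
  have "s \<in> trms_cls C" "t \<in> trms_cls C" using assms(2) by (force simp: trms_cls_def)+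
  then show "ground_trm F (s \<cdot> \<theta>)" "ground_trm F (t \<cdot> \<theta>)"
    using assms(1) by (auto simp: ground_cls_def trms_subst_cls)
qed

text \<open>The conditions on a rule-producing closure that do not mention a rewrite system.\<close>

definition max_eqn :: "('f, 'v) cls \<Rightarrow> ('f, 'v) subst \<Rightarrow> ('f, 'v) trm \<Rightarrow> ('f, 'v) trm \<Rightarrow> bool" where
  "max_eqn C \<theta> t t' \<longleftrightarrow> horn C \<and> ground_closure F (C, \<theta>) \<and> Pos (Upair t t') \<in># C
     \<and> strictly_maximal_lit lt (Pos (Upair t t') \<cdot>l \<theta>) (C \<cdot>c \<theta>) \<and> lt (t' \<cdot> \<theta>) (t \<cdot> \<theta>)"

lemma max_eqn_ground:
  assumes "max_eqn C \<theta> t t'"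
  shows "ground_cls F (C \<cdot>c \<theta>)" "ground_trm F (t \<cdot> \<theta>)" "ground_trm F (t' \<cdot> \<theta>)"
  using assms ground_lit[of C \<theta> t t'] by (auto simp: max_eqn_def ground_closure_def)

lemma horn_add_Pos:
  assumes "horn (add_mset (Pos e) C)" "L \<in># C"
  obtains s s' where "L = Neg (Upair s s')"
proof (cases L rule: literal_cases)
  case (Pos s t)
  from assms(2) obtain C' where "C = add_mset L C'" by (rule mset_add)
  then show thesis using assms(1) Pos by (simp add: horn_def)
qed (rule that)

lemma horn_Pos:
  assumes "horn C" "Pos e \<in># C" "L \<in># C" "L \<noteq> Pos e"
  obtains s s' where "L = Neg (Upair s s')"
proof -
  from assms(2) obtain C' where "C = add_mset (Pos e) C'" by (rule mset_add)
  then show thesis using assms horn_add_Pos that by auto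
qed

text \<open>A negative literal lists each side twice. If \<open>q \<cdot> \<theta>\<close> were at
  least \<open>t \<cdot> \<theta>\<close>, its literal would therefore exceed the maximal
  equation.\<close>

lemma max_eqn_ts_neg:
  assumes "max_eqn C \<theta> t t'" "q \<in> ts_neg C"
  shows "lt (q \<cdot> \<theta>) (t \<cdot> \<theta>)"
proof (rule ccontr)
  assume nlt: "\<not> lt (q \<cdot> \<theta>) (t \<cdot> \<theta>)"
  obtain r where qr: "Neg (Upair q r) \<in># C" using ts_negE[OF assms(2)] .
  have "ground_trm F (q \<cdot> \<theta>)" "ground_trm F (t \<cdot> \<theta>)"
    using max_eqn_ground[OF assms(1)] ground_lit qr by blast+
  then consider "q \<cdot> \<theta> = t \<cdot> \<theta>" | "lt (t \<cdot> \<theta>) (q \<cdot> \<theta>)" using lt_total nlt by blast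
  then have "multp lt {#t' \<cdot> \<theta>, t \<cdot> \<theta>#} {#r \<cdot> \<theta>, q \<cdot> \<theta>, r \<cdot> \<theta>, q \<cdot> \<theta>#}"
  proof cases
    case 1
    \<comment> \<open>One copy of \<open>q \<cdot> \<theta>\<close> cancels against
      \<open>t \<cdot> \<theta>\<close>; the second copy dominates
      \<open>t' \<cdot> \<theta>\<close>.\<close>
    then show ?thesis
      using one_step_implies_multp[of "{#r \<cdot> \<theta>, q \<cdot> \<theta>, r \<cdot> \<theta>#}" "{#t' \<cdot> \<theta>#}" lt "{#t \<cdot> \<theta>#}"] assms(1)
      by (auto simp: max_eqn_def)
  next
    case 2
    then show ?thesis using assms(1)
      by (intro multp_dominated[of "q \<cdot> \<theta>"]) (auto simp: max_eqn_def intro: lt_trans)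
  qed
  then have "lt_lit lt (Pos (Upair t t') \<cdot>l \<theta>) (Neg (Upair q r) \<cdot>l \<theta>)"
    by (simp add: lt_lit_def add_mset_commute)
  moreover have "Neg (Upair q r) \<cdot>l \<theta> \<in># C \<cdot>c \<theta> - {#Pos (Upair t t') \<cdot>l \<theta>#}"
    using subst_cls_memberI[OF qr, of \<theta>] by (simp add: in_diff_count)
  ultimately show False using assms(1) by (auto simp: max_eqn_def strictly_maximal_lit_def)
qed

lemma max_eqn_ts_pos:
  assumes "max_eqn C \<theta> t t'"
  shows "ts_pos C = {t, t'}"
proof -
  have "e = Upair t t'" if e: "Pos e \<in># C" for e
  proof (rule ccontr)
    assume "e \<noteq> Upair t t'"
    then have ne: "Pos e \<noteq> Pos (Upair t t')" by simp
    have "horn C" "Pos (Upair t t') \<in># C" using assms by (auto simp: max_eqn_def)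
    then obtain s s' where "Pos e = Neg (Upair s s')" using e ne by (rule horn_Pos)
    then show False by simp
  qed
  moreover have "Pos (Upair t t') \<in># C" using assms by (simp add: max_eqn_def)
  ultimately have "{e. Pos e \<in># C} = {Upair t t'}" by blast
  then show ?thesis by (simp add: ts_pos_def)
qed

lemma max_eqn_below:
  assumes "max_eqn C \<theta> t t'" "p \<in> ss_neg C \<union> ss_pos_below C"
  shows "lt (p \<cdot> \<theta>) (t \<cdot> \<theta>)"
  using assms(2)
proof
  assume "p \<in> ss_neg C"
  then obtain q where q: "q \<in> ts_neg C" "p \<in> subterms q" by (auto simp: ss_neg_conv)
  then have "ground_trm F (q \<cdot> \<theta>)"
    using max_eqn_ground[OF assms(1)] ts_negE[OF q(1)] ground_lit by metis
  then show ?thesis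
    using le_subterm subterms_subst[OF q(2)] max_eqn_ts_neg[OF assms(1) q(1)] le_lt_trans by blast
next
  assume "p \<in> ss_pos_below C"
  then obtain q where q: "q = t \<or> q = t'" "p \<in> proper_subterms q"
    using max_eqn_ts_pos[OF assms(1)] by (auto simp: ss_pos_below_conv)
  then have "lt (p \<cdot> \<theta>) (q \<cdot> \<theta>)"
    using max_eqn_ground[OF assms(1)] lt_proper_subterm proper_subterms_subst by blast
  then show ?thesis using q(1) assms(1) lt_trans by (auto simp: max_eqn_def)
qed

text \<open>Instances of negative and of non-top positive subterms lie strictly below
  \<open>t \<cdot> \<theta>\<close>, so \<open>t\<close> itself gets label \<open>0\<close>. It is
  the only labelled term whose instance reaches the maximal term.\<close>

lemma max_eqn_lss:
  assumes "max_eqn C \<theta> t t'"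
  shows "(t, 0) \<in> lss C" "(p, m) \<in> lss C \<Longrightarrow> (p, m) \<noteq> (t, 0) \<Longrightarrow> lt (p \<cdot> \<theta>) (t \<cdot> \<theta>)"
proof -
  have "t \<notin> ss_neg C \<union> ss_pos_below C" using max_eqn_below[OF assms, of t] lt_irrefl by blast
  then show "(t, 0) \<in> lss C" by (auto simp: lss_def max_eqn_ts_pos[OF assms])
  assume "(p, m) \<in> lss C" "(p, m) \<noteq> (t, 0)"
  then show "lt (p \<cdot> \<theta>) (t \<cdot> \<theta>)"
    using max_eqn_below[OF assms, of p] assms
    by (auto simp: lss_def max_eqn_ts_pos[OF assms] max_eqn_def)
qed

lemma max_eqn_lts:
  assumes "max_eqn C \<theta> t t'"
  shows "(t, 0) \<in> lts C" "(p, m) \<in> lts C \<Longrightarrow> (p, m) \<noteq> (t, 0) \<Longrightarrow> lt (p \<cdot> \<theta>) (t \<cdot> \<theta>)"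
proof -
  have "t \<notin> ts_neg C" using max_eqn_ts_neg[OF assms, of t] lt_irrefl by blast
  then show "(t, 0) \<in> lts C" by (auto simp: lts_def max_eqn_ts_pos[OF assms])
  assume "(p, m) \<in> lts C" "(p, m) \<noteq> (t, 0)"
  then show "lt (p \<cdot> \<theta>) (t \<cdot> \<theta>)"
    using max_eqn_ts_neg[OF assms, of p] assms
    by (auto simp: lts_def max_eqn_ts_pos[OF assms] max_eqn_def)
qed

text \<open>This provides the clause-order condition of Parallel Superposition. Some literal of
  \<open>C\<close> containing \<open>u\<close> exceeds the maximal equation of \<open>D\<close>: in
  a negative literal the doubled sides decide a tie, and below the top of a positive literal the
  side is strictly larger. The other literals of \<open>D\<close> consist of terms below
  \<open>t \<cdot> \<theta>'\<close>, so this literal dominates all of \<open>D\<close>.\<close>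

lemma max_eqn_lt_cls:
  assumes D: "max_eqn D \<theta>' t t'" and C: "ground_cls F (C \<cdot>c \<theta>)"
    and u: "u \<in> ss_neg C \<union> ss_pos_below C" and eq: "u \<cdot> \<theta> = t \<cdot> \<theta>'"
  shows "lt_cls lt (D \<cdot>c \<theta>') (C \<cdot>c \<theta>)"
proof -
  have t': "lt (t' \<cdot> \<theta>') (t \<cdot> \<theta>')" using D by (simp add: max_eqn_def)
  obtain L p where L: "L \<in># C \<cdot>c \<theta>" "p \<in># mset_lit L" "lt\<^sup>=\<^sup>= (t \<cdot> \<theta>') p"
    and tt': "multp lt {#t \<cdot> \<theta>', t' \<cdot> \<theta>'#} (mset_lit L)"
  proof (cases "u \<in> ss_neg C")
    case True
    then obtain q where q: "q \<in> ts_neg C" "u \<in> subterms q" by (auto simp: ss_neg_conv)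
    obtain r where r: "Neg (Upair q r) \<in># C" using ts_negE[OF q(1)] .
    have le: "lt\<^sup>=\<^sup>= (t \<cdot> \<theta>') (q \<cdot> \<theta>)"
      using le_subterm[OF ground_lit(1)[OF C] subterms_subst[OF q(2)]] r eq by metis
    have "multp lt {#t' \<cdot> \<theta>', t \<cdot> \<theta>'#} {#r \<cdot> \<theta>, q \<cdot> \<theta>, r \<cdot> \<theta>, q \<cdot> \<theta>#}"
    proof (cases "t \<cdot> \<theta>' = q \<cdot> \<theta>")
      case True
      then show ?thesis
        using one_step_implies_multp[of "{#r \<cdot> \<theta>, q \<cdot> \<theta>, r \<cdot> \<theta>#}" "{#t' \<cdot> \<theta>'#}" lt "{#t \<cdot> \<theta>'#}"] t'
        by auto
    next
      case False
      then show ?thesis using le t'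
        by (intro multp_dominated[of "q \<cdot> \<theta>"]) (auto intro: lt_trans)
    qed
    then show thesis using subst_cls_memberI[OF r] le
      by (intro that[of "Neg (Upair q r) \<cdot>l \<theta>" "q \<cdot> \<theta>"]) (auto simp: add_mset_commute)
  next
    case False
    then obtain q where q: "q \<in> ts_pos C" "u \<in> proper_subterms q"
      using u by (auto simp: ss_pos_below_conv)
    obtain r where r: "Pos (Upair q r) \<in># C" using ts_posE[OF q(1)] .
    have less: "lt (t \<cdot> \<theta>') (q \<cdot> \<theta>)"
      using lt_proper_subterm[OF ground_lit(1)[OF C] proper_subterms_subst[OF q(2)]] r eq by metis
    have "multp lt {#t \<cdot> \<theta>', t' \<cdot> \<theta>'#} {#q \<cdot> \<theta>, r \<cdot> \<theta>#}"
      using less t' by (intro multp_dominated[of "q \<cdot> \<theta>"]) (auto intro: lt_trans)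
    then show thesis using subst_cls_memberI[OF r] less
      by (intro that[of "Pos (Upair q r) \<cdot>l \<theta>" "q \<cdot> \<theta>"]) auto
  qed
  have "lt_lit lt K L" if "K \<in># D \<cdot>c \<theta>'" for K
  proof -
    from that obtain K' where K': "K' \<in># D" "K = K' \<cdot>l \<theta>'" by (auto simp: subst_cls_def)
    show ?thesis
    proof (cases "K' = Pos (Upair t t')")
      case True
      then show ?thesis using tt' K' by (simp add: lt_lit_def)
    next
      case False
      then obtain q r where qr: "K' = Neg (Upair q r)"
        using horn_Pos[of D "Upair t t'" K'] D K' by (auto simp: max_eqn_def)
      then have "q \<in> ts_neg D" "r \<in> ts_neg D" using K' by (force simp: ts_neg_def)+
      then have "lt (q \<cdot> \<theta>') p" "lt (r \<cdot> \<theta>') p"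
        using max_eqn_ts_neg[OF D] L(3) lt_le_trans by blast+
      then show ?thesis unfolding lt_lit_def K'(2) qr
        by (intro multp_dominated[OF L(2)]) auto
    qed
  qed
  then show ?thesis unfolding lt_cls_def by (rule multp_dominated[OF L(1)])
qed

end

section \<open>Normalization multisets over an admissible system\<close>

context admissible_trs
begin

lemma nm_arg_rsteps:
  assumes "ground_trm F (t \<cdot> \<theta>)"
  shows "(rstep R)\<^sup>*\<^sup>* (t \<cdot> \<theta>) (nm_arg R \<theta> t)"
proof (cases t)
  case (Fun f ts)
  have "(rstep R)\<^sup>*\<^sup>* (Fun f (map (\<lambda>s. s \<cdot> \<theta>) ts)) (Fun f (map (\<lambda>s. normal_form R (s \<cdot> \<theta>)) ts))"
    by (rule rsteps_args) (use assms Fun normal_form in \<open>auto simp: ground_Fun\<close>)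
  then show ?thesis using Fun by simp
qed simp

lemma nm_arg_bound:
  assumes "ground_trm F (t \<cdot> \<theta>)"
  shows "ground_trm F (nm_arg R \<theta> t)" "lt\<^sup>=\<^sup>= (nm_arg R \<theta> t) (t \<cdot> \<theta>)"
  using rsteps_ground[OF nm_arg_rsteps[OF assms] assms] by auto

lemma nm_arg_irreducible:
  assumes "\<And>p. p \<in> proper_subterms (t \<cdot> \<theta>) \<Longrightarrow> irreducible R p"
  shows "nm_arg R \<theta> t = t \<cdot> \<theta>"
proof (cases t)
  case (Fun f ts)
  have "normal_form R (s \<cdot> \<theta>) = s \<cdot> \<theta>" if "s \<in> set ts" for s
    using assms[of "s \<cdot> \<theta>"] that Fun subterms_refl
    by (auto intro!: normal_form_irreducible simp del: subterms_refl)
  then show ?thesis using Fun by simp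
qed simp

text \<open>A summand of a compound term already uses normalized arguments, and a summand of
  \<open>lts\<close> a normal form, so neither changes when \<open>\<theta>\<close> is normalized.
  Only the redexes inside variable instances disappear, and \<open>x\<close> contributes at least
  one.\<close>

lemma nm_normalize:
  assumes "ground_cls F (C \<cdot>c \<theta>)" and x: "x \<in> vars_cls C" "\<not> irreducible R (\<theta> x)"
  shows "multp (lt_labelled lt) (nm R (C, \<lambda>x. normal_form R (\<theta> x))) (nm R (C, \<theta>))"
proof -
  let ?\<theta>' = "\<lambda>x. normal_form R (\<theta> x)"
  \<comment> \<open>The redexes that a summand loses when \<open>\<theta>\<close> is
    normalized.\<close>
  define g where "g p = (if is_Var (fst p) then rm R (fst p \<cdot> \<theta>) (snd p) else {#})"
    for p :: "('f, 'v) trm \<times> nat"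
  have lss: "rm R (nm_arg R \<theta> (fst p)) (snd p) = rm R (nm_arg R ?\<theta>' (fst p)) (snd p) + g p"
    if p: "p \<in> lss C" for p
  proof (cases p)
    case (Pair t m)
    have gr: "ground_trm F (t \<cdot> \<theta>)" using ground_lss assms(1) p Pair by blast
    show ?thesis
    proof (cases t)
      case (Var y)
      then show ?thesis using Pair gr normal_form rm_irreducible by (simp add: g_def)
    next
      case (Fun f ts)
      then have "normal_form R (s \<cdot> \<theta>) = normal_form R (s \<cdot> ?\<theta>')" if "s \<in> set ts" for s
        using normal_form_subst[of s \<theta>] gr that by (auto simp: ground_Fun)
      then have "nm_arg R \<theta> t = nm_arg R ?\<theta>' t"
        unfolding Fun nm_arg.simps by (metis (no_types, lifting) map_cong)
      then show ?thesis using Pair Fun by (simp add: g_def del: nm_arg.simps)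
    qed
  qed
  have "normal_form R (fst p \<cdot> \<theta>) = normal_form R (fst p \<cdot> ?\<theta>')" if "p \<in> lts C" for p
    using normal_form_subst[of "fst p" \<theta>] ground_lts[OF assms(1), of "fst p" "snd p"] that by simp
  then have *: "nm R (C, \<theta>) = nm R (C, ?\<theta>') + (\<Sum>p \<in> lss C. g p)"
    by (simp add: nm_conv lss sum.distrib)
  obtain m where m: "(Var x, m) \<in> lss C"
    using x(1) trms_cls_lss by (fastforce simp: vars_cls_def Var_subterms_iff[symmetric])
  then have "g (Var x, m) \<noteq> {#}"
    using rm_reducible ground_lss[OF assms(1) m] x(2) by (simp add: g_def)
  then have "(\<Sum>p \<in> lss C. g p) \<noteq> {#}"
    using m by (metis finite_lss sum_eq_empty_iff)
  then show ?thesis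
    unfolding * by (intro subset_implies_multp) (simp add: subset_mset.less_le)
qed

text \<open>Each collected redex is bounded by the term being normalized; by
  \<open>max_eqn_lss\<close> and \<open>max_eqn_lts\<close> only \<open>t\<close> with label
  \<open>0\<close> reaches the bound \<open>t \<cdot> \<theta>\<close>.\<close>

lemma nm_max_eqn_bound:
  assumes D: "max_eqn D \<theta> t t'" and w: "(w, k) \<in># nm R (D, \<theta>)"
  shows "lt w (t \<cdot> \<theta>) \<or> w = t \<cdot> \<theta> \<and> k = 0"
proof -
  note gr = max_eqn_ground(1)[OF D]
  from w have "(\<exists>p m. (p, m) \<in> lss D \<and> (w, k) \<in># rm R (nm_arg R \<theta> p) m)
      \<or> (\<exists>p. (p, k) \<in> lts D \<and> w = normal_form R (p \<cdot> \<theta>))"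
    unfolding nm_conv by (auto simp: set_mset_sum)
  then show ?thesis
  proof (elim disjE exE conjE)
    fix p m assume p: "(p, m) \<in> lss D" and w: "(w, k) \<in># rm R (nm_arg R \<theta> p) m"
    have g: "ground_trm F (p \<cdot> \<theta>)" using ground_lss[OF gr p] .
    have "lt w (nm_arg R \<theta> p) \<or> w = nm_arg R \<theta> p \<and> k = m"
      using rm_bound[OF nm_arg_bound(1)[OF g] w] .
    then have *: "lt w (p \<cdot> \<theta>) \<or> w = p \<cdot> \<theta> \<and> k = m"
      using nm_arg_bound(2)[OF g] by (auto intro: lt_trans)
    show ?thesis
    proof (cases "(p, m) = (t, 0)")
      case False
      then show ?thesis using max_eqn_lss(2)[OF D p] * lt_trans by blast
    qed (use * in auto)
  next
    fix p assume p: "(p, k) \<in> lts D" and w: "w = normal_form R (p \<cdot> \<theta>)"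
    have le: "lt\<^sup>=\<^sup>= w (p \<cdot> \<theta>)"
      unfolding w using normal_form_ground[OF ground_lts[OF gr p]] by blast
    show ?thesis
    proof (cases "(p, k) = (t, 0)")
      case False
      then show ?thesis using max_eqn_lts(2)[OF D p] le le_lt_trans by blast
    qed (use le in auto)
  qed
qed

text \<open>Proper subterms of a left-hand side are irreducible, so normalizing arguments leaves the
  redex \<open>u \<cdot> \<theta>\<close> intact, and it is collected at the root with the label of
  \<open>u\<close> in \<open>lss C\<close>.\<close>

lemma nm_redex:
  assumes "u \<in> ss_neg C \<union> ss_pos_below C" and "(u \<cdot> \<theta>, v) \<in> R"
  obtains k where "k \<ge> 1" "(u \<cdot> \<theta>, k) \<in># nm R (C, \<theta>)"
proof -
  from assms(1) obtain k where k: "(u, k) \<in> lss C" "k \<ge> 1"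
    by (cases "u \<in> ss_neg C") (auto simp: lss_def)
  have "nm_arg R \<theta> u = u \<cdot> \<theta>"
    using nm_arg_irreducible rule_subterm_irreducible[OF assms(2)] by blast
  then have "(u \<cdot> \<theta>, k) \<in># rm R (nm_arg R \<theta> (fst (u, k))) (snd (u, k))"
    using rm_rule[OF assms(2)] by simp
  then have "(u \<cdot> \<theta>, k) \<in># nm R (C, \<theta>)"
    using k(1) unfolding nm_conv by (auto simp: set_mset_sum intro!: bexI[of _ "(u, k)"])
  then show thesis using that k(2) by blast
qed

text \<open>Label \<open>0\<close> at the top of a maximal positive side is what makes the left premise of a
  superposition smaller than the right one.\<close>

lemma max_eqn_lt_nm:
  assumes D: "max_eqn D \<theta>' t t'" and u: "u \<in> ss_neg C \<union> ss_pos_below C"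
    and eq: "u \<cdot> \<theta> = t \<cdot> \<theta>'" and "(t \<cdot> \<theta>', v) \<in> R"
  shows "multp (lt_labelled lt) (nm R (D, \<theta>')) (nm R (C, \<theta>))"
proof -
  obtain k where k: "k \<ge> 1" "(u \<cdot> \<theta>, k) \<in># nm R (C, \<theta>)"
    using nm_redex[OF u, of \<theta> v] assms(4) eq by auto
  show ?thesis
  proof (rule multp_dominated[OF k(2)])
    fix p assume "p \<in># nm R (D, \<theta>')"
    then show "lt_labelled lt p (u \<cdot> \<theta>, k)"
      using nm_max_eqn_bound[OF D, of "fst p" "snd p"] k(1) eq by (cases p) auto
  qed
qed

interpretation below: admissible_trs F lt "below lt s R" for s
  using admissible_below by unfold_locales

text \<open>Rules that are not below \<open>s\<close> affect the multisets of all closures with maximal term \<open>s\<close> in the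
  same way.\<close>

lemma nm_below:
  assumes C: "max_eqn C \<theta> t t'" and s: "s = t \<cdot> \<theta>" and irr: "irreducible (below lt s R) s"
  shows "nm R (C, \<theta>) + {#(s, 0)#}
    = nm (below lt s R) (C, \<theta>) + (rm R s 0 + {#(normal_form R s, 0)#})"
proof -
  let ?R0 = "below lt s R"
  note gr = max_eqn_ground[OF C]
  \<comment> \<open>Everything except the two summands of \<open>t\<close>; the instances involved
    here are all below \<open>s\<close>.\<close>
  define X where "X S = (\<Sum>p \<in> lss C - {(t, 0)}. rm S (nm_arg S \<theta> (fst p)) (snd p))" for S
  define Y where "Y S = (\<Sum>p \<in> lts C - {(t, 0)}. {#(normal_form S (fst p \<cdot> \<theta>), snd p)#})" for S
  have nm: "nm S (C, \<theta>) = rm S (nm_arg S \<theta> t) 0 + X S + ({#(normal_form S s, 0)#} + Y S)" for S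
    unfolding nm_conv X_def Y_def s
    by (simp add: sum.remove[OF finite_lss max_eqn_lss(1)[OF C]]
        sum.remove[OF finite_lts max_eqn_lts(1)[OF C]])
  have args: "nm_arg ?R0 \<theta> p = nm_arg R \<theta> p" if "ground_trm F (p \<cdot> \<theta>)" "lt (p \<cdot> \<theta>) s" for p
  proof (cases p)
    case (Fun f ts)
    have "normal_form ?R0 (q \<cdot> \<theta>) = normal_form R (q \<cdot> \<theta>)" if "q \<in> set ts" for q
    proof (rule normal_form_below)
      have q: "q \<cdot> \<theta> \<in> proper_subterms (p \<cdot> \<theta>)" 
        using that by (auto simp: Fun intro!: bexI[of _ q])
      show "ground_trm F (q \<cdot> \<theta>)"
        using ground_subterm[OF \<open>ground_trm F (p \<cdot> \<theta>)\<close>] q by (simp add: subterms_conv_proper)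
      show "lt (q \<cdot> \<theta>) s"
        using lt_proper_subterm[OF \<open>ground_trm F (p \<cdot> \<theta>)\<close> q] \<open>lt (p \<cdot> \<theta>) s\<close> lt_trans by blast
    qed
    then show ?thesis using Fun by simp
  qed simp
  have "X ?R0 = X R"
    unfolding X_def
  proof (rule sum.cong[OF refl])
    fix p assume p: "p \<in> lss C - {(t, 0)}"
    obtain q m where qm: "p = (q, m)" by force
    have q: "ground_trm F (q \<cdot> \<theta>)" "lt (q \<cdot> \<theta>) s"
      using ground_lss[OF gr(1)] max_eqn_lss(2)[OF C] p qm s by auto
    have "lt (nm_arg R \<theta> q) s" using nm_arg_bound(2)[OF q(1)] q(2) le_lt_trans by blast
    then show "rm ?R0 (nm_arg ?R0 \<theta> (fst p)) (snd p) = rm R (nm_arg R \<theta> (fst p)) (snd p)"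
      using args[OF q] rm_below[OF nm_arg_bound(1)[OF q(1)]] qm by simp
  qed
  moreover have "Y ?R0 = Y R"
    unfolding Y_def
  proof (rule sum.cong[OF refl])
    fix p assume p: "p \<in> lts C - {(t, 0)}"
    then show "{#(normal_form ?R0 (fst p \<cdot> \<theta>), snd p)#} = {#(normal_form R (fst p \<cdot> \<theta>), snd p)#}"
      using normal_form_below[of "fst p \<cdot> \<theta>" s] ground_lts[OF gr(1), of "fst p" "snd p"]
        max_eqn_lts(2)[OF C, of "fst p" "snd p"] s by simp
  qed
  \<comment> \<open>Proper subterms of \<open>s\<close> are irreducible under the truncated system
    and, being below \<open>s\<close>, also under \<open>R\<close>. So in both systems the summand
    of \<open>t\<close> starts from \<open>s\<close> unchanged.\<close>
  moreover have "nm_arg ?R0 \<theta> t = s" "nm_arg R \<theta> t = s"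
  proof -
    have irr0: "irreducible ?R0 p" if "p \<in> proper_subterms (t \<cdot> \<theta>)" for p
      using irreducible_subterm[OF irr] that s by (simp add: subterms_conv_proper)
    have "irreducible R p" if p: "p \<in> proper_subterms (t \<cdot> \<theta>)" for p
      using irr0[OF p] irreducible_below[of p s] lt_proper_subterm[OF gr(2) p]
        ground_subterm[OF gr(2), of p] p s by (simp add: subterms_conv_proper)
    with irr0 show "nm_arg ?R0 \<theta> t = s" "nm_arg R \<theta> t = s"
      unfolding s using nm_arg_irreducible below.nm_arg_irreducible[where s = "t \<cdot> \<theta>"] by blast+
  qed
  ultimately show ?thesis
    unfolding nm by (simp add: below.rm_irreducible[OF irr] below.normal_form_irreducible[OF irr])
qed

text \<open>By \<open>nm_below\<close> both multisets change by the same correction, which cancels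
  in the multiset ordering; the later components of the closure ordering do not mention the rewrite
  system.\<close>

lemma lt_closure_below:
  assumes C: "max_eqn C \<theta> t t'" "t \<cdot> \<theta> = s" and D: "max_eqn D \<theta>' u u'" "u \<cdot> \<theta>' = s"
    and irr: "irreducible (below lt s R) s"
    and lt: "lt_closure lt lt_clo R (C, \<theta>) (D, \<theta>')"
  shows "lt_closure lt lt_clo (below lt s R) (C, \<theta>) (D, \<theta>')"
proof -
  note eqC = nm_below[OF C(1) C(2)[symmetric] irr]
  note eqD = nm_below[OF D(1) D(2)[symmetric] irr]
  note cancel = multp_cancel[OF transp_lt_labelled
      irreflp_on_subset[OF wfp_imp_irreflp[OF wfp_lt_labelled] subset_UNIV]]
  have "multp (lt_labelled lt) (nm R (C, \<theta>)) (nm R (D, \<theta>'))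
      \<longleftrightarrow> multp (lt_labelled lt) (nm R (C, \<theta>) + {#(s, 0)#}) (nm R (D, \<theta>') + {#(s, 0)#})"
    by (rule cancel[symmetric])
  also have "\<dots> \<longleftrightarrow> multp (lt_labelled lt) (nm (below lt s R) (C, \<theta>)) (nm (below lt s R) (D, \<theta>'))"
    unfolding eqC eqD by (rule cancel)
  finally have 1: "multp (lt_labelled lt) (nm R (C, \<theta>)) (nm R (D, \<theta>'))
      \<longleftrightarrow> multp (lt_labelled lt) (nm (below lt s R) (C, \<theta>)) (nm (below lt s R) (D, \<theta>'))" .
  have "nm R (C, \<theta>) = nm R (D, \<theta>') \<longrightarrow> nm (below lt s R) (C, \<theta>) = nm (below lt s R) (D, \<theta>')"
    using eqC eqD by (metis add_right_cancel)
  with lt 1 show ?thesis unfolding lt_closure_def by blast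
qed

end

section \<open>Truth in the rewrite interpretation\<close>

lemma true_lit_simps:
  assumes "symp E"
  shows "true_lit E (Pos (Upair s t)) \<longleftrightarrow> E s t" "true_lit E (Neg (Upair s t)) \<longleftrightarrow> \<not> E s t"
  using sympD[OF assms] by auto

lemma symp_equivclp: "symp (equivclp r)"
  by (rule sympI) (rule equivclp_sym)

lemmas true_lit_equivclp = true_lit_simps[OF symp_equivclp]

lemma rsteps_equivclp: "(rstep R)\<^sup>*\<^sup>* s t \<Longrightarrow> equivclp (rstep R) s t"
  by (induction rule: rtranclp_induct) (auto intro: equivclp_trans[OF _ r_into_equivclp])

lemma equivclp_mono: "equivclp (rstep R) s t \<Longrightarrow> R \<subseteq> R' \<Longrightarrow> equivclp (rstep R') s t"
  by (induction rule: equivclp_induct)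
    (auto intro: equivclp_trans[OF _ r_into_equivclp]
      equivclp_trans[OF _ equivclp_sym[OF r_into_equivclp]] rstep_mono)

lemma true_lit_map_cong:
  assumes "\<And>t. t \<in> set_literal L \<Longrightarrow> equivclp r (f t) (g t)"
  shows "true_lit (equivclp r) (map_literal f L) \<longleftrightarrow> true_lit (equivclp r) (map_literal g L)"
proof -
  have "equivclp r (f s) (f t) \<longleftrightarrow> equivclp r (g s) (g t)"
    if "equivclp r (f s) (g s)" "equivclp r (f t) (g t)" for s t
    using that by (meson equivclp_sym equivclp_trans)
  then show ?thesis using assms
    by (cases L rule: literal_cases) (simp_all add: true_lit_equivclp del: true_lit.simps)
qed

lemma true_cls_mono: "true_cls E C \<Longrightarrow> C \<subseteq># D \<Longrightarrow> true_cls E D"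
  by (auto simp: true_cls_def dest: mset_subset_eqD)

lemma entails_inst: "inst c = inst d \<Longrightarrow> entails R c \<longleftrightarrow> entails R d"
  by (simp add: entails_def)

lemma entails_rsteps:
  assumes "\<And>x. x \<in> vars_cls C \<Longrightarrow> (rstep R)\<^sup>*\<^sup>* (\<theta> x) (\<theta>' x)"
  shows "entails R (C, \<theta>) \<longleftrightarrow> entails R (C, \<theta>')"
proof -
  have "true_lit (equivclp (rstep R)) (L \<cdot>l \<theta>) \<longleftrightarrow> true_lit (equivclp (rstep R)) (L \<cdot>l \<theta>')"
    if "L \<in># C" for L
    unfolding subst_lit_def
    by (intro true_lit_map_cong rsteps_equivclp rsteps_subst assms) (auto intro: vars_clsI[OF that])
  then show ?thesis by (simp add: entails_def true_cls_def subst_cls_def)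
qed

text \<open>Each replaced occurrence is rewritten by a rule of \<open>R\<close>, so all sides of
  literals keep their congruence class.\<close>

lemma true_replace_cls:
  assumes "(u \<cdot> \<theta>, u' \<cdot> \<theta>) \<in> R"
  shows "true_cls (equivclp (rstep R)) (replace_cls u u' C \<cdot>c \<theta>)
    \<longleftrightarrow> true_cls (equivclp (rstep R)) (C \<cdot>c \<theta>)"
proof -
  have "true_lit (equivclp (rstep R)) (map_literal (replace_trm u u') L \<cdot>l \<theta>)
      \<longleftrightarrow> true_lit (equivclp (rstep R)) (L \<cdot>l \<theta>)" for L
    unfolding subst_lit_def literal.map_comp comp_def
    by (intro true_lit_map_cong equivclp_sym[OF rsteps_equivclp] rsteps_replace assms)
  then show ?thesis by (simp add: true_cls_def subst_cls_def replace_cls_def)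
qed

section \<open>Lifting of ordering conditions\<close>

lemma mset_lit_subst: "mset_lit (L \<cdot>l \<sigma>) = image_mset (\<lambda>t. t \<cdot> \<sigma>) (mset_lit L)"
  by (cases L rule: literal_cases) simp_all

context ground_total_ordering
begin

lemma lt_lit_subst:
  assumes "lt_lit lt L K" and "\<And>x. wf_trm F (\<sigma> x)"
  shows "lt_lit lt (L \<cdot>l \<sigma>) (K \<cdot>l \<sigma>)"
proof -
  have "lt \<le> (\<lambda>s t. lt (s \<cdot> \<sigma>) (t \<cdot> \<sigma>))" using lt_subst assms(2) by auto
  from mono_multp[OF this] have "multp (\<lambda>s t. lt (s \<cdot> \<sigma>) (t \<cdot> \<sigma>)) (mset_lit L) (mset_lit K)"
    using assms(1) unfolding lt_lit_def by auto
  then show ?thesis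
    unfolding lt_lit_def mset_lit_subst by (rule multp_image_mset_image_msetI[OF _ transp_lt])
qed

lemma lt_cls_subst:
  assumes "lt_cls lt C D" and "\<And>x. wf_trm F (\<sigma> x)"
  shows "lt_cls lt (C \<cdot>c \<sigma>) (D \<cdot>c \<sigma>)"
proof -
  have "lt_lit lt \<le> (\<lambda>L K. lt_lit lt (L \<cdot>l \<sigma>) (K \<cdot>l \<sigma>))" using lt_lit_subst assms(2) by auto
  from mono_multp[OF this] have "multp (\<lambda>L K. lt_lit lt (L \<cdot>l \<sigma>) (K \<cdot>l \<sigma>)) C D"
    using assms(1) unfolding lt_cls_def by auto
  then show ?thesis
    unfolding lt_cls_def subst_cls_def by (rule multp_image_mset_image_msetI[OF _ transp_lt_lit])
qed

text \<open>Contrapositive by stability: a literal that is larger under \<open>\<sigma>\<close>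
  would remain larger in the ground instance. Stability is available for substitutions into
  well-formed terms.\<close>

lemma maximal_lit_lift:
  assumes "maximal_lit lt (L \<cdot>l \<sigma> \<cdot>l \<theta>) (C \<cdot>c \<sigma> \<cdot>c \<theta>)" and "L \<in># C" and "\<And>x. wf_trm F (\<theta> x)"
  shows "maximal_lit lt (L \<cdot>l \<sigma>) (C \<cdot>c \<sigma>)"
proof -
  from assms(2) obtain C' where C: "C = add_mset L C'" by (rule mset_add)
  have "\<not> lt_lit lt (L \<cdot>l \<sigma>) K" if "K \<in># C' \<cdot>c \<sigma>" for K
    using assms(1) lt_lit_subst[where \<sigma> = \<theta>, OF _ assms(3)] subst_cls_memberI[OF that]
    unfolding C by (auto simp: maximal_lit_def)
  then show ?thesis by (simp add: maximal_lit_def C)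
qed

lemma strictly_maximal_lit_lift:
  assumes "strictly_maximal_lit lt (L \<cdot>l \<sigma> \<cdot>l \<theta>) (C \<cdot>c \<sigma> \<cdot>c \<theta>)" and "L \<in># C"
    and "\<And>x. wf_trm F (\<theta> x)"
  shows "strictly_maximal_lit lt (L \<cdot>l \<sigma>) (C \<cdot>c \<sigma>)"
proof -
  from assms(2) obtain C' where C: "C = add_mset L C'" by (rule mset_add)
  have "\<not> (lt_lit lt (L \<cdot>l \<sigma>) K \<or> L \<cdot>l \<sigma> = K)" if "K \<in># C' \<cdot>c \<sigma>" for K
    using assms(1) lt_lit_subst[where \<sigma> = \<theta>, OF _ assms(3)] subst_cls_memberI[OF that]
    unfolding C by (auto simp: strictly_maximal_lit_def)
  then show ?thesis by (simp add: strictly_maximal_lit_def C)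
qed

lemma not_le_lift:
  assumes "lt (s \<cdot> \<sigma> \<cdot> \<theta>) (t \<cdot> \<sigma> \<cdot> \<theta>)" and "\<And>x. wf_trm F (\<theta> x)"
  shows "\<not> lt\<^sup>=\<^sup>= (t \<cdot> \<sigma>) (s \<cdot> \<sigma>)"
  using assms lt_subst[of "t \<cdot> \<sigma>" "s \<cdot> \<sigma>" \<theta>] lt_asym lt_irrefl by auto

lemma not_le_cls_lift:
  assumes "lt_cls lt (C \<cdot>c \<sigma> \<cdot>c \<theta>) (D \<cdot>c \<sigma> \<cdot>c \<theta>)" and "\<And>x. wf_trm F (\<theta> x)"
  shows "\<not> (lt_cls lt)\<^sup>=\<^sup>= (D \<cdot>c \<sigma>) (C \<cdot>c \<sigma>)"
proof -
  have "\<not> lt_cls lt (D \<cdot>c \<sigma> \<cdot>c \<theta>) (C \<cdot>c \<sigma> \<cdot>c \<theta>)" "C \<cdot>c \<sigma> \<cdot>c \<theta> \<noteq> D \<cdot>c \<sigma> \<cdot>c \<theta>"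
    using assms(1) wfp_imp_asymp[OF wfp_lt_cls] by (auto dest: asympD)
  then show ?thesis using lt_cls_subst[of "D \<cdot>c \<sigma>" "C \<cdot>c \<sigma>" \<theta>] assms(2) by auto
qed

end

section \<open>The candidate rewrite system\<close>

locale horn_clauses = ground_total_ordering F lt
  for F :: "'f signature" and lt :: "('f, 'v) trm rel2" +
  fixes lt_clo :: "('f, 'v) closure rel2" and N :: "('f, 'v) cls set"
  assumes tiebreak: "tiebreak_ordering F lt_clo"
    and horn_N: "\<And>C. C \<in> N \<Longrightarrow> horn C"
begin

text \<open>In a Horn clause all literals besides the maximal equation are negative, so demanding
  falsity of the negative literals covers the whole remainder.\<close>

definition candidate ::
  "('f, 'v) trs \<Rightarrow> ('f, 'v) trm \<Rightarrow> ('f, 'v) cls \<Rightarrow> ('f, 'v) subst \<Rightarrow>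
   ('f, 'v) trm \<Rightarrow> ('f, 'v) trm \<Rightarrow> bool" where
  "candidate R s C \<theta> t t' \<longleftrightarrow> C \<in> N \<and> max_eqn C \<theta> t t' \<and> t \<cdot> \<theta> = s
     \<and> (\<forall>e. Neg e \<in># C \<longrightarrow> \<not> true_lit (equivclp (rstep R)) (Neg e \<cdot>l \<theta>))"

text \<open>Minimality is measured with the system \<open>R\<close> built so far, as the final
  system is not yet available during the recursion.\<close>

definition produced :: "('f, 'v) trs \<Rightarrow> ('f, 'v) trm \<Rightarrow> ('f, 'v) trm \<Rightarrow> bool" where
  "produced R s v \<longleftrightarrow> (\<exists>C \<theta> t t'. candidate R s C \<theta> t t' \<and> v = t' \<cdot> \<theta>
     \<and> (\<forall>D \<theta>' u u'. candidate R s D \<theta>' u u' \<longrightarrow> \<not> lt_closure lt lt_clo R (D, \<theta>') (C, \<theta>)))"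

text \<open>The choice operator makes the right-hand side unique without an appeal to totality of
  the closure ordering.\<close>

definition rules_for :: "('f, 'v) trs \<Rightarrow> ('f, 'v) trm \<Rightarrow> ('f, 'v) trs" where
  "rules_for R s =
     (if irreducible R s \<and> (\<exists>v. produced R s v) then {(s, SOME v. produced R s v)} else {})"

definition rules :: "('f, 'v) trm \<Rightarrow> ('f, 'v) trs" where
  "rules = wfrec {(s, t). lt s t} (\<lambda>E s. rules_for (\<Union>s' \<in> {s'. lt s' s}. E s') s)"

definition RN :: "('f, 'v) trs" where
  "RN = (\<Union>s. rules s)"

lemma rules_unfold: "rules s = rules_for (\<Union>s' \<in> {s'. lt s' s}. rules s') s"
proof -
  have "rules s = rules_for (\<Union>s' \<in> {s'. lt s' s}. cut rules {(s, t). lt s t} s s') s"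
    unfolding rules_def using wfp_lt by (subst wfrec) (auto simp: wfp_def)
  also have "(\<Union>s' \<in> {s'. lt s' s}. cut rules {(s, t). lt s t} s s') = (\<Union>s' \<in> {s'. lt s' s}. rules s')"
    by (auto simp: cut_def)
  finally show ?thesis .
qed

lemma rules_lhs: "(u, v) \<in> rules s \<Longrightarrow> u = s"
  by (subst (asm) rules_unfold) (auto simp: rules_for_def split: if_splits)

lemma below_RN: "below lt s RN = (\<Union>s' \<in> {s'. lt s' s}. rules s')"
  by (auto simp: below_def RN_def dest: rules_lhs)

text \<open>The fixpoint equation that replaces the recursion in all later arguments.\<close>

lemma RN_rules: "(s, v) \<in> RN \<longleftrightarrow> (s, v) \<in> rules_for (below lt s RN) s"
  unfolding below_RN rules_unfold[symmetric] by (auto simp: RN_def dest: rules_lhs)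

lemma RN_produced:
  assumes "(s, v) \<in> RN"
  shows "irreducible (below lt s RN) s" "produced (below lt s RN) s v"
  using assms unfolding RN_rules rules_for_def by (auto split: if_splits intro: someI)

lemma RN_unique: "(s, v) \<in> RN \<Longrightarrow> (s, v') \<in> RN \<Longrightarrow> v = v'"
  unfolding RN_rules rules_for_def by (auto split: if_splits)

text \<open>If \<open>s\<close> were irreducible, a minimal candidate would exist by
  well-foundedness and a rule for \<open>s\<close> would have been added.\<close>

lemma candidate_reducible:
  assumes cand: "candidate (below lt s RN) s C \<theta> t t'"
  shows "\<not> irreducible RN s"
proof
  assume irr: "irreducible RN s"
  let ?R = "below lt s RN"
  let ?Q = "{(D, \<theta>'). \<exists>u u'. candidate ?R s D \<theta>' u u'}"
  have "(C, \<theta>) \<in> ?Q" using cand by auto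
  from wfp_lt_closure[OF tiebreak, of ?R, unfolded wfp_eq_minimal, rule_format, OF this]
  obtain D \<theta>' u u' where "candidate ?R s D \<theta>' u u'"
    "\<And>c. lt_closure lt lt_clo ?R c (D, \<theta>') \<Longrightarrow> c \<notin> ?Q" by auto
  then have "produced ?R s (u' \<cdot> \<theta>')"
    unfolding produced_def by blast
  moreover have "irreducible ?R s"
    using irr by (rule irreducible_mono) (auto simp: below_def)
  ultimately have "\<exists>v. (s, v) \<in> RN" unfolding RN_rules rules_for_def by auto
  then show False using irr subterms_refl unfolding irreducible_iff by blast
qed

text \<open>A rule reducing the left-hand side \<open>u\<close> has its own left-hand side at most
  \<open>u\<close>. Equality is excluded by \<open>RN_unique\<close>, a smaller one by the
  irreducibility check made before the rule is added.\<close>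

lemma admissible_RN: "admissible F lt RN"
  unfolding admissible_def
proof clarify
  fix u v assume uv: "(u, v) \<in> RN"
  obtain C \<theta> t t' where "candidate (below lt u RN) u C \<theta> t t'" "v = t' \<cdot> \<theta>"
    using RN_produced(2)[OF uv] unfolding produced_def by blast
  then have max: "max_eqn C \<theta> t t'" "u = t \<cdot> \<theta>" "v = t' \<cdot> \<theta>" by (auto simp: candidate_def)
  note gr = max_eqn_ground[OF max(1)]
  have "irreducible (RN - {(u, v)}) u"
    unfolding irreducible_iff
  proof clarify
    fix l r assume lr: "(l, r) \<in> RN" "l \<in> subterms u" "\<not> (l = u \<and> r = v)"
    then have "l \<noteq> u" using RN_unique uv by blast
    then have "lt l u" using le_subterm[OF gr(2)] lr(2) max(2) by blast
    then have "(l, r) \<in> below lt u RN" using lr(1) by (simp add: below_def)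
    then show False using RN_produced(1)[OF uv] lr(2) by (auto simp: irreducible_iff)
  qed
  then show "ground_trm F u \<and> ground_trm F v \<and> lt v u \<and> irreducible (RN - {(u, v)}) u"
    using gr max by (simp add: max_eqn_def)
qed

sublocale RN: admissible_trs F lt RN
  by unfold_locales (rule admissible_RN)

lemma false_lit:
  "\<not> entails R (C, \<theta>) \<Longrightarrow> L \<in># C \<Longrightarrow> \<not> true_lit (equivclp (rstep R)) (L \<cdot>l \<theta>)"
  by (auto simp: entails_def true_cls_def subst_cls_def)

text \<open>Every term of a negative literal is below \<open>t \<cdot> \<theta>\<close>, where
  \<open>RN\<close> and its truncation generate the same equality.\<close>

lemma counterexample_candidate:
  assumes C: "C \<in> N" "max_eqn C \<theta> t t'" and false: "\<not> entails RN (C, \<theta>)"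
  shows "candidate (below lt (t \<cdot> \<theta>) RN) (t \<cdot> \<theta>) C \<theta> t t'"
  unfolding candidate_def
proof (intro conjI allI impI C refl)
  fix e assume e: "Neg e \<in># C"
  obtain q r where qr: "e = Upair q r" by (cases e)
  have "q \<in> ts_neg C" "r \<in> ts_neg C" using e qr by (force simp: ts_neg_def)+
  then have "lt (q \<cdot> \<theta>) (t \<cdot> \<theta>)" "lt (r \<cdot> \<theta>) (t \<cdot> \<theta>)" using max_eqn_ts_neg[OF C(2)] by auto
  moreover have "ground_trm F (q \<cdot> \<theta>)" "ground_trm F (r \<cdot> \<theta>)"
    using ground_lit[OF max_eqn_ground(1)[OF C(2)]] e qr by auto
  moreover have "equivclp (rstep RN) (q \<cdot> \<theta>) (r \<cdot> \<theta>)"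
    using false_lit[OF false e] qr by (simp add: true_lit_equivclp del: true_lit.simps)
  ultimately have "equivclp (rstep (below lt (t \<cdot> \<theta>) RN)) (q \<cdot> \<theta>) (r \<cdot> \<theta>)"
    using RN.equivclp_below by blast
  then show "\<not> true_lit (equivclp (rstep (below lt (t \<cdot> \<theta>) RN))) (Neg e \<cdot>l \<theta>)"
    using qr by (simp add: true_lit_equivclp del: true_lit.simps)
qed

text \<open>The equations of the negative literals hold in the truncated system and persist when
  rules are added. So the rest of a producing clause adds nothing true to a superposition
  conclusion.\<close>

lemma candidate_rest_false:
  assumes "candidate (below lt s RN) s (add_mset (Pos (Upair t t')) D) \<theta> t t'"
  shows "\<not> entails RN (D, \<theta>)"
proof
  assume "entails RN (D, \<theta>)"
  then obtain L where L: "L \<in># D" "true_lit (equivclp (rstep RN)) (L \<cdot>l \<theta>)"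
    by (auto simp: entails_def true_cls_def subst_cls_def)
  have "horn (add_mset (Pos (Upair t t')) D)"
    using assms horn_N by (auto simp: candidate_def)
  then obtain q r where qr: "L = Neg (Upair q r)" using L(1) by (rule horn_add_Pos)
  have "\<not> true_lit (equivclp (rstep (below lt s RN))) (Neg (Upair q r) \<cdot>l \<theta>)"
    using assms L(1) qr unfolding candidate_def by auto
  then have "equivclp (rstep RN) (q \<cdot> \<theta>) (r \<cdot> \<theta>)"
    using equivclp_mono[OF _ RN.below_subset]
    by (simp add: true_lit_equivclp del: true_lit.simps)
  then show False using L(2) qr by (simp add: true_lit_equivclp del: true_lit.simps)
qed

end

section \<open>Minimal counterexamples of a saturated set\<close>

lemma true_cls_union: "true_cls E (C + D) \<longleftrightarrow> true_cls E C \<or> true_cls E D"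
  by (auto simp: true_cls_def)

text \<open>The rule generated by the inductive definition represents \<open>lt\<close> by a set of pairs.\<close>

lemma par_sup_inference:
  assumes "D = add_mset (Pos (Upair t t')) D'" and "vars_cls D \<inter> vars_cls C = {}"
    and "\<not> is_Var u" and "is_mgu \<sigma> t u"
    and "u \<in> ss_neg C \<union> ss_pos_below C \<Longrightarrow> \<not> (lt_cls lt)\<^sup>=\<^sup>= (C \<cdot>c \<sigma>) (D \<cdot>c \<sigma>)"
    and "strictly_maximal_lit lt (Pos (Upair t t') \<cdot>l \<sigma>) (D \<cdot>c \<sigma>)"
    and "overlap lt u C \<sigma>" and "\<not> lt\<^sup>=\<^sup>= (t \<cdot> \<sigma>) (t' \<cdot> \<sigma>)"
  shows "ParSup D t t' C ((D' + replace_cls u t' C) \<cdot>c \<sigma>) \<in> inferences lt"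
proof -
  have "(\<lambda>x y. (x, y) \<in> {(x, y). lt x y}) = lt" by simp
  then show ?thesis
    using inferences.par_sup[of D t t' D' C u \<sigma> "{(x, y). lt x y}", OF assms(1-4)] assms(5-8)
    by (simp only:) simp
qed

context horn_clauses
begin

abbreviation closures :: "('f, 'v) closure set" where
  "closures \<equiv> ground_closures F N"

definition min_counterexample :: "('f, 'v) cls \<Rightarrow> ('f, 'v) subst \<Rightarrow> bool" where
  "min_counterexample C \<theta> \<longleftrightarrow> C \<in> N \<and> ground_closure F (C, \<theta>) \<and> \<not> entails RN (C, \<theta>)
     \<and> (\<forall>d \<in> closures. \<not> entails RN d \<longrightarrow> \<not> lt_closure lt lt_clo RN d (C, \<theta>))"

lemma min_counterexample_exists:
  assumes "c \<in> closures" "\<not> entails RN c"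
  obtains C \<theta> where "min_counterexample C \<theta>"
proof -
  let ?Q = "{c \<in> closures. \<not> entails RN c}"
  have "c \<in> ?Q" using assms by simp
  from wfp_lt_closure[OF tiebreak, of RN, unfolded wfp_eq_minimal, rule_format, OF this]
  obtain d where "d \<in> ?Q" "\<And>e. lt_closure lt lt_clo RN e d \<Longrightarrow> e \<notin> ?Q" by blast
  moreover obtain C \<theta> where "d = (C, \<theta>)" by force
  ultimately have "min_counterexample C \<theta>"
    by (auto simp: min_counterexample_def ground_closures_def)
  then show thesis by (rule that)
qed

text \<open>Lets the substitution be changed off the variables of \<open>C\<close>, to make it
  well-formed or to share it with a renamed left premise.\<close>

lemma min_counterexample_cong:
  assumes "min_counterexample C \<theta>" and "\<And>x. x \<in> vars_cls C \<Longrightarrow> \<theta> x = \<theta>' x"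
  shows "min_counterexample C \<theta>'"
proof -
  have inst: "inst (C, \<theta>') = inst (C, \<theta>)"
    using subst_cls_cong[OF assms(2)] by simp
  have "same_closure (C, \<theta>') (C, \<theta>)" "nm RN (C, \<theta>') = nm RN (C, \<theta>)"
    using assms(2) by (auto intro!: same_closure_cong nm_cong)
  moreover have "same_closure d d" for d :: "('f, 'v) closure"
    by (simp add: same_closure_def variant_refl)
  ultimately have "lt_closure lt lt_clo RN d (C, \<theta>)" if "lt_closure lt lt_clo RN d (C, \<theta>')" for d
    using lt_closure_cong[OF tiebreak _ refl _ _ that] by blast
  then show ?thesis
    using assms(1) entails_inst[OF inst] inst unfolding min_counterexample_def
    by (auto simp: ground_closure_def)
qed

text \<open>Otherwise normalizing the substitution gives another false ground closure of the same
  clause, smaller by \<open>nm_normalize\<close>.\<close>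

lemma min_counterexample_irreducible:
  assumes C: "min_counterexample C \<theta>" and x: "x \<in> vars_cls C"
  shows "irreducible RN (\<theta> x)"
proof (rule ccontr)
  assume red: "\<not> irreducible RN (\<theta> x)"
  let ?\<theta> = "\<lambda>x. normal_form RN (\<theta> x)"
  have gr: "ground_cls F (C \<cdot>c \<theta>)" and "C \<in> N"
    using C by (auto simp: min_counterexample_def ground_closure_def)
  have g: "ground_trm F (\<theta> y)" if "y \<in> vars_cls C" for y
    using ground_vars_cls[OF gr that] .
  have rsteps: "(rstep RN)\<^sup>*\<^sup>* (t \<cdot> \<theta>) (t \<cdot> ?\<theta>)" if "t \<in> trms_cls C" for t
    using that g RN.normal_form by (intro rsteps_subst) (auto simp: vars_cls_def)
  have "ground_trm F (t \<cdot> ?\<theta>)" if "t \<in> trms_cls C" for t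
    using RN.rsteps_ground[OF rsteps[OF that]] gr that by (simp add: ground_cls_def trms_subst_cls)
  then have "(C, ?\<theta>) \<in> closures"
    using \<open>C \<in> N\<close> by (auto simp: ground_closures_def ground_closure_def ground_cls_def trms_subst_cls)
  moreover have "\<not> entails RN (C, ?\<theta>)"
    using entails_rsteps[of C RN \<theta> ?\<theta>] RN.normal_form g C by (auto simp: min_counterexample_def)
  moreover have "lt_closure lt lt_clo RN (C, ?\<theta>) (C, \<theta>)"
    using RN.nm_normalize[OF gr x red] by (simp add: lt_closure_def)
  ultimately show False using C by (auto simp: min_counterexample_def)
qed

text \<open>Redundancy is specialized to the system \<open>RN\<close>. A smaller false closure
  contradicts minimality, which leaves an entailed conclusion and the two cases specific to
  superposition.\<close>

lemma redundant_inference: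
  assumes sat: "saturated F lt lt_clo N" and \<iota>: "\<iota> \<in> inferences_from lt N"
    and gr: "map_inference id (\<lambda>C. (C, \<theta>)) \<iota> \<in> ground_inferences F lt"
    and C: "min_counterexample (main_prem \<iota>) \<theta>"
  shows "entails RN (concl \<iota>, \<theta>)
    \<or> (\<exists>D t t' C E. \<iota> = ParSup D t t' C E \<and> ((t \<cdot> \<theta>, t' \<cdot> \<theta>) \<notin> RN
        \<or> lt_closure lt lt_clo RN (C, \<theta>) (D, \<theta>)))"
proof -
  let ?\<iota> = "map_inference id (\<lambda>C. (C, \<theta>)) \<iota>"
  have "\<iota> \<in> lifted_Red_I F lt lt_clo N" using sat \<iota> by (auto simp: saturated_def)
  then have "?\<iota> \<in> Red_I F lt lt_clo closures"
    using gr by (auto simp: lifted_Red_I_def ground_instances_def)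
  then consider "entails RN (concl ?\<iota>)"
    | c where "c \<in> closures" "lt_closure lt lt_clo RN c (main_prem ?\<iota>)" "\<not> entails RN c"
    | D \<theta>' t t' c e where "?\<iota> = ParSup (D, \<theta>') t t' c e" "(t \<cdot> \<theta>', t' \<cdot> \<theta>') \<notin> RN"
    | d t t' c e where "?\<iota> = ParSup d t t' c e" "lt_closure lt lt_clo RN c d"
    using admissible_RN unfolding Red_I_def by blast
  then show ?thesis
  proof cases
    case 1
    then show ?thesis by (cases \<iota>) auto
  next
    case (2 c)
    then show ?thesis using C by (cases \<iota>) (auto simp: min_counterexample_def)
  next
    case 3
    then show ?thesis by (cases \<iota>) auto
  next
    case 4
    then show ?thesis by (cases \<iota>) auto
  qed
qed

text \<open>A ground closure constrains its substitution only on the clause variables, while lifting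
  order conditions requires well-formed values everywhere; all other variables are mapped to
  themselves.\<close>

lemma min_counterexample_wf:
  assumes "min_counterexample C \<theta>"
  obtains \<theta>' where "min_counterexample C \<theta>'" "\<And>x. x \<in> vars_cls C \<Longrightarrow> \<theta>' x = \<theta> x"
    "\<And>x. wf_trm F (\<theta>' x)"
proof -
  let ?\<theta> = "\<lambda>x. if x \<in> vars_cls C then \<theta> x else Var x"
  have "ground_cls F (C \<cdot>c \<theta>)" using assms by (simp add: min_counterexample_def ground_closure_def)
  then have "wf_trm F (?\<theta> x)" for x
    using ground_vars_cls[of C \<theta> x] by (auto simp: ground_trm_def)
  moreover have "min_counterexample C ?\<theta>"
    by (rule min_counterexample_cong[OF assms]) simp
  ultimately show thesis using that[of ?\<theta>] by simp
qed

text \<open>Otherwise the ground Equality Resolution inference lifts to \<open>C\<close>. Its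
  conclusion is entailed by redundancy and its ground instance is contained in that of
  \<open>C\<close>, which would make \<open>C\<close> true.\<close>

lemma no_equality_resolution:
  assumes sat: "saturated F lt lt_clo N" and C: "min_counterexample C \<theta>"
    and s: "Neg (Upair s s') \<in># C" "maximal_lit lt (Neg (Upair s s') \<cdot>l \<theta>) (C \<cdot>c \<theta>)"
  shows "s \<cdot> \<theta> \<noteq> s' \<cdot> \<theta>"
proof
  assume eq: "s \<cdot> \<theta> = s' \<cdot> \<theta>"
  obtain \<theta>' where C': "min_counterexample C \<theta>'" and agree: "\<And>x. x \<in> vars_cls C \<Longrightarrow> \<theta>' x = \<theta> x"
    and wf: "\<And>x. wf_trm F (\<theta>' x)" 
    using min_counterexample_wf[OF C] by metis
  have C\<theta>': "C \<cdot>c \<theta>' = C \<cdot>c \<theta>" using subst_cls_cong agree by blast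
  have s\<theta>': "s \<cdot> \<theta>' = s \<cdot> \<theta>" "s' \<cdot> \<theta>' = s' \<cdot> \<theta>"
    using agree vars_clsI[OF s(1)] by (auto intro!: subst_trm_cong)
  obtain \<sigma> where \<sigma>: "is_mgu \<sigma> s s'" using is_mgu_exists[OF eq] .
  have "s \<cdot> \<theta>' = s' \<cdot> \<theta>'" using eq s\<theta>' by simp
  note absorb = is_mgu_absorb[OF \<sigma> this]
  obtain C0 where C0: "C = add_mset (Neg (Upair s s')) C0" using s(1) by (rule mset_add)
  let ?\<iota> = "EqRes C (C0 \<cdot>c \<sigma>)"
  have "maximal_lit lt (Neg (Upair s s') \<cdot>l \<sigma>) (C \<cdot>c \<sigma>)"
  proof (rule maximal_lit_lift[OF _ s(1) wf])
    show "maximal_lit lt (Neg (Upair s s') \<cdot>l \<sigma> \<cdot>l \<theta>') (C \<cdot>c \<sigma> \<cdot>c \<theta>')"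
      using s(2) unfolding subst_lit_comp subst_cls_comp absorb C\<theta>' by (simp add: s\<theta>')
  qed
  then have "?\<iota> \<in> inferences_from lt N"
    using inferences.eq_res[OF C0 \<sigma>] C' variant_refl
    by (auto simp: inferences_from_def min_counterexample_def)
  moreover have "map_inference id (\<lambda>C. (C, \<theta>')) ?\<iota> \<in> ground_inferences F lt"
    using ground_inferences.eq_res[OF _ C0 _ \<sigma>, of F \<theta>' lt] C' s(2) eq
    by (simp add: min_counterexample_def s\<theta>' C\<theta>' del: subst_cls_add_mset)
  ultimately have "entails RN (C0 \<cdot>c \<sigma>, \<theta>')"
    using redundant_inference[OF sat, of ?\<iota> \<theta>'] C' by auto
  then have "true_cls (equivclp (rstep RN)) (C0 \<cdot>c \<theta>')"
    by (simp add: entails_def subst_cls_comp absorb)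
  then have "entails RN (C, \<theta>')"
    unfolding entails_def by (rule true_cls_mono) (simp add: C0)
  then show False using C' by (simp add: min_counterexample_def)
qed

end

section \<open>Superposition into a minimal counterexample\<close>

locale horn_clauses_inf = horn_clauses F lt lt_clo N
  for F :: "'f signature" and lt :: "('f, 'v :: infinite) trm rel2" and lt_clo and N
begin

text \<open>If \<open>u\<close> occurs with a label of at least \<open>1\<close>, the left premise
  is smaller by its normalization multiset. Otherwise \<open>u\<close> is the larger side of the
  maximal equation of \<open>C\<close>, so \<open>C\<close> is a candidate for the same rule;
  \<open>lt_closure_below\<close> carries the comparison to the truncated system, where
  \<open>D\<close> is minimal.\<close>

lemma left_premise_not_larger:
  assumes C: "C \<in> N" "ground_cls F (C \<cdot>c \<theta>)" "\<not> entails RN (C, \<theta>)"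
    and D: "candidate (below lt (t \<cdot> \<theta>') RN) (t \<cdot> \<theta>') D \<theta>' t t'"
      "\<And>E \<tau> w w'. candidate (below lt (t \<cdot> \<theta>') RN) (t \<cdot> \<theta>') E \<tau> w w' \<Longrightarrow>
        \<not> lt_closure lt lt_clo (below lt (t \<cdot> \<theta>') RN) (E, \<tau>) (D, \<theta>')"
    and rule: "(t \<cdot> \<theta>', t' \<cdot> \<theta>') \<in> RN" and u: "u \<cdot> \<theta> = t \<cdot> \<theta>'"
    and overlap: "ground_overlap lt u C \<theta>"
  shows "\<not> lt_closure lt lt_clo RN (C, \<theta>) (D, \<theta>')"
proof
  assume lt: "lt_closure lt lt_clo RN (C, \<theta>) (D, \<theta>')"
  have maxD: "max_eqn D \<theta>' t t'" using D(1) by (simp add: candidate_def)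
  show False
  proof (cases "u \<in> ss_neg C \<union> ss_pos_below C")
    case True
    have "lt_closure lt lt_clo RN (D, \<theta>') (C, \<theta>)"
      using RN.max_eqn_lt_nm[OF maxD True u rule] by (simp add: lt_closure_def)
    then show False using lt wfp_imp_asymp[OF wfp_lt_closure[OF tiebreak]] by (meson asympD)
  next
    case False
    from overlap obtain s s' where s: "u \<in> subterms s" "lt (s' \<cdot> \<theta>) (s \<cdot> \<theta>)"
      and "Pos (Upair s s') \<in># C \<and> strictly_maximal_lit lt (Pos (Upair s s') \<cdot>l \<theta>) (C \<cdot>c \<theta>)
        \<or> Neg (Upair s s') \<in># C" unfolding ground_overlap_def by blast
    moreover have "Neg (Upair s s') \<notin># C"
    proof
      assume "Neg (Upair s s') \<in># C"
      then have "s \<in> ts_neg C" by (force simp: ts_neg_def)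
      then show False using False s(1) by (auto simp: ss_neg_def)
    qed
    ultimately have pos: "Pos (Upair s s') \<in># C"
      "strictly_maximal_lit lt (Pos (Upair s s') \<cdot>l \<theta>) (C \<cdot>c \<theta>)" by blast+
    then have "s \<in> ts_pos C" by (force simp: ts_pos_def)
    then have us: "u = s" using False s(1) by (auto simp: ss_pos_below_def subterms_conv_proper)
    have max: "max_eqn C \<theta> s s'"
      using pos s C horn_N by (simp add: max_eqn_def ground_closure_def)
    have "candidate (below lt (t \<cdot> \<theta>') RN) (t \<cdot> \<theta>') C \<theta> s s'"
      using counterexample_candidate[OF C(1) max C(3)] us u by simp
    then show False
      using D(2) RN.lt_closure_below[OF max _ maxD refl _ lt] us u RN_produced(1)[OF rule] by blast
  qed
qed

text \<open>A rule comes from a producing closure \<open>D\<close>, which can be renamed apart and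
  superposed into \<open>C\<close>. The conclusion is false, the rule lies in \<open>RN\<close> and
  the left premise is not the larger one, so the inference is not redundant, contradicting
  saturation.\<close>

lemma no_superposition:
  assumes sat: "saturated F lt lt_clo N" and C: "min_counterexample C \<theta>"
    and u: "\<not> is_Var u" "ground_overlap lt u C \<theta>"
  shows "(u \<cdot> \<theta>, v) \<notin> RN"
proof
  assume uv: "(u \<cdot> \<theta>, v) \<in> RN"
  have CN: "C \<in> N" and grC: "ground_cls F (C \<cdot>c \<theta>)" and false: "\<not> entails RN (C, \<theta>)"
    using C by (auto simp: min_counterexample_def ground_closure_def)
  obtain D \<theta>D t t' where cand: "candidate (below lt (u \<cdot> \<theta>) RN) (u \<cdot> \<theta>) D \<theta>D t t'"
    and v: "v = t' \<cdot> \<theta>D"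
    and min: "\<And>E \<tau> w w'. candidate (below lt (u \<cdot> \<theta>) RN) (u \<cdot> \<theta>) E \<tau> w w' \<Longrightarrow>
      \<not> lt_closure lt lt_clo (below lt (u \<cdot> \<theta>) RN) (E, \<tau>) (D, \<theta>D)"
    using RN_produced(2)[OF uv] unfolding produced_def by blast
  then have DN: "D \<in> N" and maxD: "max_eqn D \<theta>D t t'" and tu: "t \<cdot> \<theta>D = u \<cdot> \<theta>"
    by (auto simp: candidate_def)
  have tD: "Pos (Upair t t') \<in># D" and grD: "ground_cls F (D \<cdot>c \<theta>D)"
    using maxD by (auto simp: max_eqn_def ground_closure_def)
  obtain D0 where D0: "D = add_mset (Pos (Upair t t')) D0" using tD by (rule mset_add)
  obtain \<pi> :: "'v \<Rightarrow> 'v" where \<pi>: "bij \<pi>" and apart: "\<pi> ` vars_cls D \<inter> vars_cls C = {}"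
    using finite_renaming_apart[OF finite_vars_cls finite_vars_cls] .
  let ?\<rho> = "\<lambda>x. Var (\<pi> x)"
  \<comment> \<open>One substitution for both premises; off their variables it is the identity, so
    that it is well-formed everywhere.\<close>
  define \<theta>' where "\<theta>' x = (if x \<in> vars_cls C then \<theta> x
    else if x \<in> \<pi> ` vars_cls D then \<theta>D (inv \<pi> x) else Var x)" for x
  have agreeC: "\<theta>' x = \<theta> x" if "x \<in> vars_cls C" for x using that by (simp add: \<theta>'_def)
  have agreeD: "\<theta>' (\<pi> x) = \<theta>D x" if "x \<in> vars_cls D" for x
    using that apart \<pi> by (auto simp: \<theta>'_def bij_is_inj)
  have wf: "wf_trm F (\<theta>' x)" for x
    using ground_vars_cls[OF grC, of x] ground_vars_cls[OF grD] \<pi>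
    by (auto simp: \<theta>'_def ground_trm_def bij_is_inj)
  have C\<theta>: "C \<cdot>c \<theta>' = C \<cdot>c \<theta>" using subst_cls_cong agreeC by blast
  have D\<theta>: "D \<cdot>c ?\<rho> \<cdot>c \<theta>' = D \<cdot>c \<theta>D"
    unfolding subst_cls_comp subst_trm.simps using agreeD by (intro subst_cls_cong) auto
  have t\<theta>: "t \<cdot> ?\<rho> \<cdot> \<theta>' = t \<cdot> \<theta>D" "t' \<cdot> ?\<rho> \<cdot> \<theta>' = t' \<cdot> \<theta>D"
    unfolding subst_trm_comp subst_trm.simps
    using agreeD vars_clsI[OF tD] by (auto intro!: subst_trm_cong)
  have C': "min_counterexample C \<theta>'" using min_counterexample_cong[OF C] agreeC by simp
  obtain s s' where s: "u \<in> subterms s" "lt (s' \<cdot> \<theta>) (s \<cdot> \<theta>)"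
    and lit: "Pos (Upair s s') \<in># C \<and> strictly_maximal_lit lt (Pos (Upair s s') \<cdot>l \<theta>) (C \<cdot>c \<theta>)
        \<or> Neg (Upair s s') \<in># C \<and> maximal_lit lt (Neg (Upair s s') \<cdot>l \<theta>) (C \<cdot>c \<theta>)"
    using u(2) unfolding ground_overlap_def by blast
  have vars_s: "vars_trm s \<subseteq> vars_cls C" "vars_trm s' \<subseteq> vars_cls C"
    using lit by (auto intro: vars_clsI)
  have s\<theta>: "s \<cdot> \<theta>' = s \<cdot> \<theta>" "s' \<cdot> \<theta>' = s' \<cdot> \<theta>" "u \<cdot> \<theta>' = u \<cdot> \<theta>"
    using agreeC vars_s vars_subterms[OF s(1)] by (auto intro!: subst_trm_cong)
  let ?D = "D \<cdot>c ?\<rho>" and ?t = "t \<cdot> ?\<rho>" and ?t' = "t' \<cdot> ?\<rho>" and ?Drest = "D0 \<cdot>c ?\<rho>"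
  have unif: "?t \<cdot> \<theta>' = u \<cdot> \<theta>'" by (simp add: t\<theta> tu s\<theta>)
  obtain \<sigma> where \<sigma>: "is_mgu \<sigma> ?t u" using is_mgu_exists[OF unif] .
  note absorb = is_mgu_absorb[OF \<sigma> unif]
  \<comment> \<open>Applying \<open>\<sigma>\<close> and then \<open>\<theta>'\<close> gives the
    same ground instances as \<open>\<theta>'\<close> alone, so the order conditions known for the
    ground instances can be lifted to \<open>\<sigma>\<close>.\<close>
  have abs: "p \<cdot> \<sigma> \<cdot> \<theta>' = p \<cdot> \<theta>'" "L \<cdot>l \<sigma> \<cdot>l \<theta>' = L \<cdot>l \<theta>'" "E \<cdot>c \<sigma> \<cdot>c \<theta>' = E \<cdot>c \<theta>'" for p L E
    by (simp_all add: subst_trm_comp subst_lit_comp subst_cls_comp absorb)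
  have D0': "?D = add_mset (Pos (Upair ?t ?t')) ?Drest" by (simp add: D0)
  have disj: "vars_cls ?D \<inter> vars_cls C = {}"
    using apart by (simp add: vars_subst_cls UNION_singleton_eq_range)
  have lt_cls: "lt_cls lt (?D \<cdot>c \<theta>') (C \<cdot>c \<theta>')" if "u \<in> ss_neg C \<union> ss_pos_below C"
    unfolding C\<theta> D\<theta> using max_eqn_lt_cls[OF maxD grC that] tu by simp
  have maxt: "strictly_maximal_lit lt (Pos (Upair ?t ?t') \<cdot>l \<theta>') (?D \<cdot>c \<theta>')"
    using maxD by (simp add: D\<theta> t\<theta> max_eqn_def)
  have ltt: "lt (?t' \<cdot> \<theta>') (?t \<cdot> \<theta>')" using maxD by (simp add: t\<theta> max_eqn_def)
  have lit': "Pos (Upair s s') \<in># C \<and> strictly_maximal_lit lt (Pos (Upair s s') \<cdot>l \<theta>') (C \<cdot>c \<theta>')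
      \<or> Neg (Upair s s') \<in># C \<and> maximal_lit lt (Neg (Upair s s') \<cdot>l \<theta>') (C \<cdot>c \<theta>')"
    using lit by (simp add: s\<theta> C\<theta>)
  have lts: "lt (s' \<cdot> \<theta>') (s \<cdot> \<theta>')" using s(2) by (simp add: s\<theta>)
  have overlap': "ground_overlap lt u C \<theta>'" using s(1) lts lit' unfolding ground_overlap_def by blast
  let ?E = "(?Drest + replace_cls u ?t' C) \<cdot>c \<sigma>"
  let ?\<iota> = "ParSup ?D ?t ?t' C ?E"
  have "?\<iota> \<in> inferences lt"
  proof (rule par_sup_inference[OF D0' disj u(1) \<sigma>])
    show "\<not> (lt_cls lt)\<^sup>=\<^sup>= (C \<cdot>c \<sigma>) (?D \<cdot>c \<sigma>)" if "u \<in> ss_neg C \<union> ss_pos_below C"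
      using lt_cls[OF that] by (intro not_le_cls_lift[where \<theta> = \<theta>', OF _ wf]) (simp only: abs)
    show "strictly_maximal_lit lt (Pos (Upair ?t ?t') \<cdot>l \<sigma>) (?D \<cdot>c \<sigma>)"
    proof (rule strictly_maximal_lit_lift[where \<theta> = \<theta>', OF _ _ wf])
      show "strictly_maximal_lit lt (Pos (Upair ?t ?t') \<cdot>l \<sigma> \<cdot>l \<theta>') (?D \<cdot>c \<sigma> \<cdot>c \<theta>')"
        unfolding abs by (rule maxt)
      show "Pos (Upair ?t ?t') \<in># ?D" unfolding D0' by simp
    qed
    show "overlap lt u C \<sigma>"
      unfolding overlap_def
    proof (intro exI conjI)
      show "\<not> lt\<^sup>=\<^sup>= (s \<cdot> \<sigma>) (s' \<cdot> \<sigma>)"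
        using lts by (intro not_le_lift[where \<theta> = \<theta>', OF _ wf]) (simp only: abs)
      show "Pos (Upair s s') \<in># C \<and> strictly_maximal_lit lt (Pos (Upair s s') \<cdot>l \<sigma>) (C \<cdot>c \<sigma>)
          \<or> Neg (Upair s s') \<in># C \<and> maximal_lit lt (Neg (Upair s s') \<cdot>l \<sigma>) (C \<cdot>c \<sigma>)"
        using lit' strictly_maximal_lit_lift[where \<theta> = \<theta>', OF _ _ wf, of "Pos (Upair s s')" \<sigma> C]
          maximal_lit_lift[where \<theta> = \<theta>', OF _ _ wf, of "Neg (Upair s s')" \<sigma> C]
        unfolding abs by blast
    qed (rule s(1))
    show "\<not> lt\<^sup>=\<^sup>= (?t \<cdot> \<sigma>) (?t' \<cdot> \<sigma>)"
      using ltt by (intro not_le_lift[where \<theta> = \<theta>', OF _ wf]) (simp only: abs)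
  qed
  moreover have "variant C C" "variant D ?D"
    using variant_refl \<pi> by (auto simp: variant_def)
  ultimately have "?\<iota> \<in> inferences_from lt N"
    using CN DN by (auto simp: inferences_from_def)
  moreover have "map_inference id (\<lambda>C. (C, \<theta>')) ?\<iota> \<in> ground_inferences F lt"
    using ground_inferences.par_sup_I[OF _ _ D0' disj u(1) unif \<sigma> lt_cls overlap' maxt ltt, of F]
      grC grD unfolding ground_closure_def inst.simps C\<theta> D\<theta> by simp
  ultimately consider "entails RN (?E, \<theta>')" | "(?t \<cdot> \<theta>', ?t' \<cdot> \<theta>') \<notin> RN"
    | "lt_closure lt lt_clo RN (C, \<theta>') (?D, \<theta>')"
    using redundant_inference[OF sat, of ?\<iota> \<theta>'] C' by auto
  then show False
  proof cases
    \<comment> \<open>Replacing \<open>u\<close> preserves truth under \<open>RN\<close>, so a true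
      conclusion would make \<open>C\<close> or the rest of \<open>D\<close> true.\<close>
    case 1
    have "(u \<cdot> \<theta>', ?t' \<cdot> \<theta>') \<in> RN" using uv v by (simp add: s\<theta> t\<theta>)
    then have "true_cls (equivclp (rstep RN)) (?Drest \<cdot>c \<theta>') \<or> true_cls (equivclp (rstep RN)) (C \<cdot>c \<theta>')"
      using 1 true_replace_cls[of u \<theta>' ?t' RN C] by (simp add: entails_def abs true_cls_union)
    moreover have "?Drest \<cdot>c \<theta>' = D0 \<cdot>c \<theta>D"
      unfolding subst_cls_comp subst_trm.simps using agreeD D0
      by (intro subst_cls_cong) (auto simp: vars_cls_def trms_cls_def)
    ultimately show False
      using false candidate_rest_false[of "u \<cdot> \<theta>" t t' D0 \<theta>D] cand D0
      by (simp add: entails_def C\<theta>)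
  next
    case 2
    then show False using uv v by (simp add: t\<theta> tu)
  next
    \<comment> \<open>The comparison concerns the renamed left premise under the shared
      substitution; it is transported back to the original closures.\<close>
    case 3
    have nmC: "nm RN (C, \<theta>') = nm RN (C, \<theta>)" and same: "same_closure (C, \<theta>') (C, \<theta>)"
      using agreeC by (auto intro: nm_cong same_closure_cong)
    have "nm RN (?D, \<theta>') = nm RN (D, \<theta>D)"
      using nm_renaming[OF \<pi>, of RN D \<theta>'] nm_cong[of D "\<lambda>x. \<theta>' (\<pi> x)" \<theta>D] agreeD by simp
    moreover have "same_closure (?D, \<theta>') (D, \<theta>D)"
      using same_closure_renaming[OF \<pi>, of D \<theta>'] D\<theta> by (simp add: same_closure_def)
    ultimately have "lt_closure lt lt_clo RN (C, \<theta>) (D, \<theta>D)"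
      using lt_closure_cong[OF tiebreak same nmC _ _ 3] by blast
    moreover have "\<not> lt_closure lt lt_clo RN (C, \<theta>) (D, \<theta>D)"
    proof (rule left_premise_not_larger[OF CN grC false])
      show "candidate (below lt (t \<cdot> \<theta>D) RN) (t \<cdot> \<theta>D) D \<theta>D t t'"
        unfolding tu by (rule cand)
      show "\<not> lt_closure lt lt_clo (below lt (t \<cdot> \<theta>D) RN) (E, \<tau>) (D, \<theta>D)"
        if "candidate (below lt (t \<cdot> \<theta>D) RN) (t \<cdot> \<theta>D) E \<tau> w w'" for E \<tau> w w'
        using min that unfolding tu by blast
      show "(t \<cdot> \<theta>D, t' \<cdot> \<theta>D) \<in> RN" using uv unfolding tu v .
    qed (use tu u(2) in simp_all)
    ultimately show False by blast
  qed
qed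

text \<open>A maximal literal of the false instance is examined. If it is negative, its equation
  holds in \<open>RN\<close>: equal sides admit Equality Resolution, different sides make the larger
  one reducible. If it is positive, its sides differ and \<open>C\<close> is a candidate, so again
  the larger side is reducible, which contradicts \<open>no_superposition\<close>.\<close>

lemma saturated_counterexample_empty:
  assumes sat: "saturated F lt lt_clo N" and C: "min_counterexample C \<theta>"
  shows "C = {#}"
proof (rule ccontr)
  assume "C \<noteq> {#}"
  have CN: "C \<in> N" and grC: "ground_cls F (C \<cdot>c \<theta>)" and false: "\<not> entails RN (C, \<theta>)"
    using C by (auto simp: min_counterexample_def ground_closure_def)
  \<comment> \<open>A redex in the larger side cannot come from the irreducible substitution, so it
    lies at a non-variable position, where \<open>no_superposition\<close> applies.\<close>
  have irreducible_s: "irreducible RN (s \<cdot> \<theta>)"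
    if "lt (s' \<cdot> \<theta>) (s \<cdot> \<theta>)" and
      "Pos (Upair s s') \<in># C \<and> strictly_maximal_lit lt (Pos (Upair s s') \<cdot>l \<theta>) (C \<cdot>c \<theta>)
        \<or> Neg (Upair s s') \<in># C \<and> maximal_lit lt (Neg (Upair s s') \<cdot>l \<theta>) (C \<cdot>c \<theta>)" for s s'
    unfolding irreducible_iff
  proof clarify
    fix l r assume lr: "(l, r) \<in> RN" "l \<in> subterms (s \<cdot> \<theta>)"
    have "vars_trm s \<subseteq> vars_cls C" using that(2) by (auto intro: vars_clsI)
    then have "l \<notin> subterms (\<theta> x)" if "x \<in> vars_trm s" for x
      using min_counterexample_irreducible[OF C, of x] lr(1) that by (auto simp: irreducible_iff)
    then obtain u where u: "u \<in> subterms s" "\<not> is_Var u" "u \<cdot> \<theta> = l"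
      using subst_subterm_redex[OF lr(2)] by blast
    have "ground_overlap lt u C \<theta>" using that u(1) unfolding ground_overlap_def by blast
    then show False using no_superposition[OF sat C u(2)] u(3) lr(1) by blast
  qed
  have "\<exists>M \<in> set_mset (C \<cdot>c \<theta>). \<forall>K \<in> set_mset (C \<cdot>c \<theta>). K \<noteq> M \<longrightarrow> \<not> lt_lit lt M K"
    using \<open>C \<noteq> {#}\<close> transp_lt_lit wfp_imp_asymp[OF wfp_lt_lit]
    by (intro Finite_Set.bex_max_element)
      (auto simp: subst_cls_def intro: transp_on_subset asymp_on_subset)
  then obtain M where M: "M \<in># C \<cdot>c \<theta>" "\<And>K. K \<in># C \<cdot>c \<theta> \<Longrightarrow> \<not> lt_lit lt M K"
    using wfp_imp_irreflp[OF wfp_lt_lit] by (metis irreflpD)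
  then obtain L where L: "L \<in># C" "M = L \<cdot>l \<theta>" by (auto simp: subst_cls_def)
  have max: "maximal_lit lt (L \<cdot>l \<theta>) (C \<cdot>c \<theta>)"
    using M L(2) by (auto simp: maximal_lit_def dest: in_diffD)
  show False
  proof (cases L rule: literal_cases)
    case (Neg s s')
    \<comment> \<open>Stated for fresh \<open>s\<close> and \<open>s'\<close>, so that it covers
      both orientations of the unordered equation.\<close>
    have contra: False if s: "Neg (Upair s s') \<in># C" "L = Neg (Upair s s')" "lt (s' \<cdot> \<theta>) (s \<cdot> \<theta>)" for s s'
    proof -
      have irr: "irreducible RN (s \<cdot> \<theta>)" using irreducible_s[OF s(3)] s max by blast
      have "equivclp (rstep RN) (s \<cdot> \<theta>) (s' \<cdot> \<theta>)"
        using false_lit[OF false s(1)] by (simp add: true_lit_equivclp del: true_lit.simps)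
      then obtain z where "(rstep RN)\<^sup>*\<^sup>* (s \<cdot> \<theta>) z" and z: "(rstep RN)\<^sup>*\<^sup>* (s' \<cdot> \<theta>) z"
        by (auto simp: RN.equivclp_join)
      \<comment> \<open>As \<open>s \<cdot> \<theta>\<close> is irreducible,
        \<open>s' \<cdot> \<theta>\<close> rewrites to it and cannot be smaller.\<close>
      then have "z = s \<cdot> \<theta>" using RN.irreducible_rsteps irr by blast
      then have "lt\<^sup>=\<^sup>= (s \<cdot> \<theta>) (s' \<cdot> \<theta>)"
        using RN.rsteps_ground[OF z] ground_lit(2)[OF grC] s(1) by blast
      then show False using s(3) lt_asym lt_irrefl by auto
    qed
    have "s \<cdot> \<theta> \<noteq> s' \<cdot> \<theta>" using no_equality_resolution[OF sat C] L(1) Neg max by blast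
    then have "lt (s' \<cdot> \<theta>) (s \<cdot> \<theta>) \<or> lt (s \<cdot> \<theta>) (s' \<cdot> \<theta>)"
      using lt_total ground_lit[OF grC] L(1) Neg by blast
    moreover have "L = Neg (Upair s' s)" using Neg by simp
    ultimately show False using contra[of s s'] contra[of s' s] L(1) Neg by metis
  next
    case (Pos s s')
    obtain C0 where C0: "C = add_mset L C0" using L(1) by (rule mset_add)
    \<comment> \<open>The remaining literals of a Horn clause are negative, so none of them equals
      the positive literal \<open>L\<close> and maximality is strict.\<close>
    have smax: "strictly_maximal_lit lt (L \<cdot>l \<theta>) (C \<cdot>c \<theta>)"
      unfolding strictly_maximal_lit_def
    proof (intro conjI ballI)
      show "L \<cdot>l \<theta> \<in># C \<cdot>c \<theta>" using L(1) by (rule subst_cls_memberI)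
      fix K assume K: "K \<in># C \<cdot>c \<theta> - {#L \<cdot>l \<theta>#}"
      then obtain K' where K': "K' \<in># C0" "K = K' \<cdot>l \<theta>" by (auto simp: C0 subst_cls_def)
      have "horn (add_mset (Pos (Upair s s')) C0)" using horn_N[OF CN] C0 Pos by simp
      then obtain q r where "K' = Neg (Upair q r)" using K'(1) by (rule horn_add_Pos)
      then show "\<not> (lt_lit lt (L \<cdot>l \<theta>) K \<or> L \<cdot>l \<theta> = K)"
        using M(2) L(2) K K' Pos by (auto dest: in_diffD)
    qed
    have contra: False if s: "Pos (Upair s s') \<in># C" "L = Pos (Upair s s')" "lt (s' \<cdot> \<theta>) (s \<cdot> \<theta>)" for s s'
    proof -
      have irr: "irreducible RN (s \<cdot> \<theta>)" using irreducible_s[OF s(3)] s smax by blast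
      have "max_eqn C \<theta> s s'"
        using s smax CN grC horn_N by (simp add: max_eqn_def ground_closure_def)
      from candidate_reducible[OF counterexample_candidate[OF CN this false]] irr show False by blast
    qed
    have "\<not> equivclp (rstep RN) (s \<cdot> \<theta>) (s' \<cdot> \<theta>)"
      using false_lit[OF false L(1)] Pos by (simp add: true_lit_equivclp del: true_lit.simps)
    then have "s \<cdot> \<theta> \<noteq> s' \<cdot> \<theta>" by auto
    then have "lt (s' \<cdot> \<theta>) (s \<cdot> \<theta>) \<or> lt (s \<cdot> \<theta>) (s' \<cdot> \<theta>)"
      using lt_total ground_lit[OF grC] L(1) Pos by blast
    moreover have "L = Pos (Upair s' s)" using Pos by simp
    ultimately show False using contra[of s s'] contra[of s' s] L(1) Pos by metis
  qed
qed

lemma saturated_entails: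
  assumes "saturated F lt lt_clo N" "{#} \<notin> N" "c \<in> closures"
  shows "entails RN c"
proof (rule ccontr)
  assume "\<not> entails RN c"
  then obtain C \<theta> where "min_counterexample C \<theta>" using min_counterexample_exists assms(3) by blast
  then show False
    using saturated_counterexample_empty[OF assms(1)] assms(2) by (auto simp: min_counterexample_def)
qed

end

section \<open>Models\<close>

lemma true_cls_cong:
  assumes "\<And>s t. s \<in> trms_cls C \<Longrightarrow> t \<in> trms_cls C \<Longrightarrow> E s t \<longleftrightarrow> E' s t"
  shows "true_cls E C \<longleftrightarrow> true_cls E' C"
proof -
  have "true_lit E L \<longleftrightarrow> true_lit E' L" if "L \<in># C" for L
  proof (cases L rule: literal_cases)
    case (Pos s t)
    then have "s \<in> trms_cls C" "t \<in> trms_cls C" using that by (force simp: trms_cls_def)+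
    then show ?thesis using Pos assms by auto
  next
    case (Neg s t)
    then have "s \<in> trms_cls C" "t \<in> trms_cls C" using that by (force simp: trms_cls_def)+
    then show ?thesis using Neg assms by auto
  qed
  then show ?thesis by (simp add: true_cls_def)
qed

lemma true_cls_subst:
  assumes "symp E"
  shows "true_cls E (C \<cdot>c \<sigma>) \<longleftrightarrow> true_cls (\<lambda>s t. E (s \<cdot> \<sigma>) (t \<cdot> \<sigma>)) C"
proof -
  have "symp (\<lambda>s t. E (s \<cdot> \<sigma>) (t \<cdot> \<sigma>))" using assms by (auto intro: sympI dest: sympD)
  then have "true_lit E (L \<cdot>l \<sigma>) \<longleftrightarrow> true_lit (\<lambda>s t. E (s \<cdot> \<sigma>) (t \<cdot> \<sigma>)) L" for L
    using true_lit_simps[OF assms]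
    by (cases L rule: literal_cases) (simp_all add: true_lit_simps del: true_lit.simps)
  then show ?thesis by (simp add: true_cls_def subst_cls_def)
qed

lemma eval_cong: "(\<And>x. x \<in> vars_trm t \<Longrightarrow> \<beta> x = \<beta>' x) \<Longrightarrow> eval I \<beta> t = eval I \<beta>' t"
proof (induction t)
  case (Fun f ts)
  then have "map (eval I \<beta>) ts = map (eval I \<beta>') ts" by auto
  then show ?case by (simp only: eval.simps)
qed simp

lemma eval_subst: "eval I \<beta> (t \<cdot> \<sigma>) = eval I (\<lambda>x. eval I \<beta> (\<sigma> x)) t"
proof (induction t)
  case (Fun f ts)
  then have "map (eval I \<beta>) (map (\<lambda>t. t \<cdot> \<sigma>) ts) = map (eval I (\<lambda>x. eval I \<beta> (\<sigma> x))) ts" by auto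
  then show ?case by (simp only: eval.simps subst_trm.simps)
qed simp

lemma symp_eval: "symp (\<lambda>s t. eval I \<beta> s = eval I \<beta> t)"
  by (auto intro: sympI)

lemma true_cls_eval_subst:
  "true_cls (\<lambda>s t. eval I \<beta> s = eval I \<beta> t) (C \<cdot>c \<theta>) \<longleftrightarrow>
   true_cls (\<lambda>s t. eval I (\<lambda>x. eval I \<beta> (\<theta> x)) s = eval I (\<lambda>x. eval I \<beta> (\<theta> x)) t) C"
  by (simp add: true_cls_subst[OF symp_eval] eval_subst)

lemma true_cls_eval_cong:
  assumes "\<And>x. x \<in> vars_cls C \<Longrightarrow> \<beta> x = \<beta>' x"
  shows "true_cls (\<lambda>s t. eval I \<beta> s = eval I \<beta> t) C \<longleftrightarrow> true_cls (\<lambda>s t. eval I \<beta>' s = eval I \<beta>' t) C"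
proof -
  have "eval I \<beta> t = eval I \<beta>' t" if "t \<in> trms_cls C" for t
    using that assms by (intro eval_cong) (auto simp: vars_cls_def)
  then show ?thesis by (intro true_cls_cong) simp
qed

lemma eval_in_universe:
  assumes "is_algebra F U I" and "wf_trm F t" and "\<And>x. x \<in> vars_trm t \<Longrightarrow> \<beta> x \<in> U"
  shows "eval I \<beta> t \<in> U"
  using assms(2,3)
proof (induction t)
  case (Fun f ts)
  then have "set (map (eval I \<beta>) ts) \<subseteq> U" "length (map (eval I \<beta>) ts) = length ts" by auto
  moreover have "(f, length ts) \<in> F" using Fun.prems by simp
  ultimately have "I f (map (eval I \<beta>) ts) \<in> U"
    using assms(1) unfolding is_algebra_def by fastforce
  then show ?case by simp
qed simp

text \<open>Normalizing the arguments first does not change the normal form of a compound ground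
  term.\<close>

lemma (in admissible_trs) eval_normal_form:
  assumes "ground_trm F t"
  shows "eval (\<lambda>f ts. normal_form R (Fun f ts)) \<beta> t = normal_form R t"
  using assms
proof (induction t)
  case (Fun f ts)
  let ?I = "\<lambda>f ts. normal_form R (Fun f ts)"
  have g: "ground_trm F t" if "t \<in> set ts" for t using Fun.prems that by (simp add: ground_Fun)
  then have "map (eval ?I \<beta>) ts = map (normal_form R) ts" using Fun.IH by simp
  then have "eval ?I \<beta> (Fun f ts) = normal_form R (Fun f (map (normal_form R) ts))"
    by (simp only: eval.simps)
  also have "\<dots> = normal_form R (Fun f ts)"
  proof -
    have "(rstep R)\<^sup>*\<^sup>* (Fun f (map (\<lambda>t. t) ts)) (Fun f (map (normal_form R) ts))"
      by (rule rsteps_args) (use normal_form g in auto)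
    then show ?thesis using normal_form_rsteps[OF Fun.prems] by simp
  qed
  finally show ?case .
qed (simp add: ground_trm_def)

text \<open>The algebra of normal forms. Its universe may be all terms, since evaluating the sides
  of a ground clause yields normal forms of ground terms, whose equality coincides with
  convertibility.\<close>

lemma (in admissible_trs) model_of_entailed:
  assumes "\<And>c. c \<in> M \<Longrightarrow> ground_closure F c \<and> entails R c"
  shows "model F UNIV (\<lambda>f ts. normal_form R (Fun f ts)) (inst ` M)"
  unfolding model_def
proof (intro conjI ballI allI impI)
  let ?I = "\<lambda>f ts. normal_form R (Fun f ts)"
  show "is_algebra F UNIV ?I" by (simp add: is_algebra_def)
  fix C \<beta> assume "C \<in> inst ` M"
  then have gr: "ground_cls F C" and true: "true_cls (equivclp (rstep R)) C"
    using assms by (auto simp: ground_closure_def entails_def)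
  have "true_cls (equivclp (rstep R)) C \<longleftrightarrow> true_cls (\<lambda>s t. eval ?I \<beta> s = eval ?I \<beta> t) C"
    by (rule true_cls_cong)
      (use gr equivclp_normal_form eval_normal_form in \<open>simp add: ground_cls_def\<close>)
  then show "true_cls (\<lambda>s t. eval ?I \<beta> s = eval ?I \<beta> t) C" using true by blast
qed

text \<open>By the substitution lemma, an assignment for a ground instance induces one for the
  clause itself.\<close>

lemma model_ground_closures:
  fixes N :: "('f, 'v) cls set" and U :: "'a set"
  assumes "model F U I N"
  shows "model F U I (inst ` ground_closures F N)"
  unfolding model_def
proof (intro conjI ballI allI impI)
  show alg: "is_algebra F U I" using assms by (simp add: model_def)
  fix D and \<beta> :: "'v \<Rightarrow> 'a"
  assume D: "D \<in> inst ` ground_closures F N" and \<beta>: "range \<beta> \<subseteq> U"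
  then obtain C \<theta> where C: "C \<in> N" "D = C \<cdot>c \<theta>" "ground_cls F (C \<cdot>c \<theta>)"
    by (auto simp: ground_closures_def ground_closure_def)
  \<comment> \<open>Off the variables of \<open>C\<close>, \<open>\<theta>\<close> may have
    ill-formed values whose evaluation could leave \<open>U\<close>; there \<open>\<beta>\<close> is
    kept.\<close>
  define \<gamma> where "\<gamma> x = (if x \<in> vars_cls C then eval I \<beta> (\<theta> x) else \<beta> x)" for x
  have "wf_trm F (\<theta> x)" if x: "x \<in> vars_cls C" for x
  proof -
    obtain t where "t \<in> trms_cls C" "x \<in> vars_trm t" using x by (auto simp: vars_cls_def)
    then show ?thesis
      using C(3) wf_subst_trmD[of F t \<theta> x] by (auto simp: ground_cls_def trms_subst_cls ground_trm_def)
  qed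
  then have "range \<gamma> \<subseteq> U"
    using \<beta> by (auto simp: \<gamma>_def intro!: eval_in_universe[OF alg])
  then have "true_cls (\<lambda>s t. eval I \<gamma> s = eval I \<gamma> t) C"
    using assms C(1) by (auto simp: model_def)
  then have "true_cls (\<lambda>s t. eval I (\<lambda>x. eval I \<beta> (\<theta> x)) s = eval I (\<lambda>x. eval I \<beta> (\<theta> x)) t) C"
    by (subst true_cls_eval_cong[where \<beta>' = \<gamma>]) (simp_all add: \<gamma>_def)
  then show "true_cls (\<lambda>s t. eval I \<beta> s = eval I \<beta> t) D"
    by (simp add: C(2) true_cls_eval_subst)
qed

text \<open>In the subalgebra of values of ground terms every assignment is induced by a ground
  substitution, so truth of all ground instances gives truth of the clauses. The constant makes this
  universe nonempty.\<close>

lemma model_generated_subalgebra: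
  fixes N :: "('f, 'v) cls set" and U :: "'a set"
  assumes "model F U I (inst ` ground_closures F N)" and const: "(c, 0) \<in> F"
    and wf: "\<And>C. C \<in> N \<Longrightarrow> wf_cls F C"
  shows "\<exists>U' :: 'a set. model F U' I N"
proof -
  have alg: "is_algebra F U I" using assms(1) by (simp add: model_def)
  then obtain a where "a \<in> U" by (auto simp: is_algebra_def)
  \<comment> \<open>Ground terms contain no variables, so any fixed element can serve as the
    assignment.\<close>
  let ?a = "\<lambda>_. a"
  let ?U = "eval I ?a ` {t :: ('f, 'v) trm. ground_trm F t}"
  have "model F ?U I N"
    unfolding model_def
  proof (intro conjI ballI allI impI)
    have "ground_trm F (Fun c [])" using const by (simp add: ground_Fun)
    moreover have "I f as \<in> ?U" if "(f, length as) \<in> F" "set as \<subseteq> ?U" for f as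
    proof -
      have "\<forall>b \<in> set as. \<exists>t :: ('f, 'v) trm. ground_trm F t \<and> eval I ?a t = b"
        using that(2) by fastforce
      from bchoice[OF this] obtain h :: "'a \<Rightarrow> ('f, 'v) trm"
        where h: "\<forall>b \<in> set as. ground_trm F (h b) \<and> eval I ?a (h b) = b" by blast
      then have "map (eval I ?a) (map h as) = as" by (simp add: map_idI)
      then have "eval I ?a (Fun f (map h as)) = I f as" by (simp only: eval.simps)
      moreover have "ground_trm F (Fun f (map h as))" using h that(1) by (simp add: ground_Fun)
      ultimately show ?thesis by (metis (mono_tags, lifting) imageI mem_Collect_eq)
    qed
    ultimately show "is_algebra F ?U I" unfolding is_algebra_def by blast
    fix C and \<beta> :: "'v \<Rightarrow> 'a"
    assume C: "C \<in> N" and "range \<beta> \<subseteq> ?U"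
    then have "\<beta> x \<in> ?U" for x by blast
    then have "\<forall>x. \<exists>t :: ('f, 'v) trm. ground_trm F t \<and> eval I ?a t = \<beta> x"
      by (metis (mono_tags, lifting) imageE mem_Collect_eq)
    from choice[OF this] obtain \<theta> :: "'v \<Rightarrow> ('f, 'v) trm"
      where "\<forall>x. ground_trm F (\<theta> x) \<and> eval I ?a (\<theta> x) = \<beta> x" ..
    then have \<theta>: "ground_trm F (\<theta> x)" "eval I ?a (\<theta> x) = \<beta> x" for x by auto
    have "ground_trm F (t \<cdot> \<theta>)" if "t \<in> trms_cls C" for t
      using that wf[OF C] \<theta>(1)
      by (auto simp: ground_trm_def wf_cls_def vars_subst_trm intro!: wf_subst_trm)
    then have "C \<cdot>c \<theta> \<in> inst ` ground_closures F N"
      using C by (force simp: ground_closures_def ground_closure_def ground_cls_def trms_subst_cls)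
    then have "true_cls (\<lambda>s t. eval I ?a s = eval I ?a t) (C \<cdot>c \<theta>)"
      using assms(1) \<open>a \<in> U\<close> unfolding model_def by auto
    then show "true_cls (\<lambda>s t. eval I \<beta> s = eval I \<beta> t) C"
      by (simp add: true_cls_eval_subst \<theta>(2))
  qed
  then show ?thesis by blast
qed

theorem theorem2:
  fixes F :: "'f signature"
    and lt :: "('f, 'v :: infinite) trm \<Rightarrow> ('f, 'v) trm \<Rightarrow> bool"
    and lt_clo :: "('f, 'v) closure \<Rightarrow> ('f, 'v) closure \<Rightarrow> bool"
    and N :: "('f, 'v) cls set"
  assumes "reduction_ordering F lt" and "total_on_ground F lt"
    and "tiebreak_ordering F lt_clo"
    and "\<forall>C \<in> N. wf_cls F C \<and> horn C"
    and "saturated F lt lt_clo N"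
  shows "(unsatisfiable F (inst ` ground_closures F N) \<longrightarrow> {#} \<in> N)
    \<and> ((\<exists>c. (c, 0) \<in> F) \<longrightarrow>
         (unsatisfiable F N \<longleftrightarrow> unsatisfiable F (inst ` ground_closures F N)))"
proof (intro conjI impI)
  interpret horn_clauses_inf F lt lt_clo N
    using assms(1-4) by unfold_locales auto
  assume unsat: "unsatisfiable F (inst ` ground_closures F N)"
  show "{#} \<in> N"
  proof (rule ccontr)
    assume "{#} \<notin> N"
    \<comment> \<open>Without \<open>\<bottom>\<close> no ground closure is false in
      \<open>RN\<close>, so the algebra of normal forms is a model.\<close>
    then have "model F UNIV (\<lambda>f ts. normal_form RN (Fun f ts)) (inst ` ground_closures F N)"
      using saturated_entails[OF assms(5)]
      by (intro RN.model_of_entailed) (auto simp: ground_closures_def)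
    then show False using unsat unfolding unsatisfiable_def by blast
  qed
next
  assume "\<exists>c. (c, 0) \<in> F"
  \<comment> \<open>A model of \<open>N\<close> also satisfies its ground closures, and a model of
    these restricts to one of \<open>N\<close> on the values of ground terms. Both directions keep
    the type of the universe.\<close>
  then show "unsatisfiable F N \<longleftrightarrow> unsatisfiable F (inst ` ground_closures F N)"
    using model_ground_closures model_generated_subalgebra assms(4)
    unfolding unsatisfiable_def by metis
qed

end
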